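(* Let $M \geq 3$ be an integer, $d = 1/M$, and let $f \in W^{2,2}(0,1)$. Let the observation points $x_1,\dots,x_N$ be independent and identically distributed random variables with sample space $[0,1]$, cumulative distribution function $F$, and probability density function $\rho$ that is continuous on $[0,1]$. Let $y_i = f(x_i)+\eta_i$, $1\le i\le N$, where $\eta_1,\dots,\eta_N$ are random variables with $\mathbb{E}[\eta_i] = 0$, $\mathbb{E}[\eta_i\eta_j] = \sigma^2\delta_{ij}$, and where the random sequences $\{x_i\}_{i=1}^N$ and $\{\eta_i\}_{i=1}^N$ are independent. Suppose $$\sup_{x\in[0,1]}\rho(x) \leq \beta.$$ Let $K_\ast = 32$, let $p,q$ be nonnegative integers with $0 \leq p < q \leq M$ and $q-p \geq 2\sqrt{K_\ast}$, and put $I' = (pd,qd)$. Choose the regularization parameter $\alpha_N = M\sigma^2/N + d^4$, and suppose $$\inf_{x\in I'}\rho(x) \geq \gamma > 0.$$ Let $f_N$ be the minimizer of $J(\cdot\,;\alpha_N,\bm{y}_N)$ over $V_M$, where $\bm{y}_N=(y_1,\dots,y_N)^\top$, and let $e_N = f_N - f$. Then for arbitrary $\delta\in(0,1)$, provided that $$N \geq \max\Big\{M, \frac{8\ln(4/\delta)}{\gamma^2 d^2}\Big\},$$ the estimates $$\Vert e_N \Vert_{L^2(I')} \leq C_1' \Big( \frac{M \sigma^2}{N} \Big)^{\frac12} + C_2' M^{-2}, \qquad \Vert e_N' \Vert_{L^2(I')} \leq C_3' \Big( \frac{M \sigma^2}{N} \Big)^{\frac14} + C_4' M^{-1}$$ hold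 with a probability of at least $1-\delta$, where the constants $C_1', C_2', C_3', C_4'$ are independent of $M$ and $N$. Denoting by $K_\sigma$ the Sobolev constant $K(\epsilon_0,|I'|)$ with $\epsilon_0 = \max\{\sqrt\sigma,(q-p)d\}$, the constants can be written as $$C_1' = 2\sqrt2\,\gamma^{-\frac12}\Vert f''\Vert_{L^2(0,1)} + \frac{8}{\sqrt{\delta\gamma}},$$ $$C_2' = \Vert f''\Vert_{L^2(0,1)}\sqrt{\frac{18\beta+8}{\gamma} + 72K_\ast^2\beta + 64K_\ast^2} + 4\sqrt2\,K_\ast\delta^{-\frac12},$$ $$C_3' = K_\sigma^{\frac12}\Big(\Vert f''\Vert_{L^2(0,1)}\sqrt{8\gamma^{-1}+\tfrac92\beta+4} + \delta^{-\frac12}\sqrt{64\gamma^{-1}+2}\Big),$$ $$C_4' = K_\sigma^{\frac12}\Big(\Vert f''\Vert_{L^2(0,1)}\sqrt{\frac{9\beta+4}{2K_\ast\gamma}+36K_\ast\beta+32K_\ast} + 4\delta^{-\frac12}K_\ast^{\frac12}\Big).$$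
   Context: Functions in $W^{2,2}(0,1)$ are identified with their $C^1[0,1]$ representatives. $\sigma \ge 0$ denotes the standard deviation of the noise (its variance is $\sigma^2$) and $\delta_{ij}$ is the Kronecker symbol. Spline space: for a positive integer $M$ and $d = 1/M$, $V_M$ is the $(M+3)$-dimensional space of cubic splines on $[0,1]$ with knots $p_j = jd$, $0 \le j \le M$, i.e. of functions in $C^2[0,1]$ that are polynomials of degree at most $3$ on each $[(j-1)d, jd]$. Tikhonov functional: for $g \in W^{2,2}(0,1)$, $\alpha>0$ and $\bm{z}=(z_1,\dots,z_N)^\top\in\mathbb{R}^N$, $$J(g;\alpha,\bm{z}) = \frac1N \sum_{i=1}^N (g(x_i) - z_i)^2 + \alpha \Vert g'' \Vert_{L^2(0,1)}^2 .$$ It has a unique minimizer over $V_M$ whenever $N \ge 2$ and the $x_i$ are not all identical. Sobolev constant: for a bounded interval $I_s$ and $\epsilon_0>0$, a Sobolev constant $K(\epsilon_0,|I_s|)$ is a constant $K$ such that for all $u \in W^{2,2}(I_s)$ and all $\epsilon \in (0,\epsilon_0]$, $\Vert u' \Vert_{L^2(I_s)}^2 \le K\big(\epsilon^{-2}\Vert u \Vert_{L^2(I_s)}^2 + \epsilon^2 \Vert u'' \Vert_{L^2(I_s)}^2\big)$. If $\epsilon_0 = |I_s|$, the constant $K_\ast = 32$ may be used. *)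

theory Defs
  imports
    "HOL-Probability.Probability"
    "HOL-Computational_Algebra.Polynomial"
begin

text \<open>
  A function on an interval is a total function \<open>real \<Rightarrow> real\<close>; no definition below depends on
  values outside the (closed) interval in question.
\<close>

subsection \<open>The Sobolev space $W^{2,2}(a,b)$\<close>

definition square_integrable :: "real \<Rightarrow> real \<Rightarrow> (real \<Rightarrow> real) \<Rightarrow> bool" where
  "square_integrable a b u \<longleftrightarrow>
     set_borel_measurable lborel {a<..<b} u \<and> set_integrable lborel {a<..<b} (\<lambda>t. (u t)\<^sup>2)"

definition L2norm :: "real \<Rightarrow> real \<Rightarrow> (real \<Rightarrow> real) \<Rightarrow> real" where
  "L2norm a b u = sqrt (set_lebesgue_integral lborel {a<..<b} (\<lambda>t. (u t)\<^sup>2))"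

text \<open>
  One-sided derivatives are used at boundary points of the set, so that for \<open>S = {a..b}\<close> this is
  membership in $C^k[a,b]$.
\<close>
definition Ck_on :: "nat \<Rightarrow> real set \<Rightarrow> (real \<Rightarrow> real) \<Rightarrow> bool" where
  "Ck_on k S g \<longleftrightarrow>
     (\<exists>D :: nat \<Rightarrow> real \<Rightarrow> real. D 0 = g \<and>
        (\<forall>i<k. \<forall>t\<in>S. (D i has_real_derivative D (Suc i) t) (at t within S)) \<and>
        continuous_on S (D k))"

definition test_function :: "real \<Rightarrow> real \<Rightarrow> (real \<Rightarrow> real) \<Rightarrow> bool" where
  "test_function a b \<phi> \<longleftrightarrow>
     (\<forall>k t. (deriv ^^ k) \<phi> field_differentiable at t) \<and>
     compact (closure {t. \<phi> t \<noteq> 0}) \<and> closure {t. \<phi> t \<noteq> 0} \<subseteq> {a<..<b}"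

definition has_weak_deriv :: "nat \<Rightarrow> real \<Rightarrow> real \<Rightarrow> (real \<Rightarrow> real) \<Rightarrow> (real \<Rightarrow> real) \<Rightarrow> bool" where
  "has_weak_deriv k a b u w \<longleftrightarrow>
     (\<forall>\<phi>. test_function a b \<phi> \<longrightarrow>
        set_lebesgue_integral lborel {a<..<b} (\<lambda>t. u t * (deriv ^^ k) \<phi> t) =
        (-1) ^ k * set_lebesgue_integral lborel {a<..<b} (\<lambda>t. w t * \<phi> t))"

text \<open>The weak derivative is determined only almost everywhere; this is some representative.\<close>
definition weak_deriv :: "nat \<Rightarrow> real \<Rightarrow> real \<Rightarrow> (real \<Rightarrow> real) \<Rightarrow> real \<Rightarrow> real" where
  "weak_deriv k a b u = (SOME w. square_integrable a b w \<and> has_weak_deriv k a b u w)"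

text \<open>The condition \<open>Ck_on 1\<close> says that \<open>u\<close> is the $C^1[a,b]$ representative of its class.\<close>
definition W22 :: "real \<Rightarrow> real \<Rightarrow> (real \<Rightarrow> real) set" where
  "W22 a b =
     {u. Ck_on 1 {a..b} u \<and> square_integrable a b u \<and>
         (\<forall>k\<in>{1, 2}. \<exists>w. square_integrable a b w \<and> has_weak_deriv k a b u w)}"

text \<open>
  \<open>L\<close> is the length of the interval. As \<open>u\<close> is the $C^1$ representative, \<open>deriv u\<close> is its
  first weak derivative on the open interval.
\<close>
definition sobolev_constant :: "real \<Rightarrow> real \<Rightarrow> real \<Rightarrow> bool" where
  "sobolev_constant K \<epsilon>\<^sub>0 L \<longleftrightarrow>
     (\<forall>a b. b - a = L \<longrightarrow> (\<forall>u\<in>W22 a b. \<forall>\<epsilon>\<in>{0<..\<epsilon>\<^sub>0}.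
        (L2norm a b (deriv u))\<^sup>2 \<le>
          K * ((L2norm a b u)\<^sup>2 / \<epsilon>\<^sup>2 + \<epsilon>\<^sup>2 * (L2norm a b (weak_deriv 2 a b u))\<^sup>2)))"

subsection \<open>Splines and the Tikhonov functional\<close>

definition spline_space :: "nat \<Rightarrow> (real \<Rightarrow> real) set" where
  "spline_space M =
     {g. Ck_on 2 {0..1} g \<and>
         (\<forall>j\<in>{1..M}. \<exists>c :: real poly. degree c \<le> 3 \<and>
            (\<forall>t\<in>{(real j - 1) / real M .. real j / real M}. g t = poly c t))}"

definition tikhonov ::
  "nat \<Rightarrow> (nat \<Rightarrow> real) \<Rightarrow> real \<Rightarrow> (nat \<Rightarrow> real) \<Rightarrow> (real \<Rightarrow> real) \<Rightarrow> real" where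
  "tikhonov N x \<alpha> z g =
     1 / real N * (\<Sum>i=1..N. (g (x i) - z i)\<^sup>2) + \<alpha> * (L2norm 0 1 (weak_deriv 2 0 1 g))\<^sup>2"

subsection \<open>The constants\<close>

text \<open>
  Here \<open>s\<close> stands for $\Vert f''\Vert_{L^2(0,1)}$ and \<open>K\<close> for the Sobolev constant $K_\sigma$.
\<close>

definition Kstar :: real where
  "Kstar = 32"

definition C1' :: "real \<Rightarrow> real \<Rightarrow> real \<Rightarrow> real" where
  "C1' s \<gamma> \<delta> = 2 * sqrt 2 * \<gamma> powr (-1/2) * s + 8 / sqrt (\<delta> * \<gamma>)"

definition C2' :: "real \<Rightarrow> real \<Rightarrow> real \<Rightarrow> real \<Rightarrow> real" where
  "C2' s \<beta> \<gamma> \<delta> =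
     s * sqrt ((18 * \<beta> + 8) / \<gamma> + 72 * Kstar\<^sup>2 * \<beta> + 64 * Kstar\<^sup>2)
     + 4 * sqrt 2 * Kstar * \<delta> powr (-1/2)"

definition C3' :: "real \<Rightarrow> real \<Rightarrow> real \<Rightarrow> real \<Rightarrow> real \<Rightarrow> real" where
  "C3' K s \<beta> \<gamma> \<delta> =
     sqrt K * (s * sqrt (8 / \<gamma> + 9 / 2 * \<beta> + 4) + \<delta> powr (-1/2) * sqrt (64 / \<gamma> + 2))"

definition C4' :: "real \<Rightarrow> real \<Rightarrow> real \<Rightarrow> real \<Rightarrow> real \<Rightarrow> real" where
  "C4' K s \<beta> \<gamma> \<delta> =
     sqrt K * (s * sqrt ((9 * \<beta> + 4) / (2 * Kstar * \<gamma>) + 36 * Kstar * \<beta> + 32 * Kstar)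
               + 4 * \<delta> powr (-1/2) * sqrt Kstar)"

end

theory Submission
  imports Defs
begin

text \<open>
  Let \<open>g = quasi_interpolant M f\<close> be the Schoenberg spline of \<open>f\<close> extended linearly beyond
  $[0,1]$. By Jensen's inequality $\Vert g''\Vert \le \Vert f''\Vert$, and $g - f$ is small both
  uniformly and in $L^2$. Comparing \<open>f\<^sub>N\<close> with the points of the segment from \<open>f\<^sub>N\<close> to $g$
  bounds the empirical norm of the error and $\Vert f_N''\Vert$ by the size of $g - f$ at the observation
  points, by $\Vert g''\Vert$, and by the norm of the projection of the noise vector onto the space of
  spline values. The expected square of this norm is at most $(M+3)\sigma^2$, so Markov's inequality
  controls it with probability $1 - \delta/2$. Chernoff bounds guarantee, with the remaining
  probability, that $g - f$ is small at the observation points and that every cell in $I'$ contains at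
  least $N \gamma d / 2$ of them; the sum of the failure probabilities over the $q - p$ cells
  is small since $\gamma d (q - p) \le 1$. A sampling inequality on the cells, combined with a
  Sobolev inequality, then passes from the empirical norm of the error to its $L^2$ norm, and the
  Sobolev constant $K_\sigma$ gives the derivative.
\<close>

subsection \<open>Test functions and weak derivatives\<close>

text \<open>The minimizer depends on the noise, so the noise sum tested against
  \<open>f\<^sub>N\<close> has no fixed coefficients. Bounding the projection of the noise onto all
  spline values handles every spline at once. The projection is determined by the points, which are
  independent of the noise, so its basis must be measurable in the points. Second derivatives enter
  through a chosen weak derivative, while the estimates need increments of a continuous first
  derivative. Passing between the two takes explicit smooth test functions. Since 2 sqrt 32 exceeds
  11, \<open>I'\<close> has at least 12 cells. This makes the first-derivative term in the sampling
  inequality absorbable, and it makes 8 d an admissible parameter for the Sobolev constant. For (g -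
  f)^2 the uniform bound is of order d^3 and the integral of order d^4. The ratio d makes its
  Chernoff exponent comparable to that of one cell. The factor (\<gamma> d)^2 in the condition on N
  turns the failure probability of one of m cells into (\<delta>/4)^m, which pays for the union over
  all of them.\<close>

text \<open>The positive and negative parts of \<open>h\<close> are densities of finite measures
  that agree on every ray, and rays determine a finite Borel measure. This yields uniqueness of
  second derivatives up to null sets.\<close>

lemma AE_eq_zero_of_integral_greaterThan:
  fixes h :: "real \<Rightarrow> real"
  assumes h: "integrable lborel h"
    and zero: "\<And>x. (LINT t|lborel. indicator {x<..} t * h t) = 0"
  shows "AE t in lborel. h t = 0"
proof -
  have hm [measurable]: "h \<in> borel_measurable borel"
    using h by (simp add: borel_measurable_integrable)
  define hp where "hp t = max 0 (h t)" for t
  define hn where "hn t = max 0 (- h t)" for t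
  have pm [measurable]: "hp \<in> borel_measurable borel" "hn \<in> borel_measurable borel"
    unfolding hp_def hn_def by measurable
  have ip: "integrable lborel hp" and ineg: "integrable lborel hn"
    unfolding hp_def hn_def using h by auto
  have em: "emeasure (density lborel (\<lambda>t. ennreal (g t))) {x<..} =
      ennreal (LINT t|lborel. indicator {x<..} t * g t)"
    if g: "integrable lborel g" "\<And>t. 0 \<le> g t" for g :: "real \<Rightarrow> real" and x
  proof -
    have [measurable]: "g \<in> borel_measurable borel"
      using g(1) by (simp add: borel_measurable_integrable)
    have i: "integrable lborel (\<lambda>t. indicator {x<..} t * g t)"
      using integrable_mult_indicator[OF _ g(1), of "{x<..}"] by simp
    have "emeasure (density lborel (\<lambda>t. ennreal (g t))) {x<..} =
        (\<integral>\<^sup>+t. ennreal (g t) * indicator {x<..} t \<partial>lborel)"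
      by (subst emeasure_density) auto
    also have "\<dots> = (\<integral>\<^sup>+t. ennreal (indicator {x<..} t * g t) \<partial>lborel)"
      by (intro nn_integral_cong) (simp split: split_indicator)
    also have "\<dots> = ennreal (LINT t|lborel. indicator {x<..} t * g t)"
      using i g(2) by (intro nn_integral_eq_integral) auto
    finally show ?thesis .
  qed
  have i2: "integrable lborel (\<lambda>t. indicator {x<..} t * g t)" if "integrable lborel g"
    for g :: "real \<Rightarrow> real" and x :: real
    using integrable_mult_indicator[OF _ that, of "{x<..}"] by simp
  have "density lborel (\<lambda>t. ennreal (hp t)) = density lborel (\<lambda>t. ennreal (hn t))"
  proof (rule measure_eqI_lessThan)
    fix x :: real
    show "emeasure (density lborel (\<lambda>t. ennreal (hp t))) {x<..} < \<infinity>"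
      by (subst em[OF ip]) (auto simp: hp_def)
    have "(LINT t|lborel. indicator {x<..} t * hp t) - (LINT t|lborel. indicator {x<..} t * hn t)
        = (LINT t|lborel. indicator {x<..} t * h t)"
      by (subst Bochner_Integration.integral_diff[OF i2[OF ip] i2[OF ineg], symmetric])
        (auto intro!: Bochner_Integration.integral_cong simp: hp_def hn_def split: split_indicator)
    then show "emeasure (density lborel (\<lambda>t. ennreal (hp t))) {x<..} =
        emeasure (density lborel (\<lambda>t. ennreal (hn t))) {x<..}"
      using zero[of x] em[OF ip, of x] em[OF ineg, of x] by (simp add: hp_def hn_def)
  qed auto
  then have "AE t in lborel. ennreal (hp t) = ennreal (hn t)"
    by (subst (asm) sigma_finite_measure.density_unique_iff[OF lborel.sigma_finite_measure_axioms]) auto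
  then show ?thesis
    by eventually_elim (auto simp: hp_def hn_def max_def split: if_splits)
qed

section \<open>Smooth bump functions\<close>

text \<open>The polynomial \<open>P\<close> and the power \<open>n\<close> make the family closed
  under differentiation, so one derivative formula gives smoothness of every order. The test
  functions are the members with \<open>P = 1\<close> and \<open>n = 0\<close>.\<close>

definition bump :: "real \<Rightarrow> real \<Rightarrow> real \<Rightarrow> real poly \<Rightarrow> nat \<Rightarrow> real \<Rightarrow> real" where
  "bump l s T P n t = (if s < t \<and> t < T
     then poly P t / ((t - s) * (T - t)) ^ n * exp (- l / ((t - s) * (T - t))) else 0)"

lemma power_div_fact_le_exp: "0 \<le> x \<Longrightarrow> x ^ k / fact k \<le> exp (x::real)"
proof -
  assume x: "0 \<le> x"
  have "(\<Sum>n\<in>{k}. x ^ n /\<^sub>R fact n) \<le> (\<Sum>n. x ^ n /\<^sub>R fact n)"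
    using x by (intro sum_le_suminf summable_exp_generic) auto
  then show ?thesis by (simp add: exp_def divide_inverse mult.commute)
qed

text \<open>With q = (t - s)(T - t), the exponential is at most (n+2)! q^(n+2) / l^(n+2), which
  cancels the pole of order n and leaves q^2. As q is at most (T - s)|t - z| for \<open>z\<close>
  outside the open interval, the decay at \<open>z\<close> is quadratic and forces derivative zero
  there, endpoints included.\<close>

lemma bump_quadratic_bound:
  assumes l: "0 < l"
  obtains C where "\<And>z t. z \<notin> {s<..<T} \<Longrightarrow> \<bar>bump l s T P n t\<bar> \<le> C * (t - z)\<^sup>2"
proof -
  obtain B where B: "\<And>t. t \<in> {s..T} \<Longrightarrow> \<bar>poly P t\<bar> \<le> B"
  proof -
    have "bounded (poly P ` {s..T})"
      by (intro compact_imp_bounded compact_continuous_image continuous_intros) auto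
    then obtain B where "\<forall>t\<in>{s..T}. \<bar>poly P t\<bar> \<le> B" by (auto simp: bounded_iff)
    then show ?thesis by (intro that) blast
  qed
  define C where "C = \<bar>B\<bar> * (fact (n+2) / l ^ (n+2)) * (T - s)\<^sup>2"
  have C0: "0 \<le> C" using l by (simp add: C_def)
  have "\<bar>bump l s T P n t\<bar> \<le> C * (t - z)\<^sup>2" if z: "z \<notin> {s<..<T}" for z t
  proof (cases "s < t \<and> t < T")
    case False
    then show ?thesis using C0 by (auto simp: bump_def)
  next
    case True
    define q where "q = (t - s) * (T - t)"
    have q: "0 < q" using True by (simp add: q_def)
    have "(l / q) ^ (n+2) / fact (n+2) \<le> exp (l / q)"
      using q l by (intro power_div_fact_le_exp) auto
    then have e: "exp (- l / q) \<le> fact (n+2) * q ^ (n+2) / l ^ (n+2)"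
      using q l by (simp add: exp_minus field_simps power_divide del: fact_Suc power_Suc)
    have "\<bar>bump l s T P n t\<bar> = \<bar>poly P t\<bar> / q ^ n * exp (- l / q)"
      using True q by (simp add: bump_def q_def[symmetric] abs_mult)
    also have "\<dots> \<le> \<bar>B\<bar> / q ^ n * (fact (n+2) * q ^ (n+2) / l ^ (n+2))"
      using True q B[of t] by (intro mult_mono e divide_right_mono) auto
    also have "\<dots> = \<bar>B\<bar> * (fact (n+2) / l ^ (n+2)) * q\<^sup>2"
      using q l by (simp add: field_simps power_add power2_eq_square del: fact_Suc)
    also have "\<dots> \<le> \<bar>B\<bar> * (fact (n+2) / l ^ (n+2)) * ((T - s)\<^sup>2 * (t - z)\<^sup>2)"
    proof -
      have "q \<le> (T - s) * \<bar>t - z\<bar>"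
      proof (cases "z \<le> s")
        case True
        then show ?thesis using \<open>s < t \<and> t < T\<close> unfolding q_def
          by (subst mult.commute) (intro mult_mono, auto)
      next
        case False
        then have "T \<le> z" using z by auto
        then show ?thesis using \<open>s < t \<and> t < T\<close> unfolding q_def
          by (intro mult_mono) auto
      qed
      then have "q\<^sup>2 \<le> ((T - s) * \<bar>t - z\<bar>)\<^sup>2" using q by (intro power_mono) auto
      then show ?thesis using l by (intro mult_left_mono) (auto simp: power_mult_distrib)
    qed
    finally show ?thesis by (simp add: C_def mult.assoc)
  qed
  then show ?thesis using that by blast
qed

lemma has_real_derivative_zero_of_quadratic_bound:
  fixes f :: "real \<Rightarrow> real"
  assumes "\<And>t. \<bar>f t\<bar> \<le> C * (t - z)\<^sup>2"
  shows "(f has_real_derivative 0) (at z)"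
proof -
  have f0: "f z = 0" using assms[of z] by simp
  have "((\<lambda>h. f (z + h) / h) \<longlongrightarrow> 0) (at 0)"
  proof (rule Lim_null_comparison)
    show "\<forall>\<^sub>F h in at 0. norm (f (z + h) / h) \<le> C * \<bar>h\<bar>"
    proof (rule eventually_at_filter[THEN iffD2, OF always_eventually], safe)
      fix h :: real assume "h \<noteq> 0"
      then show "norm (f (z + h) / h) \<le> C * \<bar>h\<bar>"
        using assms[of "z + h"] by (simp add: power2_eq_square divide_le_eq mult.assoc)
    qed
    show "((\<lambda>h. C * \<bar>h\<bar>) \<longlongrightarrow> 0) (at (0::real))"
      by (auto intro!: tendsto_eq_intros)
  qed
  then show ?thesis using f0 by (simp add: DERIV_def)
qed

text \<open>Inside the interval this is the quotient rule over the common denominator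
  \<open>Q ^ (n + 2)\<close>, with the \<open>smult l\<close> term coming from the exponential;
  elsewhere the quadratic bound gives derivative zero.\<close>

lemma bump_has_derivative:
  fixes l s T :: real
  assumes l: "0 < l"
  defines "Q \<equiv> [:- s, 1:] * [:T, - 1:]"
  shows "(bump l s T P n has_real_derivative
     bump l s T (pderiv P * Q\<^sup>2 - of_nat n * P * pderiv Q * Q + smult l (P * pderiv Q)) (n + 2) t) (at t)"
proof (cases "s < t \<and> t < T")
  case False
  obtain C where C: "\<And>z t. z \<notin> {s<..<T} \<Longrightarrow> \<bar>bump l s T P n t\<bar> \<le> C * (t - z)\<^sup>2"
    using bump_quadratic_bound[OF l] by metis
  have "(bump l s T P n has_real_derivative 0) (at t)"
    by (rule has_real_derivative_zero_of_quadratic_bound[where C = C]) (use C False in auto)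
  moreover have "bump l s T P' (n + 2) t = 0" for P' using False by (auto simp: bump_def)
  ultimately show ?thesis by simp
next
  case True
  have q: "poly Q t = (t - s) * (T - t)" for t by (simp add: Q_def algebra_simps)
  have q0: "poly Q t > 0" using True by (simp add: q)
  have q0': "poly Q t \<noteq> 0" using q0 by simp
  have "((\<lambda>t. poly P t / poly Q t ^ n * exp (- l / poly Q t)) has_real_derivative
     (poly (pderiv P * Q\<^sup>2 - of_nat n * P * pderiv Q * Q + smult l (P * pderiv Q)) t)
       / poly Q t ^ (n + 2) * exp (- l / poly Q t)) (at t)"
  proof (cases n)
    case 0
    show ?thesis unfolding 0 using q0'
      by (auto intro!: derivative_eq_intros simp: field_simps power2_eq_square)
  next
    case (Suc k)
    have a: "((\<lambda>t. poly Q t ^ n) has_real_derivative real n * poly Q t ^ k * poly (pderiv Q) t) (at t)"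
      using DERIV_power[OF poly_DERIV[of Q t], of n] by (simp add: Suc mult_ac)
    have "((\<lambda>t. poly P t / poly Q t ^ n * exp (- l / poly Q t)) has_real_derivative
       (poly (pderiv P) t / poly Q t ^ n - real n * poly P t * poly (pderiv Q) t / poly Q t ^ (n+1)) * exp (- l / poly Q t)
        + poly P t / poly Q t ^ n * (exp (- l / poly Q t) * (l * poly (pderiv Q) t / (poly Q t)\<^sup>2))) (at t)"
    proof (rule DERIV_cong)
      have b: "((\<lambda>t. exp (- l / poly Q t)) has_real_derivative
          exp (- l / poly Q t) * (l * poly (pderiv Q) t / (poly Q t)\<^sup>2)) (at t)"
        using q0' by (auto intro!: derivative_eq_intros simp: power2_eq_square)
      show "((\<lambda>t. poly P t / poly Q t ^ n * exp (- l / poly Q t)) has_real_derivative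
          ((poly (pderiv P) t * poly Q t ^ n - poly P t * (real n * poly Q t ^ k * poly (pderiv Q) t))
            / (poly Q t ^ n * poly Q t ^ n)) * exp (- l / poly Q t)
          + exp (- l / poly Q t) * (l * poly (pderiv Q) t / (poly Q t)\<^sup>2) * (poly P t / poly Q t ^ n)) (at t)"
        using q0' by (intro DERIV_mult DERIV_divide poly_DERIV a b) auto
    qed (use q0' in \<open>simp add: Suc field_simps power2_eq_square\<close>)
    also have "(poly (pderiv P) t / poly Q t ^ n - real n * poly P t * poly (pderiv Q) t / poly Q t ^ (n+1)) * exp (- l / poly Q t)
        + poly P t / poly Q t ^ n * (exp (- l / poly Q t) * (l * poly (pderiv Q) t / (poly Q t)\<^sup>2))
       = (poly (pderiv P * Q\<^sup>2 - of_nat n * P * pderiv Q * Q + smult l (P * pderiv Q)) t)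
       / poly Q t ^ (n + 2) * exp (- l / poly Q t)"
      using q0' by (simp add: field_simps power2_eq_square)
    finally show ?thesis .
  qed
  then have "((\<lambda>t. poly P t / poly Q t ^ n * exp (- l / poly Q t)) has_real_derivative
     bump l s T (pderiv P * Q\<^sup>2 - of_nat n * P * pderiv Q * Q + smult l (P * pderiv Q)) (n + 2) t) (at t)"
    using True by (simp add: bump_def q)
  then show ?thesis
    by (rule DERIV_cong_ev[THEN iffD1, rotated 3])
      (use True in \<open>auto simp: bump_def q eventually_at_topological intro!: exI[of _ "{s<..<T}"] eventually_nhds_in_open[THEN eventually_mono, of "{s<..<T}"]\<close>)
qed

lemma deriv_funpow_bump:
  assumes l: "0 < l"
  shows "\<exists>P' n'. (deriv ^^ k) (bump l s T P n) = bump l s T P' n'"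
proof (induction k)
  case 0
  show ?case by auto
next
  case (Suc k)
  then obtain P' n' where "(deriv ^^ k) (bump l s T P n) = bump l s T P' n'" by blast
  then have "(deriv ^^ Suc k) (bump l s T P n) = deriv (bump l s T P' n')" by simp
  also have "\<dots> = bump l s T (pderiv P' * ([:- s, 1:] * [:T, - 1:])\<^sup>2 - of_nat n' * P' * pderiv ([:- s, 1:] * [:T, - 1:]) * ([:- s, 1:] * [:T, - 1:]) + smult l (P' * pderiv ([:- s, 1:] * [:T, - 1:]))) (n' + 2)"
    using bump_has_derivative[OF l] by (intro ext DERIV_imp_deriv)
  finally show ?case by blast
qed

lemma test_function_bump:
  assumes l: "0 < l" and st: "a < s" "s < T" "T < b"
  shows "test_function a b (bump l s T 1 0)"
proof -
  have "(deriv ^^ k) (bump l s T 1 0) field_differentiable at t" for k t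
  proof -
    obtain P' n' where "(deriv ^^ k) (bump l s T 1 0) = bump l s T P' n'"
      using deriv_funpow_bump[OF l] by blast
    then show ?thesis
      using bump_has_derivative[OF l] unfolding field_differentiable_def by metis
  qed
  moreover have "{t. bump l s T 1 0 t \<noteq> 0} = {s<..<T}" by (auto simp: bump_def)
  ultimately show ?thesis using st by (auto simp: test_function_def)
qed

section \<open>Point evaluation as a limit of integrals\<close>

text \<open>The nonnegative densities \<Phi>' have antiderivatives that vanish at \<open>s\<close>
  and tend to 1 at every later point, so their mass concentrates at \<open>s\<close>: a one-sided
  approximate identity.\<close>

lemma tendsto_integral_mult_left_endpoint:
  fixes g :: "real \<Rightarrow> real" and \<Phi> \<Phi>' :: "nat \<Rightarrow> real \<Rightarrow> real"
  assumes sc: "s < c" and g: "continuous_on {s..c} g"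
    and d: "\<And>n t. t \<in> {s..c} \<Longrightarrow> (\<Phi> n has_real_derivative \<Phi>' n t) (at t within {s..c})"
    and c: "\<And>n. continuous_on {s..c} (\<Phi>' n)"
    and nn: "\<And>n t. t \<in> {s..c} \<Longrightarrow> 0 \<le> \<Phi>' n t"
    and z: "\<And>n. \<Phi> n s = 0"
    and lim: "\<And>t. s < t \<Longrightarrow> t \<le> c \<Longrightarrow> (\<lambda>n. \<Phi> n t) \<longlonglongrightarrow> 1"
  shows "(\<lambda>n. integral {s..c} (\<lambda>t. g t * \<Phi>' n t)) \<longlonglongrightarrow> g s"
proof -
  define h where "h t = g t - g s" for t
  have hc: "continuous_on {s..c} h" unfolding h_def by (intro continuous_intros g)
  obtain B where B: "\<And>t. t \<in> {s..c} \<Longrightarrow> \<bar>h t\<bar> \<le> B"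
  proof -
    have "bounded (h ` {s..c})" by (intro compact_imp_bounded compact_continuous_image hc) auto
    then obtain B where "\<forall>t\<in>{s..c}. \<bar>h t\<bar> \<le> B" by (auto simp: bounded_iff)
    then show ?thesis by (intro that) blast
  qed
  have ftc: "(\<Phi>' n has_integral (\<Phi> n v - \<Phi> n u)) {u..v}" if "s \<le> u" "u \<le> v" "v \<le> c" for n u v
  proof (rule fundamental_theorem_of_calculus[OF that(2)])
    fix t assume "t \<in> {u..v}"
    then have "(\<Phi> n has_real_derivative \<Phi>' n t) (at t within {u..v})"
      using that by (intro DERIV_subset[OF d]) auto
    then show "(\<Phi> n has_vector_derivative \<Phi>' n t) (at t within {u..v})"
      by (simp add: has_real_derivative_iff_has_vector_derivative)
  qed
  have bd: "\<bar>integral {u..v} (\<lambda>t. h t * \<Phi>' n t)\<bar> \<le> e * (\<Phi> n v - \<Phi> n u)"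
    if uv: "s \<le> u" "u \<le> v" "v \<le> c" and e: "\<And>t. t \<in> {u..v} \<Longrightarrow> \<bar>h t\<bar> \<le> e" for n u v e
  proof -
    have sub: "{u..v} \<subseteq> {s..c}" using uv by auto
    have i: "((\<lambda>t. e * \<Phi>' n t) has_integral e * (\<Phi> n v - \<Phi> n u)) {u..v}"
      by (intro has_integral_mult_right ftc uv)
    have "norm (integral {u..v} (\<lambda>t. h t * \<Phi>' n t)) \<le> integral {u..v} (\<lambda>t. e * \<Phi>' n t)"
    proof (rule integral_norm_bound_integral)
      show "(\<lambda>t. h t * \<Phi>' n t) integrable_on {u..v}"
        by (intro integrable_continuous_interval continuous_intros continuous_on_subset[OF hc sub] continuous_on_subset[OF c sub])
      show "norm (h t * \<Phi>' n t) \<le> e * \<Phi>' n t" if "t \<in> {u..v}" for t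
        using e[OF that] nn[of t n] that sub by (auto simp: abs_mult intro!: mult_right_mono)
    qed (use i in blast)
    also have "\<dots> = e * (\<Phi> n v - \<Phi> n u)" using i by (rule integral_unique)
    finally show ?thesis by simp
  qed
  have "(\<lambda>n. integral {s..c} (\<lambda>t. h t * \<Phi>' n t)) \<longlonglongrightarrow> 0"
  proof (rule LIMSEQ_I)
    fix r :: real assume r: "0 < r"
    have "s \<in> {s..c}" using sc by simp
    then obtain \<delta> where \<delta>0: "\<delta> > 0" "\<And>t. t \<in> {s..c} \<Longrightarrow> dist t s < \<delta> \<Longrightarrow> dist (h t) (h s) < r / 3"
      using hc[unfolded continuous_on_iff] r by (metis zero_less_divide_iff zero_less_numeral)
    have \<delta>: "\<delta> > 0" "\<And>t. t \<in> {s..c} \<Longrightarrow> \<bar>t - s\<bar> < \<delta> \<Longrightarrow> \<bar>h t\<bar> < r / 3"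
      using \<delta>0 by (auto simp: dist_real_def h_def)
    \<comment> \<open>Split at a point close to \<open>s\<close>: to its left \<open>h\<close> is
      small, to its right the mass \<open>\<Phi> n c - \<Phi> n v\<close> tends to 0.\<close>
    define v where "v = min c (s + \<delta> / 2)"
    have v: "s < v" "v \<le> c" using sc \<delta> by (auto simp: v_def)
    have est: "\<bar>integral {s..c} (\<lambda>t. h t * \<Phi>' n t)\<bar> \<le> r / 3 * \<Phi> n v + B * (\<Phi> n c - \<Phi> n v)" for n
    proof -
      have "integral {s..c} (\<lambda>t. h t * \<Phi>' n t) =
          integral {s..v} (\<lambda>t. h t * \<Phi>' n t) + integral {v..c} (\<lambda>t. h t * \<Phi>' n t)"
        using v by (intro Henstock_Kurzweil_Integration.integral_combine[symmetric] integrable_continuous_interval continuous_intros hc c) auto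
      moreover have "\<bar>integral {s..v} (\<lambda>t. h t * \<Phi>' n t)\<bar> \<le> r / 3 * (\<Phi> n v - \<Phi> n s)"
        using v \<delta> by (intro bd) (auto simp: v_def intro!: less_imp_le)
      moreover have "\<bar>integral {v..c} (\<lambda>t. h t * \<Phi>' n t)\<bar> \<le> B * (\<Phi> n c - \<Phi> n v)"
        using v by (intro bd B) auto
      ultimately show ?thesis using z[of n] by simp
    qed
    have "(\<lambda>n. r / 3 * \<Phi> n v + B * (\<Phi> n c - \<Phi> n v)) \<longlonglongrightarrow> r / 3 * 1 + B * (1 - 1)"
      using v by (intro tendsto_intros lim) auto
    then have "\<forall>\<^sub>F n in sequentially. r / 3 * \<Phi> n v + B * (\<Phi> n c - \<Phi> n v) < r"
      by (rule order_tendstoD) (use r in auto)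
    then have "\<forall>\<^sub>F n in sequentially. \<bar>integral {s..c} (\<lambda>t. h t * \<Phi>' n t)\<bar> < r"
      by eventually_elim (use est in \<open>auto intro: le_less_trans\<close>)
    then show "\<exists>no. \<forall>n\<ge>no. norm (integral {s..c} (\<lambda>t. h t * \<Phi>' n t) - 0) < r"
      by (simp add: eventually_sequentially)
  qed
  then have "(\<lambda>n. integral {s..c} (\<lambda>t. h t * \<Phi>' n t) + g s * \<Phi> n c) \<longlonglongrightarrow> 0 + g s * 1"
    using sc by (intro tendsto_intros lim) auto
  moreover have "integral {s..c} (\<lambda>t. h t * \<Phi>' n t) + g s * \<Phi> n c = integral {s..c} (\<lambda>t. g t * \<Phi>' n t)" for n
  proof -
    have "g s * \<Phi> n c = integral {s..c} (\<lambda>t. g s * \<Phi>' n t)"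
      using integral_unique[OF has_integral_mult_right[OF ftc[of s c n], of "g s"]] sc z[of n] by auto
    then have "integral {s..c} (\<lambda>t. h t * \<Phi>' n t) + g s * \<Phi> n c =
       integral {s..c} (\<lambda>t. h t * \<Phi>' n t + g s * \<Phi>' n t)"
      by (subst Henstock_Kurzweil_Integration.integral_add)
        (auto intro!: integrable_continuous_interval continuous_intros hc c)
    then show ?thesis by (simp add: h_def algebra_simps)
  qed
  ultimately show ?thesis by simp
qed

text \<open>The reflection of t to -t reduces this to the left endpoint; the minus sign in the limit
  reflects that the densities are nonpositive here.\<close>

lemma tendsto_integral_mult_right_endpoint:
  fixes g :: "real \<Rightarrow> real" and \<Phi> \<Phi>' :: "nat \<Rightarrow> real \<Rightarrow> real"
  assumes cT: "c < T" and g: "continuous_on {c..T} g"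
    and d: "\<And>n t. t \<in> {c..T} \<Longrightarrow> (\<Phi> n has_real_derivative \<Phi>' n t) (at t within {c..T})"
    and c: "\<And>n. continuous_on {c..T} (\<Phi>' n)"
    and np: "\<And>n t. t \<in> {c..T} \<Longrightarrow> \<Phi>' n t \<le> 0"
    and z: "\<And>n. \<Phi> n T = 0"
    and lim: "\<And>t. c \<le> t \<Longrightarrow> t < T \<Longrightarrow> (\<lambda>n. \<Phi> n t) \<longlonglongrightarrow> 1"
  shows "(\<lambda>n. integral {c..T} (\<lambda>t. g t * \<Phi>' n t)) \<longlonglongrightarrow> - g T"
proof -
  have im: "uminus ` {-T..-c} = {c..T}" by simp
  have "(\<lambda>n. integral {-T..-c} (\<lambda>t. g (- t) * (- \<Phi>' n (- t)))) \<longlonglongrightarrow> g (- (- T))"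
  proof (rule tendsto_integral_mult_left_endpoint[where \<Phi> = "\<lambda>n t. \<Phi> n (- t)"])
    show "continuous_on {-T..-c} (\<lambda>t. g (- t))"
      using g by (intro continuous_on_compose2[OF g]) (auto intro: continuous_intros)
    show "continuous_on {-T..-c} (\<lambda>t. - \<Phi>' n (- t))" for n
      by (intro continuous_on_minus continuous_on_compose2[OF c]) (auto intro: continuous_intros)
    show "((\<lambda>t. \<Phi> n (- t)) has_real_derivative - \<Phi>' n (- t)) (at t within {-T..-c})"
      if "t \<in> {-T..-c}" for n t
    proof -
      have "(\<Phi> n has_real_derivative \<Phi>' n (- t)) (at (- t) within uminus ` {-T..-c})"
        using d[of "- t" n] that unfolding im by auto
      moreover have "(uminus has_real_derivative - 1) (at t within {-T..-c})"
        by (rule derivative_eq_intros refl)+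
      ultimately have "(\<Phi> n \<circ> uminus has_real_derivative \<Phi>' n (- t) * - 1) (at t within {-T..-c})"
        by (rule DERIV_image_chain)
      then show ?thesis by (simp add: o_def)
    qed
  qed (use cT np z lim in auto)
  moreover have "integral {-T..-c} (\<lambda>t. g (- t) * (- \<Phi>' n (- t))) = - integral {c..T} (\<lambda>t. g t * \<Phi>' n t)" for n
    using Henstock_Kurzweil_Integration.integral_reflect_real[of T c "\<lambda>t. g t * \<Phi>' n t"] by simp
  ultimately have "(\<lambda>n. - integral {c..T} (\<lambda>t. g t * \<Phi>' n t)) \<longlonglongrightarrow> g T" by simp
  then show ?thesis using tendsto_minus by fastforce
qed

lemma set_borel_measurable_power2:
  "set_borel_measurable lborel S (f :: real \<Rightarrow> real) \<Longrightarrow> set_borel_measurable lborel S (\<lambda>t. (f t)\<^sup>2)"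
proof -
  assume "set_borel_measurable lborel S f"
  then have "(\<lambda>t. (indicator S t *\<^sub>R f t)\<^sup>2) \<in> borel_measurable lborel"
    unfolding set_borel_measurable_def by (rule borel_measurable_power)
  also have "(\<lambda>t. (indicator S t *\<^sub>R f t)\<^sup>2) = (\<lambda>t. indicator S t *\<^sub>R (f t)\<^sup>2)"
    by (auto simp: indicator_def)
  finally show ?thesis unfolding set_borel_measurable_def .
qed

lemma square_integrable_set_integrable:
  assumes "square_integrable a b w"
  shows "set_integrable lborel {a<..<b} w"
proof (rule set_integrable_bound)
  show "set_integrable lborel {a<..<b} (\<lambda>t. 1 + (w t)\<^sup>2)"
  proof (rule set_integral_add(1))
    show "set_integrable lborel {a<..<b} (\<lambda>t. 1 :: real)"
      unfolding set_integrable_def by (cases "a \<le> b") simp_all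
    show "set_integrable lborel {a<..<b} (\<lambda>t. (w t)\<^sup>2)"
      using assms by (simp add: square_integrable_def)
  qed
  show "set_borel_measurable lborel {a<..<b} w"
    using assms by (simp add: square_integrable_def)
  show "AE t in lborel. t \<in> {a<..<b} \<longrightarrow> norm (w t) \<le> norm (1 + (w t)\<^sup>2)"
  proof (intro AE_I2 impI)
    fix t
    have "2 * \<bar>w t\<bar> \<le> 1 + \<bar>w t\<bar>\<^sup>2" using sum_squares_bound[of 1 "\<bar>w t\<bar>"] by simp
    then show "norm (w t) \<le> norm (1 + (w t)\<^sup>2)" by simp
  qed
qed

lemma square_integrable_absolutely_integrable:
  assumes "square_integrable a b w"
  shows "w absolutely_integrable_on {a..b}"
proof -
  have "integrable lborel (\<lambda>t. indicator {a<..<b} t *\<^sub>R w t)"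
    using square_integrable_set_integrable[OF assms] unfolding set_integrable_def .
  then have "set_integrable lebesgue {a<..<b} w"
    unfolding set_integrable_def
    by (subst integrable_completion) (rule borel_measurable_integrable)
  moreover have "negligible {x \<in> {a<..<b} - {a..b}. w x \<noteq> 0}"
    by (rule negligible_subset[of "{}"]) auto
  moreover have "negligible {x \<in> {a..b} - {a<..<b}. w x \<noteq> 0}"
    by (rule negligible_subset[of "{a, b}"]) auto
  ultimately show ?thesis by (rule absolutely_integrable_spike_set)
qed

abbreviation sq_integral :: "real \<Rightarrow> real \<Rightarrow> (real \<Rightarrow> real) \<Rightarrow> real" where
  "sq_integral a b u \<equiv> integral {a..b} (\<lambda>t. (u t)\<^sup>2)"

lemma square_integrable_power2:
  assumes "square_integrable a b w"
  shows "(\<lambda>t. (w t)\<^sup>2) integrable_on {a..b}"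
    and "(L2norm a b w)\<^sup>2 = sq_integral a b w"
proof -
  have i: "set_integrable lborel {a<..<b} (\<lambda>t. (w t)\<^sup>2)"
    using assms by (simp add: square_integrable_def)
  show "(\<lambda>t. (w t)\<^sup>2) integrable_on {a..b}"
    using set_borel_integral_eq_integral(1)[OF i] by (simp add: integrable_on_Icc_iff_Ioo)
  show "(L2norm a b w)\<^sup>2 = sq_integral a b w"
  proof -
    have "0 \<le> set_lebesgue_integral lborel {a<..<b} (\<lambda>t. (w t)\<^sup>2)"
      unfolding set_lebesgue_integral_def by (intro Bochner_Integration.integral_nonneg) auto
    then show ?thesis
      unfolding L2norm_def using set_borel_integral_eq_integral(2)[OF i]
      by (simp add: integral_open_interval_real)
  qed
qed

text \<open>
  The test functions are $\exp(-l/((t-s)(T-t)))$ on $(s,T)$. As $l \to 0$ they tend to the indicator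
  of $(s,T)$ and their derivatives to the difference of the point masses at $s$ and $T$.
\<close>

lemma weak_deriv2_increment_interior:
  assumes u: "\<And>t. t \<in> {a..b} \<Longrightarrow> (u has_real_derivative u1 t) (at t within {a..b})"
    and u1: "continuous_on {a..b} u1"
    and w: "set_integrable lborel {a<..<b} w" and wd: "has_weak_deriv 2 a b u w"
    and ab: "a < s" "s < T" "T < b"
  shows "u1 T - u1 s = (LINT t:{s<..<T}|lborel. w t)"
proof -
  define l where "l n = 1 / (real n + 1)" for n
  have l: "0 < l n" for n by (simp add: l_def)
  have l0: "l \<longlonglongrightarrow> 0"
    using LIMSEQ_inverse_real_of_nat by (simp add: l_def[abs_def] inverse_eq_divide add.commute)
  define \<phi> where "\<phi> n = bump (l n) s T 1 0" for n
  define Q where "Q = [:- s, 1:] * [:T, - 1:]"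
  define \<phi>' where "\<phi>' n = bump (l n) s T (smult (l n) (pderiv Q)) 2" for n
  have d1: "(\<phi> n has_real_derivative \<phi>' n t) (at t)" for n t
    using bump_has_derivative[OF l, of n s T 1 0 t, folded Q_def] by (simp add: \<phi>_def \<phi>'_def numeral_2_eq_2)
  define \<phi>'' where "\<phi>'' n = bump (l n) s T (pderiv (smult (l n) (pderiv Q)) * Q\<^sup>2 -
      of_nat 2 * smult (l n) (pderiv Q) * pderiv Q * Q + smult (l n) (smult (l n) (pderiv Q) * pderiv Q)) (2 + 2)" for n
  have d2: "(\<phi>' n has_real_derivative \<phi>'' n t) (at t)" for n t
    using bump_has_derivative[OF l, of n s T "smult (l n) (pderiv Q)" 2 t]
    unfolding \<phi>''_def \<phi>'_def Q_def by simp
  have c: "continuous_on S (\<phi> n)" "continuous_on S (\<phi>' n)" "continuous_on S (\<phi>'' n)" for S n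
  proof -
    show "continuous_on S (\<phi> n)" "continuous_on S (\<phi>' n)"
      by (intro continuous_at_imp_continuous_on ballI DERIV_isCont[OF d1] DERIV_isCont[OF d2])+
    show "continuous_on S (\<phi>'' n)" unfolding \<phi>''_def
      by (intro continuous_at_imp_continuous_on ballI DERIV_isCont[OF bump_has_derivative[OF l]])
  qed
  have "deriv (\<phi> n) = \<phi>' n" "deriv (\<phi>' n) = \<phi>'' n" for n
    by (rule ext, rule DERIV_imp_deriv, rule d1 d2)+
  then have dd: "(deriv ^^ 2) (\<phi> n) = \<phi>'' n" for n
    by (simp add: numeral_2_eq_2)
  have out: "\<phi> n t = 0 \<and> \<phi>' n t = 0 \<and> \<phi>'' n t = 0" if "\<not> (s < t \<and> t < T)" for n t
    using that by (simp only: \<phi>_def \<phi>'_def \<phi>''_def bump_def if_False)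
  have sub: "{s..T} \<subseteq> {a..b}" using ab by auto
  have uc: "continuous_on {a..b} u" by (rule DERIV_continuous_on) (rule u)
  \<comment> \<open>One classical integration by parts moves a derivative from
    \<open>\<phi>''\<close> to \<open>u\<close>, without boundary terms since \<open>\<phi>'\<close>
    vanishes at \<open>s\<close> and \<open>T\<close>. Only the continuous \<open>u1\<close> is then
    paired with the concentrating kernels.\<close>
  have eq: "- integral {s..T} (\<lambda>t. u1 t * \<phi>' n t) = (LINT t:{a<..<b}|lborel. w t * \<phi> n t)" for n
  proof -
    have "test_function a b (\<phi> n)" unfolding \<phi>_def by (rule test_function_bump) (use l ab in auto)
    then have "(LINT t:{a<..<b}|lborel. u t * \<phi>'' n t) = (LINT t:{a<..<b}|lborel. w t * \<phi> n t)"
      using wd unfolding has_weak_deriv_def dd[symmetric] by simp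
    moreover have "(LINT t:{a<..<b}|lborel. u t * \<phi>'' n t) = (LINT t:{s..T}|lborel. u t * \<phi>'' n t)"
      unfolding set_lebesgue_integral_def
      by (intro Bochner_Integration.integral_cong) (use out ab in \<open>auto split: split_indicator\<close>)
    moreover have "(LINT t:{s..T}|lborel. u t * \<phi>'' n t) = integral {s..T} (\<lambda>t. u t * \<phi>'' n t)"
      by (intro set_borel_integral_eq_integral borel_integrable_atLeastAtMost' continuous_intros c
          continuous_on_subset[OF uc sub])
    moreover have "((\<lambda>t. u1 t * \<phi>' n t + u t * \<phi>'' n t) has_integral (u T * \<phi>' n T - u s * \<phi>' n s)) {s..T}"
    proof (rule fundamental_theorem_of_calculus)
      fix t assume t: "t \<in> {s..T}"
      then have "((\<lambda>t. u t * \<phi>' n t) has_real_derivative (u1 t * \<phi>' n t + \<phi>'' n t * u t)) (at t within {s..T})"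
        using sub by (intro DERIV_mult DERIV_subset[OF u] has_field_derivative_at_within[OF d2]) auto
      then show "((\<lambda>t. u t * \<phi>' n t) has_vector_derivative (u1 t * \<phi>' n t + u t * \<phi>'' n t)) (at t within {s..T})"
        by (simp add: has_real_derivative_iff_has_vector_derivative mult.commute)
    qed (use ab in auto)
    then have "integral {s..T} (\<lambda>t. u1 t * \<phi>' n t + u t * \<phi>'' n t) = 0"
      using out[of T n] out[of s n] by (simp add: integral_unique)
    then have "integral {s..T} (\<lambda>t. u1 t * \<phi>' n t) + integral {s..T} (\<lambda>t. u t * \<phi>'' n t) = 0"
      by (subst Henstock_Kurzweil_Integration.integral_add[symmetric])
        (auto intro!: integrable_continuous_interval continuous_intros c
          continuous_on_subset[OF uc sub] continuous_on_subset[OF u1 sub])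
    ultimately show ?thesis by linarith
  qed
  have one: "(\<lambda>n. \<phi> n t) \<longlonglongrightarrow> 1" if "s < t" "t < T" for t
  proof -
    have "(\<lambda>n. exp (- l n / ((t - s) * (T - t)))) \<longlonglongrightarrow> exp (- 0 / ((t - s) * (T - t)))"
      using that by (intro tendsto_intros l0) auto
    then show ?thesis using that by (simp add: \<phi>_def bump_def)
  qed
  \<comment> \<open>The derivative of Q is s + T - 2t, so \<open>\<phi>'\<close> changes sign
    exactly at the midpoint, and each half has the fixed sign that its endpoint lemma
    requires.\<close>
  define m where "m = (s + T) / 2"
  have m: "s < m" "m < T" using ab by (auto simp: m_def)
  have pQ: "poly (pderiv Q) t = s + T - 2 * t" for t by (simp add: Q_def pderiv_mult pderiv_pCons)
  have "(\<lambda>n. integral {s..m} (\<lambda>t. u1 t * \<phi>' n t)) \<longlonglongrightarrow> u1 s"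
  proof (rule tendsto_integral_mult_left_endpoint[where \<Phi> = \<phi>])
    show "continuous_on {s..m} u1" using sub m by (intro continuous_on_subset[OF u1]) auto
    show "0 \<le> \<phi>' n t" if "t \<in> {s..m}" for n t
      using that l[of n] by (auto simp: \<phi>'_def bump_def pQ m_def)
    show "(\<phi> n has_real_derivative \<phi>' n t) (at t within {s..m})" for n t
      by (rule has_field_derivative_at_within[OF d1])
  qed (use m out one c in auto)
  moreover have "(\<lambda>n. integral {m..T} (\<lambda>t. u1 t * \<phi>' n t)) \<longlonglongrightarrow> - u1 T"
  proof (rule tendsto_integral_mult_right_endpoint[where \<Phi> = \<phi>])
    show "continuous_on {m..T} u1" using sub m by (intro continuous_on_subset[OF u1]) auto
    show "\<phi>' n t \<le> 0" if "t \<in> {m..T}" for n t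
    proof -
      have "l n * (s + T - 2 * t) \<le> 0"
        using that l[of n] by (intro mult_nonneg_nonpos) (auto simp: m_def)
      then have "l n * (s + T - 2 * t) / ((t - s) * (T - t))\<^sup>2 * exp (- l n / ((t - s) * (T - t))) \<le> 0"
        by (rule mult_nonpos_nonneg[OF divide_nonpos_nonneg[OF _ zero_le_power2] exp_ge_zero])
      then show ?thesis by (simp add: \<phi>'_def bump_def pQ)
    qed
    show "(\<phi> n has_real_derivative \<phi>' n t) (at t within {m..T})" for n t
      by (rule has_field_derivative_at_within[OF d1])
  qed (use m out one c in auto)
  ultimately have "(\<lambda>n. - (integral {s..m} (\<lambda>t. u1 t * \<phi>' n t) + integral {m..T} (\<lambda>t. u1 t * \<phi>' n t)))
      \<longlonglongrightarrow> - (u1 s + - u1 T)"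
    by (intro tendsto_intros)
  moreover have "integral {s..m} (\<lambda>t. u1 t * \<phi>' n t) + integral {m..T} (\<lambda>t. u1 t * \<phi>' n t)
      = integral {s..T} (\<lambda>t. u1 t * \<phi>' n t)" for n
    using m by (intro Henstock_Kurzweil_Integration.integral_combine integrable_continuous_interval continuous_intros c
        continuous_on_subset[OF u1 sub]) auto
  ultimately have L: "(\<lambda>n. LINT t:{a<..<b}|lborel. w t * \<phi> n t) \<longlonglongrightarrow> u1 T - u1 s"
    by (simp add: eq)
  have wi: "integrable lborel (\<lambda>t. indicator {a<..<b} t *\<^sub>R w t)"
    using w by (simp add: set_integrable_def)
  have wm [measurable]: "(\<lambda>t. indicator {a<..<b} t *\<^sub>R w t) \<in> borel_measurable borel"
    using borel_measurable_integrable[OF wi] by simp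
  have [measurable]: "\<phi> n \<in> borel_measurable borel" for n
    by (intro borel_measurable_continuous_onI c)
  \<comment> \<open>The bumps lie between 0 and 1 and tend to the indicator of the open interval, so
    the absolute value of \<open>w\<close> dominates.\<close>
  have R: "(\<lambda>n. LINT t|lborel. (indicator {a<..<b} t *\<^sub>R w t) * \<phi> n t) \<longlonglongrightarrow>
      (LINT t|lborel. (indicator {a<..<b} t *\<^sub>R w t) * indicator {s<..<T} t)"
  proof (rule integral_dominated_convergence)
    show "integrable lborel (\<lambda>t. \<bar>indicator {a<..<b} t *\<^sub>R w t\<bar>)" using wi by (rule integrable_abs)
    show "AE t in lborel. (\<lambda>n. indicator {a<..<b} t *\<^sub>R w t * \<phi> n t) \<longlonglongrightarrow> indicator {a<..<b} t *\<^sub>R w t * indicator {s<..<T} t"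
    proof (intro AE_I2 tendsto_mult tendsto_const)
      fix t
      show "(\<lambda>n. \<phi> n t) \<longlonglongrightarrow> indicator {s<..<T} t"
        using one[of t] out[of t] by (cases "s < t \<and> t < T") auto
    qed
    show "AE t in lborel. norm (indicator {a<..<b} t *\<^sub>R w t * \<phi> n t) \<le> \<bar>indicator {a<..<b} t *\<^sub>R w t\<bar>" for n
    proof (intro AE_I2)
      fix t
      have "\<bar>\<phi> n t\<bar> \<le> 1" using l[of n] by (auto simp: \<phi>_def bump_def)
      then show "norm (indicator {a<..<b} t *\<^sub>R w t * \<phi> n t) \<le> \<bar>indicator {a<..<b} t *\<^sub>R w t\<bar>"
        by (simp add: abs_mult mult_left_le)
    qed
  qed measurable
  have "(LINT t|lborel. (indicator {a<..<b} t *\<^sub>R w t) * \<phi> n t) = (LINT t:{a<..<b}|lborel. w t * \<phi> n t)" for n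
    by (simp add: set_lebesgue_integral_def mult.assoc)
  moreover have "(LINT t|lborel. (indicator {a<..<b} t *\<^sub>R w t) * indicator {s<..<T} t) = (LINT t:{s<..<T}|lborel. w t)"
    unfolding set_lebesgue_integral_def
    by (intro Bochner_Integration.integral_cong) (use ab in \<open>auto split: split_indicator\<close>)
  ultimately show ?thesis using LIMSEQ_unique[OF L] R by simp
qed

text \<open>
  The absolutely continuous form of membership in $W^{2,2}(a,b)$: \<open>u1\<close> is the classical first
  derivative of \<open>u\<close>, and \<open>w\<close> is a square integrable density of \<open>u1\<close>.
\<close>

definition W22_rep :: "real \<Rightarrow> real \<Rightarrow> (real \<Rightarrow> real) \<Rightarrow> (real \<Rightarrow> real) \<Rightarrow> (real \<Rightarrow> real) \<Rightarrow> bool" where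
  "W22_rep a b u u1 w \<longleftrightarrow>
     (\<forall>t\<in>{a..b}. (u has_real_derivative u1 t) (at t within {a..b})) \<and> continuous_on {a..b} u1 \<and>
     square_integrable a b w \<and>
     (\<forall>s t. a \<le> s \<longrightarrow> s \<le> t \<longrightarrow> t \<le> b \<longrightarrow> (w has_integral (u1 t - u1 s)) {s..t})"

text \<open>Test functions vanish near \<open>a\<close> and \<open>b\<close>, so the increment
  formula is first known in the interior only. There \<open>h\<close> is constant, and its
  continuity on the closed interval carries the formula to the endpoints.\<close>

lemma W22_rep_of_weak_deriv:
  assumes ab: "a < b"
    and u: "\<And>t. t \<in> {a..b} \<Longrightarrow> (u has_real_derivative u1 t) (at t within {a..b})"
    and u1: "continuous_on {a..b} u1"
    and w: "square_integrable a b w" and wd: "has_weak_deriv 2 a b u w"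
  shows "W22_rep a b u u1 w"
proof -
  have wi: "set_integrable lborel {a<..<b} w" by (rule square_integrable_set_integrable[OF w])
  have wi': "w integrable_on {a..b}"
    using square_integrable_absolutely_integrable[OF w] set_lebesgue_integral_eq_integral(1) by blast
  have inc: "u1 T - u1 s = integral {s..T} w" if "a < s" "s < T" "T < b" for s T
  proof -
    have "set_integrable lborel {s<..<T} w" using that by (intro set_integrable_subset[OF wi]) auto
    then show ?thesis
      using weak_deriv2_increment_interior[OF u u1 wi wd that]
      by (simp add: set_borel_integral_eq_integral(2) integral_open_interval_real)
  qed
  define h where "h t = u1 t - integral {a..t} w" for t
  define m where "m = (a + b) / 2"
  have m: "a < m" "m < b" using ab by (auto simp: m_def)
  have comb: "integral {a..t} w - integral {a..s} w = integral {s..t} w" if "a \<le> s" "s \<le> t" "t \<le> b" for s t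
    using Henstock_Kurzweil_Integration.integral_combine[of a s t w] that
      integrable_on_subinterval[OF wi', of a t] by auto
  have hc: "continuous_on (closure {a<..<b}) h"
    using ab unfolding h_def by (auto intro!: continuous_intros u1 indefinite_integral_continuous_1 wi')
  have "h t = h m" if "t \<in> {a<..<b}" for t
  proof -
    consider "t < m" | "t = m" | "m < t" by linarith
    then show ?thesis
    proof cases
      case 1
      then show ?thesis using inc[of t m] comb[of t m] that m by (simp add: h_def)
    next
      case 3
      then show ?thesis using inc[of m t] comb[of m t] that m by (simp add: h_def)
    qed simp
  qed
  then have hm: "h t = h m" if "t \<in> {a..b}" for t
    using continuous_constant_on_closure[OF hc, of "h m" t] that ab by simp
  have "(w has_integral (u1 t - u1 s)) {s..t}" if "a \<le> s" "s \<le> t" "t \<le> b" for s t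
  proof -
    have "u1 t - u1 s = integral {s..t} w"
      using hm[of s] hm[of t] comb[OF that] that by (simp add: h_def)
    moreover have "w integrable_on {s..t}" using that by (intro integrable_on_subinterval[OF wi']) auto
    ultimately show ?thesis by (simp add: has_integral_integral)
  qed
  then show ?thesis using u u1 w by (simp add: W22_rep_def)
qed

section \<open>Integration by parts for absolutely continuous derivatives\<close>

text \<open>The bound is of second order: on n + 1 equal pieces the factor y - x becomes (b - a)/(n
  + 1), while the increments of \<open>A\<close> telescope. The increment of \<open>H\<close> over
  the whole interval is thus at most a constant over n + 1.\<close>

lemma eq_endpoints_of_increment_bound:
  fixes H A :: "real \<Rightarrow> real"
  assumes ab: "a \<le> b"
    and inc: "\<And>x y. a \<le> x \<Longrightarrow> x \<le> y \<Longrightarrow> y \<le> b \<Longrightarrow> \<bar>H y - H x\<bar> \<le> C * (y - x) * (A y - A x)"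
  shows "H b = H a"
proof -
  define K where "K = C * (b - a) * (A b - A a)"
  have est: "\<bar>H b - H a\<bar> \<le> K / (real n + 1)" for n
  proof -
    define p where "p i = a + (b - a) * (real i / (real n + 1))" for i
    have r: "real n + 1 \<noteq> 0" by linarith
    have q: "real (Suc n) / (real n + 1) = 1" using r by (metis of_nat_Suc add.commute divide_self)
    have p: "p 0 = a" "p (Suc n) = b" unfolding p_def q by simp_all
    have step: "p (Suc i) - p i = (b - a) / (real n + 1)" for i
      unfolding p_def by (simp add: divide_inverse) (simp add: algebra_simps)
    have mono: "a \<le> p i" "p i \<le> p (Suc i)" for i
    proof -
      show "a \<le> p i" using ab by (simp add: p_def)
      have "0 \<le> (b - a) / (real n + 1)" using ab by simp
      then show "p i \<le> p (Suc i)" using step[of i] by linarith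
    qed
    have le: "p (Suc i) \<le> b" if "i \<le> n" for i
    proof -
      have "(b - a) * (real (Suc i) / (real n + 1)) \<le> (b - a) * 1"
        using that ab by (intro mult_left_mono) auto
      then show ?thesis by (simp add: p_def)
    qed
    have "H b - H a = (\<Sum>i<Suc n. H (p (Suc i)) - H (p i))"
      using sum_lessThan_telescope[of "\<lambda>i. H (p i)" "Suc n"] by (simp only: p)
    also have "\<bar>\<dots>\<bar> \<le> (\<Sum>i<Suc n. \<bar>H (p (Suc i)) - H (p i)\<bar>)" by (rule sum_abs)
    also have "\<dots> \<le> (\<Sum>i<Suc n. C * ((b - a) / (real n + 1)) * (A (p (Suc i)) - A (p i)))"
    proof (rule sum_mono)
      fix i assume "i \<in> {..<Suc n}"
      then show "\<bar>H (p (Suc i)) - H (p i)\<bar> \<le> C * ((b - a) / (real n + 1)) * (A (p (Suc i)) - A (p i))"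
        using inc[OF mono(1,2)[of i] le[of i]] by (simp only: step) simp
    qed
    also have "\<dots> = C * ((b - a) / (real n + 1)) * (A b - A a)"
      using sum_lessThan_telescope[of "\<lambda>i. A (p i)" "Suc n"]
      by (simp only: sum_distrib_left[symmetric] p)
    finally show ?thesis by (simp add: K_def)
  qed
  have "(\<lambda>n. K / (real n + 1)) \<longlonglongrightarrow> 0"
    using tendsto_mult_right_zero[OF LIMSEQ_inverse_real_of_nat, of K] by (simp add: divide_inverse add.commute)
  then have "\<bar>H b - H a\<bar> \<le> 0" by (rule LIMSEQ_le_const) (use est in auto)
  then show ?thesis by simp
qed

lemma absolutely_integrable_mult_continuous:
  fixes w \<phi> :: "real \<Rightarrow> real"
  assumes "w absolutely_integrable_on {a..b}" "continuous_on {a..b} \<phi>"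
  shows "(\<lambda>t. w t * \<phi> t) absolutely_integrable_on {a..b}"
proof -
  have "(\<lambda>t. \<phi> t * w t) absolutely_integrable_on {a..b}"
    using assms by (intro absolutely_integrable_bounded_measurable_product_real
      continuous_imp_measurable_on_sets_lebesgue compact_imp_bounded compact_continuous_image) auto
  then show ?thesis by (simp add: mult.commute)
qed

lemma W22_repD:
  assumes "W22_rep a b u u1 w"
  shows "\<And>t. t \<in> {a..b} \<Longrightarrow> (u has_real_derivative u1 t) (at t within {a..b})"
    and "continuous_on {a..b} u" "continuous_on {a..b} u1" "square_integrable a b w"
    and "w absolutely_integrable_on {a..b}" "w integrable_on {a..b}" "(\<lambda>t. \<bar>w t\<bar>) integrable_on {a..b}"
    and "(\<lambda>t. (w t)\<^sup>2) integrable_on {a..b}"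
    and "\<And>s t. a \<le> s \<Longrightarrow> s \<le> t \<Longrightarrow> t \<le> b \<Longrightarrow> (w has_integral (u1 t - u1 s)) {s..t}"
proof -
  show 1: "\<And>t. t \<in> {a..b} \<Longrightarrow> (u has_real_derivative u1 t) (at t within {a..b})"
    and 2: "continuous_on {a..b} u1" and 3: "square_integrable a b w"
    and "\<And>s t. a \<le> s \<Longrightarrow> s \<le> t \<Longrightarrow> t \<le> b \<Longrightarrow> (w has_integral (u1 t - u1 s)) {s..t}"
    using assms by (auto simp: W22_rep_def)
  show "continuous_on {a..b} u" by (rule DERIV_continuous_on) (rule 1)
  show 4: "w absolutely_integrable_on {a..b}"
    by (rule square_integrable_absolutely_integrable[OF 3])
  then show "w integrable_on {a..b}" "(\<lambda>t. \<bar>w t\<bar>) integrable_on {a..b}"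
    by (auto simp: absolutely_integrable_on_def)
  show "(\<lambda>t. (w t)\<^sup>2) integrable_on {a..b}" by (rule square_integrable_power2[OF 3])
qed

text \<open>As \<open>u1\<close> is only an indefinite integral, u1 \<phi> need not be
  differentiable everywhere. On a short interval the integrand is compared with
  \<open>w t * \<phi> y + u1 x * \<phi>' t\<close>, which integrates exactly to the increment of u1
  \<phi>; the error is bounded by a multiple of the length times the integral of the absolute value
  of \<open>w\<close>.\<close>

lemma W22_rep_by_parts:
  assumes ab: "a \<le> b" and u: "W22_rep a b u u1 w"
    and \<phi>: "\<And>t. t \<in> {a..b} \<Longrightarrow> (\<phi> has_real_derivative \<phi>' t) (at t within {a..b})"
    and \<phi>': "continuous_on {a..b} \<phi>'"
  shows "((\<lambda>t. w t * \<phi> t + u1 t * \<phi>' t) has_integral (u1 b * \<phi> b - u1 a * \<phi> a)) {a..b}"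
proof -
  note U = W22_repD[OF u]
  have \<phi>c: "continuous_on {a..b} \<phi>" by (rule DERIV_continuous_on) (rule \<phi>)
  obtain L where L: "\<And>t. t \<in> {a..b} \<Longrightarrow> \<bar>\<phi>' t\<bar> \<le> L"
  proof -
    have "bounded (\<phi>' ` {a..b})" by (intro compact_imp_bounded compact_continuous_image \<phi>') auto
    then obtain B where "\<forall>t\<in>{a..b}. \<bar>\<phi>' t\<bar> \<le> B" by (auto simp: bounded_iff)
    then show ?thesis by (intro that) blast
  qed
  have L0: "0 \<le> L" using L[of a] ab by force
  define F where "F t = w t * \<phi> t + u1 t * \<phi>' t" for t
  have Fi: "F integrable_on {a..b}"
    unfolding F_def
  proof (rule Henstock_Kurzweil_Integration.integrable_add)
    show "(\<lambda>t. w t * \<phi> t) integrable_on {a..b}"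
      using absolutely_integrable_mult_continuous[OF U(5) \<phi>c] by (simp add: absolutely_integrable_on_def)
    show "(\<lambda>t. u1 t * \<phi>' t) integrable_on {a..b}"
      by (intro integrable_continuous_interval continuous_intros U \<phi>')
  qed
  define A where "A t = integral {a..t} (\<lambda>t. \<bar>w t\<bar>)" for t
  define H where "H t = integral {a..t} F - u1 t * \<phi> t" for t
  have "H b = H a"
  proof (rule eq_endpoints_of_increment_bound[OF ab])
    fix x y assume xy: "a \<le> x" "x \<le> y" "y \<le> b"
    have sub: "{x..y} \<subseteq> {a..b}" using xy by auto
    note ii = integrable_on_subinterval[OF _ sub]
    have Ai: "integral {x..y} (\<lambda>t. \<bar>w t\<bar>) = A y - A x"
      using Henstock_Kurzweil_Integration.integral_combine[of a x y "\<lambda>t. \<bar>w t\<bar>"] xy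
        integrable_on_subinterval[OF U(7), of a y] by (simp add: A_def)
    have HF: "(F has_integral (integral {a..y} F - integral {a..x} F)) {x..y}"
      using Henstock_Kurzweil_Integration.integral_combine[of a x y F] xy ii[OF Fi]
        integrable_on_subinterval[OF Fi, of a y] by (simp add: has_integral_integral[symmetric] has_integral_iff)
    have w: "(w has_integral (u1 y - u1 x)) {x..y}" using xy by (intro U) auto
    have p: "(\<phi>' has_integral (\<phi> y - \<phi> x)) {x..y}"
    proof (rule fundamental_theorem_of_calculus[OF xy(2)])
      fix t assume "t \<in> {x..y}"
      then have "(\<phi> has_real_derivative \<phi>' t) (at t within {x..y})"
        using sub by (intro DERIV_subset[OF \<phi>]) auto
      then show "(\<phi> has_vector_derivative \<phi>' t) (at t within {x..y})"
        by (simp add: has_real_derivative_iff_has_vector_derivative)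
    qed
    have i: "((\<lambda>t. F t - (w t * \<phi> y + u1 x * \<phi>' t)) has_integral
        ((integral {a..y} F - integral {a..x} F) - ((u1 y - u1 x) * \<phi> y + u1 x * (\<phi> y - \<phi> x)))) {x..y}"
      by (intro has_integral_diff HF has_integral_add has_integral_mult_left has_integral_mult_right w p)
    have wi: "((\<lambda>t. \<bar>w t\<bar>) has_integral (A y - A x)) {x..y}"
      using ii[OF U(7)] Ai by (simp add: has_integral_iff)
    have j: "((\<lambda>t. \<bar>w t\<bar> * (L * (y - x)) + (A y - A x) * L) has_integral
       ((A y - A x) * (L * (y - x)) + (A y - A x) * L * (y - x))) {x..y}"
      using has_integral_add[OF has_integral_mult_left[OF wi, of "L * (y - x)"] 
        has_integral_const_real[of "(A y - A x) * L" x y]] xy by (simp add: mult_ac)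
    have bd: "norm (F t - (w t * \<phi> y + u1 x * \<phi>' t)) \<le> \<bar>w t\<bar> * (L * (y - x)) + (A y - A x) * L"
      if t: "t \<in> {x..y}" for t
    proof -
      have "F t - (w t * \<phi> y + u1 x * \<phi>' t) = w t * (\<phi> t - \<phi> y) + (u1 t - u1 x) * \<phi>' t"
        by (simp add: F_def algebra_simps)
      moreover have "norm (\<phi> t - \<phi> y) \<le> L * norm (t - y)"
        by (rule field_differentiable_bound[where S = "{a..b}"]) (use \<phi> L t xy in auto)
      then have "\<bar>\<phi> t - \<phi> y\<bar> \<le> L * (y - x)"
        using t L0 mult_left_mono[of "norm (t - y)" "y - x" L] by auto
      moreover have "\<bar>u1 t - u1 x\<bar> \<le> A y - A x"
      proof -
        have tw: "(w has_integral (u1 t - u1 x)) {x..t}" using t xy by (intro U) auto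
        have "norm (integral {x..t} w) \<le> integral {x..t} (\<lambda>t. \<bar>w t\<bar>)"
          using t xy by (intro integral_norm_bound_integral integrable_on_subinterval[OF U(6)] integrable_on_subinterval[OF U(7)]) auto
        also have "\<dots> \<le> integral {x..y} (\<lambda>t. \<bar>w t\<bar>)"
          using t xy by (intro integral_subset_le integrable_on_subinterval[OF U(7)]) auto
        finally show ?thesis using tw Ai by (simp add: has_integral_iff)
      qed
      ultimately show ?thesis
        using L[of t] t xy by (auto simp: abs_mult intro!: order.trans[OF abs_triangle_ineq] add_mono mult_mono)
    qed
    have "norm ((integral {a..y} F - integral {a..x} F) - ((u1 y - u1 x) * \<phi> y + u1 x * (\<phi> y - \<phi> x)))
       \<le> (A y - A x) * (L * (y - x)) + (A y - A x) * L * (y - x)"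
      using integral_norm_bound_integral[of "\<lambda>t. F t - (w t * \<phi> y + u1 x * \<phi>' t)" "{x..y}"
        "\<lambda>t. \<bar>w t\<bar> * (L * (y - x)) + (A y - A x) * L"] i j bd by (simp add: has_integral_iff)
    then show "\<bar>H y - H x\<bar> \<le> (2 * L) * (y - x) * (A y - A x)"
      by (simp add: H_def algebra_simps)
  qed
  then have "integral {a..b} F = u1 b * \<phi> b - u1 a * \<phi> a" by (simp add: H_def)
  then show ?thesis using Fi unfolding F_def by (simp add: has_integral_iff)
qed

section \<open>Closure properties of square integrability and of the absolutely continuous
  form\<close>

lemma square_integrable_continuous:
  assumes "continuous_on {a..b} u"
  shows "square_integrable a b u"
proof -
  have s: "set_integrable lborel {a<..<b} g" if "continuous_on {a..b} g" for g :: "real \<Rightarrow> real"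
    by (rule set_integrable_subset[OF borel_integrable_atLeastAtMost'[OF that]]) auto
  have "set_borel_measurable lborel {a<..<b} u"
    using s[OF assms] unfolding set_integrable_def set_borel_measurable_def by (rule borel_measurable_integrable)
  moreover have "set_integrable lborel {a<..<b} (\<lambda>t. (u t)\<^sup>2)"
    by (intro s continuous_intros assms)
  ultimately show ?thesis by (simp add: square_integrable_def)
qed

lemma square_integrable_lincomb:
  assumes "square_integrable a b u" "square_integrable a b v"
  shows "square_integrable a b (\<lambda>t. c * u t + e * v t)"
proof -
  have m: "set_borel_measurable lborel {a<..<b} (\<lambda>t. c * u t + e * v t)"
  proof -
    have "(\<lambda>t. c * (indicator {a<..<b} t *\<^sub>R u t) + e * (indicator {a<..<b} t *\<^sub>R v t)) \<in> borel_measurable lborel"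
      using assms unfolding square_integrable_def set_borel_measurable_def
      by (intro borel_measurable_add borel_measurable_times) auto
    then show ?thesis unfolding set_borel_measurable_def by (simp add: algebra_simps)
  qed
  have i: "set_integrable lborel {a<..<b} (\<lambda>t. 2 * c\<^sup>2 * (u t)\<^sup>2 + 2 * e\<^sup>2 * (v t)\<^sup>2)"
    using assms unfolding square_integrable_def by (intro set_integral_add set_integrable_mult_right) auto
  have "set_integrable lborel {a<..<b} (\<lambda>t. (c * u t + e * v t)\<^sup>2)"
  proof (rule set_integrable_bound[OF i])
    show "set_borel_measurable lborel {a<..<b} (\<lambda>t. (c * u t + e * v t)\<^sup>2)"
      by (rule set_borel_measurable_power2[OF m])
    show "AE t in lborel. t \<in> {a<..<b} \<longrightarrow> norm ((c * u t + e * v t)\<^sup>2) \<le> norm (2 * c\<^sup>2 * (u t)\<^sup>2 + 2 * e\<^sup>2 * (v t)\<^sup>2)"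
    proof (intro AE_I2 impI)
      fix t
      have "2 * c\<^sup>2 * (u t)\<^sup>2 + 2 * e\<^sup>2 * (v t)\<^sup>2 - (c * u t + e * v t)\<^sup>2 = (c * u t - e * v t)\<^sup>2"
        by (simp add: power2_eq_square algebra_simps)
      then have "(c * u t + e * v t)\<^sup>2 \<le> 2 * c\<^sup>2 * (u t)\<^sup>2 + 2 * e\<^sup>2 * (v t)\<^sup>2"
        by (smt (verit) zero_le_power2)
      then show "norm ((c * u t + e * v t)\<^sup>2) \<le> norm (2 * c\<^sup>2 * (u t)\<^sup>2 + 2 * e\<^sup>2 * (v t)\<^sup>2)"
        by simp
    qed
  qed
  with m show ?thesis by (simp add: square_integrable_def)
qed

lemma square_integrable_subinterval:
  assumes "square_integrable a b u" "a \<le> a'" "b' \<le> b"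
  shows "square_integrable a' b' u"
proof -
  have sub: "{a'<..<b'} \<subseteq> {a<..<b}" using assms by auto
  then show ?thesis
    using assms(1) unfolding square_integrable_def
    by (auto intro: set_integrable_subset set_borel_measurable_subset)
qed

lemma W22_rep_subinterval:
  assumes u: "W22_rep a b u u1 w" and ab: "a \<le> a'" "b' \<le> b"
  shows "W22_rep a' b' u u1 w"
  unfolding W22_rep_def
proof (intro conjI ballI allI impI)
  have sub: "{a'..b'} \<subseteq> {a..b}" using ab by auto
  show "(u has_real_derivative u1 t) (at t within {a'..b'})" if "t \<in> {a'..b'}" for t
    using that sub by (intro DERIV_subset[OF W22_repD(1)[OF u]]) auto
  show "continuous_on {a'..b'} u1" using W22_repD(3)[OF u] sub by (rule continuous_on_subset)
  show "square_integrable a' b' w" using W22_repD(4)[OF u] ab by (rule square_integrable_subinterval)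
  show "(w has_integral u1 t - u1 s) {s..t}" if "a' \<le> s" "s \<le> t" "t \<le> b'" for s t
    using that ab by (intro W22_repD(9)[OF u]) auto
qed

lemma W22_rep_lincomb:
  assumes u: "W22_rep a b u u1 u2" and v: "W22_rep a b v v1 v2"
  shows "W22_rep a b (\<lambda>t. c * u t + e * v t) (\<lambda>t. c * u1 t + e * v1 t) (\<lambda>t. c * u2 t + e * v2 t)"
  unfolding W22_rep_def
proof (intro conjI ballI allI impI)
  show "((\<lambda>t. c * u t + e * v t) has_real_derivative c * u1 t + e * v1 t) (at t within {a..b})" if "t \<in> {a..b}" for t
    using that by (intro DERIV_add DERIV_cmult W22_repD(1)[OF u] W22_repD(1)[OF v])
  show "continuous_on {a..b} (\<lambda>t. c * u1 t + e * v1 t)"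
    by (intro continuous_intros W22_repD(3)[OF u] W22_repD(3)[OF v])
  show "square_integrable a b (\<lambda>t. c * u2 t + e * v2 t)"
    by (intro square_integrable_lincomb W22_repD(4)[OF u] W22_repD(4)[OF v])
  show "((\<lambda>t. c * u2 t + e * v2 t) has_integral c * u1 t + e * v1 t - (c * u1 s + e * v1 s)) {s..t}"
    if "a \<le> s" "s \<le> t" "t \<le> b" for s t
    using has_integral_add[OF has_integral_mult_right[OF W22_repD(9)[OF u that], of c]
      has_integral_mult_right[OF W22_repD(9)[OF v that], of e]] by (simp add: algebra_simps)
qed

lemma W22_rep_diff:
  assumes "W22_rep a b u u1 u2" "W22_rep a b v v1 v2"
  shows "W22_rep a b (\<lambda>t. u t - v t) (\<lambda>t. u1 t - v1 t) (\<lambda>t. u2 t - v2 t)"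
  using W22_rep_lincomb[OF assms, of 1 "-1"] by simp

lemma has_integral_of_has_real_derivative:
  assumes "s \<le> t" "\<And>r. r \<in> {s..t} \<Longrightarrow> (F has_real_derivative f r) (at r within {s..t})"
  shows "(f has_integral (F t - F s)) {s..t}"
  using assms by (intro fundamental_theorem_of_calculus)
    (simp_all add: has_real_derivative_iff_has_vector_derivative)

lemma W22_rep_C2:
  assumes u: "\<And>t. t \<in> {a..b} \<Longrightarrow> (u has_real_derivative u1 t) (at t within {a..b})"
    and u1: "\<And>t. t \<in> {a..b} \<Longrightarrow> (u1 has_real_derivative u2 t) (at t within {a..b})"
    and u2: "continuous_on {a..b} u2"
  shows "W22_rep a b u u1 u2"
  unfolding W22_rep_def
proof (intro conjI ballI allI impI)
  show "continuous_on {a..b} u1" by (rule DERIV_continuous_on) (rule u1)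
  show "square_integrable a b u2" by (rule square_integrable_continuous[OF u2])
  show "(u2 has_integral u1 t - u1 s) {s..t}" if "a \<le> s" "s \<le> t" "t \<le> b" for s t
    using that by (intro has_integral_of_has_real_derivative DERIV_subset[OF u1]) auto
qed (rule u)

lemma set_integrable_mult_bounded:
  fixes w \<phi> :: "real \<Rightarrow> real"
  assumes w: "set_integrable lborel S w" and m: "\<phi> \<in> borel_measurable borel"
    and b: "\<And>t. t \<in> S \<Longrightarrow> \<bar>\<phi> t\<bar> \<le> B"
  shows "set_integrable lborel S (\<lambda>t. w t * \<phi> t)"
proof -
  have i: "integrable lborel (\<lambda>t. indicator S t *\<^sub>R w t)" using w by (simp add: set_integrable_def)
  have "integrable lborel (\<lambda>t. (indicator S t *\<^sub>R w t) * \<phi> t)"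
  proof (rule Bochner_Integration.integrable_bound)
    show "integrable lborel (\<lambda>t. B * (indicator S t *\<^sub>R w t))" using i by (rule integrable_mult_right)
    show "(\<lambda>t. (indicator S t *\<^sub>R w t) * \<phi> t) \<in> borel_measurable lborel"
      using m borel_measurable_integrable[OF i] by (intro borel_measurable_times) auto
    show "AE t in lborel. norm (indicator S t *\<^sub>R w t * \<phi> t) \<le> norm (B * (indicator S t *\<^sub>R w t))"
    proof (intro AE_I2)
      fix t
      show "norm (indicator S t *\<^sub>R w t * \<phi> t) \<le> norm (B * (indicator S t *\<^sub>R w t))"
      proof (cases "t \<in> S")
        case True
        then have "\<bar>w t\<bar> * \<bar>\<phi> t\<bar> \<le> \<bar>w t\<bar> * \<bar>B\<bar>"
          using b[of t] by (intro mult_left_mono) auto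
        then show ?thesis using True by (simp add: abs_mult mult.commute)
      qed simp
    qed
  qed
  then show ?thesis by (simp add: set_integrable_def mult.assoc)
qed

lemma set_lebesgue_integral_Ioo_eq_integral:
  fixes g :: "real \<Rightarrow> real"
  assumes "set_integrable lborel {a<..<b} g"
  shows "set_lebesgue_integral lborel {a<..<b} g = integral {a..b} g"
  using set_borel_integral_eq_integral(2)[OF assms] by (simp add: integral_open_interval_real)

section \<open>Return to weak derivatives and their norms\<close>

lemma test_function_derivs:
  assumes "test_function a b \<phi>"
  shows "\<And>k t. ((deriv ^^ k) \<phi> has_real_derivative (deriv ^^ Suc k) \<phi> t) (at t)"
    and "\<And>k S. continuous_on S ((deriv ^^ k) \<phi>)"
    and "\<And>k t. t \<notin> {a<..<b} \<Longrightarrow> (deriv ^^ k) \<phi> t = 0"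
proof -
  show 1: "((deriv ^^ k) \<phi> has_real_derivative (deriv ^^ Suc k) \<phi> t) (at t)" for k t
    using assms by (simp add: test_function_def DERIV_deriv_iff_field_differentiable)
  show "continuous_on S ((deriv ^^ k) \<phi>)" for k S
    by (intro continuous_at_imp_continuous_on ballI DERIV_isCont[OF 1])
  define C where "C = closure {t. \<phi> t \<noteq> 0}"
  have C: "open (- C)" "C \<subseteq> {a<..<b}" using assms by (auto simp: C_def test_function_def)
  have "(deriv ^^ k) \<phi> t = 0" if "t \<in> - C" for k t
    using that
  proof (induction k arbitrary: t)
    case 0
    then show ?case using closure_subset[of "{t. \<phi> t \<noteq> 0}"] by (auto simp: C_def)
  next
    case (Suc k)
    have ev: "\<forall>\<^sub>F s in nhds t. (deriv ^^ k) \<phi> s = 0"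
      using eventually_nhds_in_open[OF C(1) Suc.prems] by eventually_elim (rule Suc.IH)
    have "((\<lambda>_. 0) has_real_derivative (deriv ^^ Suc k) \<phi> t) (at t)"
      using DERIV_cong_ev[OF refl ev refl] 1[of k t] by blast
    then show ?case by (rule DERIV_unique) (rule DERIV_const)
  qed
  then show "(deriv ^^ k) \<phi> t = 0" if "t \<notin> {a<..<b}" for k t using C that by blast
qed

text \<open>Integration by parts against a test function, whose derivatives all vanish at both ends.
  The step from \<open>u\<close> to \<open>u1\<close> is classical; the step from \<open>u1\<close>
  to \<open>w\<close> needs \<open>W22_rep_by_parts\<close>.\<close>

lemma W22_rep_has_weak_deriv:
  assumes ab: "a < b" and u: "W22_rep a b u u1 w"
  shows "has_weak_deriv 1 a b u u1" "has_weak_deriv 2 a b u w"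
proof -
  note U = W22_repD[OF u]
  have si: "set_lebesgue_integral lborel {a<..<b} g = integral {a..b} g" if "continuous_on {a..b} g" for g :: "real \<Rightarrow> real"
    by (intro set_lebesgue_integral_Ioo_eq_integral set_integrable_subset[OF borel_integrable_atLeastAtMost'[OF that]]) auto
  have key: "integral {a..b} (\<lambda>t. g' t * D t) + integral {a..b} (\<lambda>t. g t * D' t) = 0"
    if g: "\<And>t. t \<in> {a..b} \<Longrightarrow> (g has_real_derivative g' t) (at t within {a..b})"
      and D: "\<And>t. (D has_real_derivative D' t) (at t)" and z: "D a = 0" "D b = 0"
      and c: "continuous_on {a..b} g'" "continuous_on {a..b} D'" for g g' D D'
  proof -
    have "((\<lambda>t. g' t * D t + D' t * g t) has_integral (g b * D b - g a * D a)) {a..b}"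
      using ab by (intro has_integral_of_has_real_derivative DERIV_mult g has_field_derivative_at_within[OF D]) auto
    then have "integral {a..b} (\<lambda>t. g' t * D t + g t * D' t) = 0"
      using z by (simp add: integral_unique mult.commute)
    moreover have "continuous_on {a..b} g" by (rule DERIV_continuous_on) (rule g)
    moreover have "continuous_on {a..b} D" 
      by (intro continuous_at_imp_continuous_on ballI DERIV_isCont[OF D])
    ultimately show ?thesis
      by (subst Henstock_Kurzweil_Integration.integral_add[symmetric])
        (auto intro!: integrable_continuous_interval continuous_intros c)
  qed
  show "has_weak_deriv 1 a b u u1" unfolding has_weak_deriv_def
  proof (intro allI impI)
    fix \<phi> assume t: "test_function a b \<phi>"
    note T = test_function_derivs[OF t]
    have "integral {a..b} (\<lambda>t. u1 t * (deriv ^^ 0) \<phi> t) + integral {a..b} (\<lambda>t. u t * (deriv ^^ 1) \<phi> t) = 0"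
      using T(1)[of 0] by (intro key U T) auto
    then show "(LINT t:{a<..<b}|lborel. u t * (deriv ^^ 1) \<phi> t) = (- 1) ^ 1 * (LINT t:{a<..<b}|lborel. u1 t * \<phi> t)"
      using T(2)[of _ 1] T(2)[of _ 0] by (subst (1 2) si) (auto intro!: continuous_intros U)
  qed
  show "has_weak_deriv 2 a b u w" unfolding has_weak_deriv_def
  proof (intro allI impI)
    fix \<phi> assume t: "test_function a b \<phi>"
    note T = test_function_derivs[OF t]
    have 1: "integral {a..b} (\<lambda>t. u1 t * (deriv ^^ 1) \<phi> t) + integral {a..b} (\<lambda>t. u t * (deriv ^^ 2) \<phi> t) = 0"
      using T(1)[of 1] by (intro key U T) (auto simp: numeral_2_eq_2)
    have \<phi>: "(\<phi> has_real_derivative (deriv ^^ 1) \<phi> t) (at t)" for t using T(1)[of 0] by simp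
    have \<phi>c: "continuous_on S \<phi>" for S using T(2)[of _ 0] by simp
    have z: "\<phi> a = 0" "\<phi> b = 0" using T(3)[of a 0] T(3)[of b 0] by auto
    have "((\<lambda>t. w t * \<phi> t + u1 t * (deriv ^^ 1) \<phi> t) has_integral (u1 b * \<phi> b - u1 a * \<phi> a)) {a..b}"
      using ab by (intro W22_rep_by_parts[OF _ u] has_field_derivative_at_within[OF \<phi>] T) auto
    then have "integral {a..b} (\<lambda>t. w t * \<phi> t + u1 t * (deriv ^^ 1) \<phi> t) = 0"
      using z by (simp add: integral_unique)
    moreover have "(\<lambda>t. w t * \<phi> t) integrable_on {a..b}"
      using absolutely_integrable_mult_continuous[OF U(5) \<phi>c] by (simp add: absolutely_integrable_on_def)
    ultimately have 2: "integral {a..b} (\<lambda>t. w t * \<phi> t) + integral {a..b} (\<lambda>t. u1 t * (deriv ^^ 1) \<phi> t) = 0"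
      by (subst Henstock_Kurzweil_Integration.integral_add[symmetric])
        (auto intro!: integrable_continuous_interval continuous_on_mult U T(2)[of _ 1, simplified])
    obtain B where B: "\<And>t. t \<in> {a..b} \<Longrightarrow> \<bar>\<phi> t\<bar> \<le> B"
    proof -
      have "bounded (\<phi> ` {a..b})" by (intro compact_imp_bounded compact_continuous_image \<phi>c) auto
      then obtain B where "\<forall>t\<in>{a..b}. \<bar>\<phi> t\<bar> \<le> B" by (auto simp: bounded_iff)
      then show ?thesis by (intro that) blast
    qed
    have "set_integrable lborel {a<..<b} (\<lambda>t. w t * \<phi> t)"
      by (rule set_integrable_mult_bounded[OF square_integrable_set_integrable[OF U(4)]
          borel_measurable_continuous_onI[OF \<phi>c], of B]) (use B in auto)
    then have "(LINT t:{a<..<b}|lborel. w t * \<phi> t) = integral {a..b} (\<lambda>t. w t * \<phi> t)"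
      by (rule set_lebesgue_integral_Ioo_eq_integral)
    moreover have "(LINT t:{a<..<b}|lborel. u t * (deriv ^^ 2) \<phi> t) = integral {a..b} (\<lambda>t. u t * (deriv ^^ 2) \<phi> t)"
      by (intro si continuous_on_mult U T)
    ultimately show "(LINT t:{a<..<b}|lborel. u t * (deriv ^^ 2) \<phi> t) = (- 1) ^ 2 * (LINT t:{a<..<b}|lborel. w t * \<phi> t)"
      using 1 2 by simp
  qed
qed

text \<open>Membership lets the hypothesis \<open>sobolev_constant\<close>, which is stated for
  \<open>W22\<close>, be applied to the error function.\<close>

lemma W22_rep_in_W22:
  assumes ab: "a < b" and u: "W22_rep a b u u1 w"
  shows "u \<in> W22 a b"
proof -
  note U = W22_repD[OF u]
  have "Ck_on 1 {a..b} u" unfolding Ck_on_def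
    by (rule exI[of _ "\<lambda>k. if k = 0 then u else u1"]) (use U in auto)
  then show ?thesis
    using W22_rep_has_weak_deriv[OF ab u] U(4) square_integrable_continuous[OF U(2)] square_integrable_continuous[OF U(3)]
    by (auto simp: W22_def)
qed

text \<open>Since \<open>weak_deriv\<close> picks some representative, its norm must not depend on
  the pick. The classical first derivatives coincide, so both densities have the same integral from
  any point up to \<open>b\<close> and agree almost everywhere.\<close>

lemma W22_rep_L2norm_unique:
  assumes ab: "a < b" and u: "W22_rep a b u u1 w" and v: "W22_rep a b u v1 w'"
  shows "L2norm a b w = L2norm a b w'"
proof -
  note U = W22_repD[OF u] and V = W22_repD[OF v]
  have eq: "u1 t = v1 t" if "t \<in> {a..b}" for t
    using U(1)[OF that] V(1)[OF that] that ab
    by (metis has_real_derivative_iff_has_vector_derivative vector_derivative_unique_within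
        trivial_limit_within islimpt_Icc)
  have wi: "integrable lborel (\<lambda>t. indicator {a<..<b} t *\<^sub>R w t)" "integrable lborel (\<lambda>t. indicator {a<..<b} t *\<^sub>R w' t)"
    using square_integrable_set_integrable[OF U(4)] square_integrable_set_integrable[OF V(4)]
    by (auto simp: set_integrable_def)
  define h where "h t = indicator {a<..<b} t *\<^sub>R w t - indicator {a<..<b} t *\<^sub>R w' t" for t
  have hi: "integrable lborel h" unfolding h_def by (intro Bochner_Integration.integrable_diff wi)
  have "AE t in lborel. h t = 0"
  proof (rule AE_eq_zero_of_integral_greaterThan[OF hi])
    fix x :: real
    \<comment> \<open>The ray beyond \<open>x\<close> meets the open interval in
      \<open>{y<..<b}\<close>, which is empty unless y < b.\<close>
    define y where "y = max a x"
    show "(LINT t|lborel. indicator {x<..} t * h t) = 0"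
    proof (cases "y < b")
      case False
      then have "(\<lambda>t. indicator {x<..} t * h t) = (\<lambda>t. 0)"
        by (auto simp: h_def y_def split: split_indicator)
      then show ?thesis by simp
    next
      case True
      have y: "a \<le> y" by (simp add: y_def)
      have si: "set_integrable lborel {y<..<b} w" "set_integrable lborel {y<..<b} w'"
        by (rule square_integrable_set_integrable, rule square_integrable_subinterval[OF U(4)], use y in auto)
          (rule square_integrable_set_integrable, rule square_integrable_subinterval[OF V(4)], use y in auto)
      have "(LINT t|lborel. indicator {x<..} t * h t) = (LINT t:{y<..<b}|lborel. w t - w' t)"
        unfolding set_lebesgue_integral_def
        by (intro Bochner_Integration.integral_cong) (auto simp: h_def y_def split: split_indicator)
      also have "\<dots> = integral {y..b} w - integral {y..b} w'"
        by (simp add: set_integral_diff(2)[OF si] set_lebesgue_integral_Ioo_eq_integral si)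
      also have "\<dots> = 0"
        using U(9)[of y b] V(9)[of y b] eq[of y] eq[of b] y True ab by (simp add: integral_unique)
      finally show ?thesis .
    qed
  qed
  then have "(LINT t|lborel. (indicator {a<..<b} t *\<^sub>R w t)\<^sup>2) = (LINT t|lborel. (indicator {a<..<b} t *\<^sub>R w' t)\<^sup>2)"
    by (intro integral_cong_AE borel_measurable_power borel_measurable_integrable[OF wi(1)] borel_measurable_integrable[OF wi(2)])
      (auto simp: h_def elim!: eventually_mono)
  moreover have "(LINT t|lborel. (indicator {a<..<b} t *\<^sub>R g t)\<^sup>2) = (LINT t:{a<..<b}|lborel. (g t)\<^sup>2)" for g :: "real \<Rightarrow> real"
    unfolding set_lebesgue_integral_def
    by (intro Bochner_Integration.integral_cong) (auto split: split_indicator)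
  ultimately show ?thesis by (simp add: L2norm_def)
qed

lemma W22_obtain_rep:
  assumes ab: "a < b" and f: "f \<in> W22 a b"
  obtains f1 where "W22_rep a b f f1 (weak_deriv 2 a b f)"
proof -
  obtain D where D: "D 0 = f" "\<And>t. t \<in> {a..b} \<Longrightarrow> (D 0 has_real_derivative D (Suc 0) t) (at t within {a..b})"
    "continuous_on {a..b} (D 1)"
    using f by (auto simp: W22_def Ck_on_def)
  obtain w where "square_integrable a b w" "has_weak_deriv 2 a b f w"
    using f by (auto simp: W22_def)
  then have "square_integrable a b (weak_deriv 2 a b f) \<and> has_weak_deriv 2 a b f (weak_deriv 2 a b f)"
    unfolding weak_deriv_def by (intro someI[of "\<lambda>w. square_integrable a b w \<and> has_weak_deriv 2 a b f w" w]) simp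
  then have "W22_rep a b f (D 1) (weak_deriv 2 a b f)"
    using D by (intro W22_rep_of_weak_deriv[OF ab]) auto
  then show ?thesis by (rule that)
qed

text \<open>Translates the norms in \<open>tikhonov\<close> and \<open>sobolev_constant\<close> into
  integrals of whichever density is at hand.\<close>

lemma W22_rep_L2norm_weak_deriv:
  assumes ab: "a < b" and u: "W22_rep a b u u1 w"
  shows "(L2norm a b (weak_deriv 2 a b u))\<^sup>2 = sq_integral a b w"
proof -
  obtain v1 where "W22_rep a b u v1 (weak_deriv 2 a b u)"
    using W22_obtain_rep[OF ab W22_rep_in_W22[OF ab u]] .
  then show ?thesis
    using W22_rep_L2norm_unique[OF ab u] square_integrable_power2(2)[OF W22_repD(4)[OF u]] by metis
qed

lemma W22_rep_L2norm_deriv: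
  assumes u: "W22_rep a b u u1 w"
  shows "(L2norm a b (deriv u))\<^sup>2 = sq_integral a b u1"
proof -
  have "deriv u t = u1 t" if "t \<in> {a<..<b}" for t
  proof -
    have "at t within {a..b} = at t" using that by (intro at_within_interior) auto
    then show ?thesis using W22_repD(1)[OF u, of t] that by (intro DERIV_imp_deriv) auto
  qed
  then have "L2norm a b (deriv u) = L2norm a b u1"
    unfolding L2norm_def set_lebesgue_integral_def
    by (intro arg_cong[of _ _ sqrt] Bochner_Integration.integral_cong) (auto split: split_indicator)
  then show ?thesis
    using square_integrable_power2(2)[OF square_integrable_continuous[OF W22_repD(3)[OF u]]] by simp
qed

subsection \<open>Sobolev and sampling inequalities\<close>

lemma Cauchy_Schwarz_integral_on:
  fixes f g :: "real \<Rightarrow> real"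
  assumes "(\<lambda>t. (f t)\<^sup>2) integrable_on S" "(\<lambda>t. f t * g t) integrable_on S" "(\<lambda>t. (g t)\<^sup>2) integrable_on S"
  shows "(integral S (\<lambda>t. f t * g t))\<^sup>2 \<le> integral S (\<lambda>t. (f t)\<^sup>2) * integral S (\<lambda>t. (g t)\<^sup>2)"
proof -
  define A where "A = integral S (\<lambda>t. (f t)\<^sup>2)"
  define B where "B = integral S (\<lambda>t. f t * g t)"
  define C where "C = integral S (\<lambda>t. (g t)\<^sup>2)"
  have q: "0 \<le> A - 2 * r * B + r\<^sup>2 * C" for r
  proof -
    have "((\<lambda>t. (f t)\<^sup>2 - (2 * r) * (f t * g t) + r\<^sup>2 * (g t)\<^sup>2) has_integral (A - 2 * r * B + r\<^sup>2 * C)) S"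
      unfolding A_def B_def C_def
      by (intro has_integral_add has_integral_diff has_integral_mult_right integrable_integral assms)
    moreover have "0 \<le> (f t)\<^sup>2 - (2 * r) * (f t * g t) + r\<^sup>2 * (g t)\<^sup>2" for t
      using zero_le_power2[of "f t - r * g t"] by (simp add: power2_eq_square algebra_simps)
    ultimately show ?thesis by (rule has_integral_nonneg)
  qed
  have C0: "0 \<le> C" unfolding C_def by (rule Henstock_Kurzweil_Integration.integral_nonneg) (use assms in auto)
  have "B\<^sup>2 \<le> A * C"
  proof (cases "C = 0")
    case True
    have "B = 0"
    proof (rule ccontr)
      assume "B \<noteq> 0"
      \<comment> \<open>For C = 0 the form is A - 2 r B, and this r gives it the value -1.\<close>
      then show False using q[of "(A + 1) / (2 * B)"] True by simp
    qed
    then show ?thesis using True by simp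
  next
    case False
    then have "0 < C" using C0 by simp
    then show ?thesis using q[of "B / C"] by (simp add: field_simps power2_eq_square)
  qed
  then show ?thesis by (simp add: A_def B_def C_def)
qed

lemma has_integral_increment_power2_le:
  fixes w :: "real \<Rightarrow> real"
  assumes "a \<le> s" "s \<le> t" "t \<le> b" and i: "(w has_integral v) {s..t}"
    and w2: "(\<lambda>t. (w t)\<^sup>2) integrable_on {a..b}"
  shows "v\<^sup>2 \<le> (t - s) * sq_integral a b w"
proof -
  have w2': "(\<lambda>t. (w t)\<^sup>2) integrable_on {s..t}"
    using assms by (intro integrable_on_subinterval[OF w2]) auto
  have "v\<^sup>2 \<le> (t - s) * sq_integral s t w"
    using Cauchy_Schwarz_integral_on[of w "{s..t}" "\<lambda>_. 1"] i w2' assms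
      integrable_const_ivl[of "1::real" s t] by (simp add: has_integral_iff mult.commute)
  also have "\<dots> \<le> (t - s) * sq_integral a b w"
    using assms by (intro mult_left_mono integral_subset_le w2 w2') auto
  finally show ?thesis .
qed

lemma W22_rep_deriv_oscillation:
  assumes u: "W22_rep a b u u1 w" and st: "s \<in> {a..b}" "t \<in> {a..b}"
  shows "(u1 t - u1 s)\<^sup>2 \<le> (b - a) * sq_integral a b w"
proof -
  note U = W22_repD[OF u]
  have w0: "0 \<le> sq_integral a b w"
    by (rule Henstock_Kurzweil_Integration.integral_nonneg) (use U in auto)
  have *: "(u1 t - u1 s)\<^sup>2 \<le> (b - a) * sq_integral a b w"
    if "a \<le> s" "s \<le> t" "t \<le> b" for s t
  proof -
    have "(u1 t - u1 s)\<^sup>2 \<le> (t - s) * sq_integral a b w"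
      using that by (intro has_integral_increment_power2_le U) auto
    also have "\<dots> \<le> (b - a) * sq_integral a b w"
      using that w0 by (intro mult_right_mono) auto
    finally show ?thesis .
  qed
  show ?thesis
    using *[of s t] *[of t s] st by (cases "s \<le> t") (auto simp: power2_commute)
qed

lemma abs_le_sqrtI: "x\<^sup>2 \<le> y \<Longrightarrow> \<bar>x\<bar> \<le> sqrt (y::real)"
  by (metis real_sqrt_abs real_sqrt_le_mono)

text \<open>
  By partial integration $m = 12 h^{-3} \int u(s)(s-c)\,ds$, with $c$ the midpoint, is a weighted mean
  of \<open>u1\<close> with weight $6 h^{-3} (s-a)(b-s)$, so it differs from every value of \<open>u1\<close> by at most the
  oscillation of \<open>u1\<close>.
\<close>

lemma W22_rep_sobolev_inequality:
  assumes ab: "a < b" and u: "W22_rep a b u u1 w"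
  defines "h \<equiv> b - a"
  shows "sq_integral a b u1 \<le>
    24 / h\<^sup>2 * sq_integral a b u + 2 * h\<^sup>2 * sq_integral a b w"
proof -
  note U = W22_repD[OF u]
  have h: "0 < h" using ab by (simp add: h_def)
  define c where "c = (a + b) / 2"
  \<comment> \<open>The antiderivative of c - s that vanishes at both ends, so that the integration
    by parts leaves no boundary terms.\<close>
  define k where "k s = (s - a) * (b - s) / 2" for s
  define E where "E = h * sq_integral a b w"
  have E0: "0 \<le> E" unfolding E_def
    using h U by (intro mult_nonneg_nonneg Henstock_Kurzweil_Integration.integral_nonneg) auto
  have kd: "(k has_real_derivative (c - s)) (at s within X)" for s X
    unfolding k_def c_def by (auto intro!: derivative_eq_intros simp: field_simps)
  have kc: "continuous_on X k" for X unfolding k_def by (intro continuous_intros) auto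
  have k0: "0 \<le> k s" if "s \<in> {a..b}" for s using that by (auto simp: k_def)
  have ki: "(k has_integral h ^ 3 / 12) {a..b}"
  proof -
    have "(k has_integral ((\<lambda>s. (- (s ^ 3) / 3 + c * s\<^sup>2 - a * b * s) / 2) b - (\<lambda>s. (- (s ^ 3) / 3 + c * s\<^sup>2 - a * b * s) / 2) a)) {a..b}"
      using ab by (intro has_integral_of_has_real_derivative)
        (auto intro!: derivative_eq_intros simp: k_def c_def field_simps power2_eq_square)
    also have "(\<lambda>s. (- (s ^ 3) / 3 + c * s\<^sup>2 - a * b * s) / 2) b - (\<lambda>s. (- (s ^ 3) / 3 + c * s\<^sup>2 - a * b * s) / 2) a = h ^ 3 / 12"
      by (simp add: h_def c_def field_simps power2_eq_square power3_eq_cube)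
    finally show ?thesis .
  qed
  have c2: "((\<lambda>s. (s - c)\<^sup>2) has_integral h ^ 3 / 12) {a..b}"
  proof -
    have "((\<lambda>s. (s - c)\<^sup>2) has_integral ((b - c) ^ 3 / 3 - (a - c) ^ 3 / 3)) {a..b}"
      using ab by (intro has_integral_of_has_real_derivative) (auto intro!: derivative_eq_intros)
    also have "(b - c) ^ 3 / 3 - (a - c) ^ 3 / 3 = h ^ 3 / 12"
      by (simp add: h_def c_def field_simps power3_eq_cube)
    finally show ?thesis .
  qed
  define m where "m = 12 / h ^ 3 * integral {a..b} (\<lambda>s. u s * (s - c))"
  have mk: "integral {a..b} (\<lambda>s. u s * (s - c)) = integral {a..b} (\<lambda>s. u1 s * k s)"
  proof -
    have "((\<lambda>s. u1 s * k s + (c - s) * u s) has_integral (u b * k b - u a * k a)) {a..b}"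
      using ab by (intro has_integral_of_has_real_derivative DERIV_mult U kd) auto
    then have "integral {a..b} (\<lambda>s. u1 s * k s - u s * (s - c)) = 0"
      by (simp add: integral_unique k_def algebra_simps)
    then show ?thesis
      by (subst (asm) Henstock_Kurzweil_Integration.integral_diff)
        (auto intro!: integrable_continuous_interval continuous_intros U kc)
  qed
  have m2: "m\<^sup>2 \<le> 12 / h ^ 3 * sq_integral a b u"
  proof -
    have "(\<lambda>t. (u t)\<^sup>2) integrable_on {a..b}" "(\<lambda>t. u t * (t - c)) integrable_on {a..b}"
      by (intro integrable_continuous_interval continuous_intros U)+
    then have "(integral {a..b} (\<lambda>s. u s * (s - c)))\<^sup>2 \<le> sq_integral a b u * (h ^ 3 / 12)"
      using Cauchy_Schwarz_integral_on[of u "{a..b}" "\<lambda>s. s - c"]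
        integral_unique[OF c2] has_integral_integrable[OF c2] by simp
    then have "(12 / h ^ 3)\<^sup>2 * (integral {a..b} (\<lambda>s. u s * (s - c)))\<^sup>2 \<le> (12 / h ^ 3)\<^sup>2 * (sq_integral a b u * (h ^ 3 / 12))"
      by (intro mult_left_mono) auto
    also have "\<dots> = 12 / h ^ 3 * sq_integral a b u"
    proof -
      have "(12 / H)\<^sup>2 * (J * (H / 12)) = 12 / H * J" if "0 < H" for H J :: real
        using that by (simp add: field_simps power2_eq_square)
      from this[of "h ^ 3"] show ?thesis using h by simp
    qed
    finally show ?thesis unfolding m_def power_mult_distrib .
  qed
  have pt: "(u1 r)\<^sup>2 \<le> 2 * m\<^sup>2 + 2 * E" if r: "r \<in> {a..b}" for r
  proof -
    have osc: "\<bar>u1 s - u1 r\<bar> \<le> sqrt E" if "s \<in> {a..b}" for s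
      using W22_rep_deriv_oscillation[OF u r that] by (intro abs_le_sqrtI) (simp add: E_def h_def)
    have i1: "((\<lambda>s. u1 s * k s) has_integral (m * (h ^ 3 / 12))) {a..b}"
    proof -
      have "(\<lambda>s. u1 s * k s) integrable_on {a..b}"
        by (intro integrable_continuous_interval continuous_intros U kc)
      moreover have "m * (h ^ 3 / 12) = integral {a..b} (\<lambda>s. u1 s * k s)"
        using h by (simp add: m_def mk)
      ultimately show ?thesis by (simp add: has_integral_iff)
    qed
    have A: "((\<lambda>s. u1 s * k s - u1 r * k s) has_integral (m * (h ^ 3 / 12) - u1 r * (h ^ 3 / 12))) {a..b}"
      by (intro has_integral_diff i1 has_integral_mult_right ki)
    have B: "((\<lambda>s. sqrt E * k s) has_integral (sqrt E * (h ^ 3 / 12))) {a..b}"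
      by (intro has_integral_mult_right ki)
    have C: "norm (u1 s * k s - u1 r * k s) \<le> sqrt E * k s" if "s \<in> {a..b}" for s
      using osc[OF that] k0[OF that]
      by (simp add: left_diff_distrib[symmetric] abs_mult mult_right_mono)
    have "norm (m * (h ^ 3 / 12) - u1 r * (h ^ 3 / 12)) \<le> sqrt E * (h ^ 3 / 12)"
      using integral_norm_bound_integral[OF has_integral_integrable[OF A] has_integral_integrable[OF B] C]
      unfolding integral_unique[OF A] integral_unique[OF B] .
    then have "\<bar>m - u1 r\<bar> * (h ^ 3 / 12) \<le> sqrt E * (h ^ 3 / 12)"
      unfolding left_diff_distrib[symmetric] real_norm_def abs_mult using h by simp
    then have "\<bar>m - u1 r\<bar> \<le> sqrt E"
      by (rule mult_right_le_imp_le) (use h in simp)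
    then have "(m - u1 r)\<^sup>2 \<le> E"
      using E0 by (metis abs_le_square_iff abs_of_nonneg real_sqrt_ge_zero real_sqrt_pow2)
    moreover have "(u1 r)\<^sup>2 \<le> 2 * m\<^sup>2 + 2 * (m - u1 r)\<^sup>2"
      using zero_le_power2[of "2 * m - u1 r"] by (simp add: power2_eq_square algebra_simps)
    ultimately show ?thesis by linarith
  qed
  \<comment> \<open>Integrating the pointwise bound over length \<open>h\<close>, the constant 24 is
    2 * 12 with 12 from \<open>m2\<close>, and the 2 is the factor of the oscillation
    \<open>E\<close>.\<close>
  have "sq_integral a b u1 \<le> integral {a..b} (\<lambda>t. 2 * m\<^sup>2 + 2 * E)"
    by (intro integral_le integrable_continuous_interval continuous_intros U pt)
  also have "\<dots> = h * (2 * m\<^sup>2 + 2 * E)" using ab by (simp add: h_def)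
  also have "\<dots> \<le> h * (2 * (12 / h ^ 3 * sq_integral a b u) + 2 * E)"
    using h m2 by (intro mult_left_mono add_right_mono) auto
  also have "\<dots> = 24 / h\<^sup>2 * sq_integral a b u + 2 * h\<^sup>2 * sq_integral a b w"
    using h by (simp add: E_def field_simps power2_eq_square power3_eq_cube)
  finally show ?thesis .
qed

section \<open>Equal partitions and the sampling inequality\<close>

lemma integral_equal_partition:
  fixes f :: "real \<Rightarrow> real"
  assumes h: "0 \<le> h" and f: "f integrable_on {a..a + real n * h}"
  shows "integral {a..a + real n * h} f = (\<Sum>i<n. integral {a + real i * h..a + real (Suc i) * h} f)"
  using f
proof (induction n)
  case 0
  then show ?case by simp
next
  case (Suc n)
  have le: "a \<le> a + real n * h" "a + real n * h \<le> a + real (Suc n) * h"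
    using h by (auto simp: algebra_simps)
  then have "f integrable_on {a..a + real n * h}"
    by (intro integrable_on_subinterval[OF Suc.prems]) auto
  then show ?case
    using Suc.IH Henstock_Kurzweil_Integration.integral_combine[OF le Suc.prems] by simp
qed

text \<open>Choosing the number of pieces makes the length \<open>h\<close> a free parameter, in the
  role of \<epsilon> in the Sobolev inequality.\<close>

lemma W22_rep_sobolev_inequality_partition:
  assumes ab: "a < b" and u: "W22_rep a b u u1 w" and n: "0 < n"
  defines "h \<equiv> (b - a) / real n"
  shows "sq_integral a b u1 \<le>
    24 / h\<^sup>2 * sq_integral a b u + 2 * h\<^sup>2 * sq_integral a b w"
proof -
  note U = W22_repD[OF u]
  have h: "0 < h" and b: "b = a + real n * h" using ab n by (auto simp: h_def)
  have sub: "a \<le> a + real i * h" "a + real (Suc i) * h \<le> b" if "i < n" for i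
  proof -
    show "a \<le> a + real i * h" using h by simp
    have "real (Suc i) * h \<le> real n * h" using that h by (intro mult_right_mono) auto
    then show "a + real (Suc i) * h \<le> b" by (simp add: b)
  qed
  have part: "integral {a..b} f = (\<Sum>i<n. integral {a + real i * h..a + real (Suc i) * h} f)"
    if "f integrable_on {a..b}" for f :: "real \<Rightarrow> real"
    using integral_equal_partition[of h f a n] that h by (simp add: b)
  have i: "(\<lambda>t. (u t)\<^sup>2) integrable_on {a..b}" "(\<lambda>t. (u1 t)\<^sup>2) integrable_on {a..b}"
    by (intro integrable_continuous_interval continuous_intros U)+
  have "(\<Sum>i<n. sq_integral (a + real i * h) (a + real (Suc i) * h) u1) \<le>
      (\<Sum>i<n. 24 / h\<^sup>2 * sq_integral (a + real i * h) (a + real (Suc i) * h) u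
        + 2 * h\<^sup>2 * sq_integral (a + real i * h) (a + real (Suc i) * h) w)"
  proof (rule sum_mono)
    fix i assume "i \<in> {..<n}"
    then have "W22_rep (a + real i * h) (a + real (Suc i) * h) u u1 w"
      using sub by (intro W22_rep_subinterval[OF u]) auto
    moreover have "a + real (Suc i) * h - (a + real i * h) = h" by (simp add: algebra_simps)
    ultimately show "sq_integral (a + real i * h) (a + real (Suc i) * h) u1 \<le>
        24 / h\<^sup>2 * sq_integral (a + real i * h) (a + real (Suc i) * h) u
        + 2 * h\<^sup>2 * sq_integral (a + real i * h) (a + real (Suc i) * h) w"
      using W22_rep_sobolev_inequality[of "a + real i * h" "a + real (Suc i) * h" u u1 w] h by simp
  qed
  then show ?thesis
    by (simp add: part i U sum.distrib sum_distrib_left)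
qed

text \<open>Cauchy-Schwarz controls u t - u \<xi> by the square root of the distance to \<xi>, and
  integrating that distance over both sides of \<xi> gives at most (b - a)^2 / 2. The weight 3/2 on
  the sample value becomes 2 after the absorption in the sampling inequality.\<close>

lemma integral_power2_le_sample:
  assumes u: "\<And>t. t \<in> {a..b} \<Longrightarrow> (u has_real_derivative u1 t) (at t within {a..b})"
    and u1: "continuous_on {a..b} u1" and \<xi>: "\<xi> \<in> {a..b}"
  shows "sq_integral a b u \<le> 3/2 * (b - a) * (u \<xi>)\<^sup>2 + 3/2 * (b - a)\<^sup>2 * sq_integral a b u1"
proof -
  define E where "E = sq_integral a b u1"
  have E0: "0 \<le> E" unfolding E_def
    by (intro Henstock_Kurzweil_Integration.integral_nonneg integrable_continuous_interval continuous_intros u1) auto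
  have uc: "continuous_on {a..b} u" by (rule DERIV_continuous_on) (rule u)
  have inc: "(u1 has_integral (u t - u s)) {s..t}" if "a \<le> s" "s \<le> t" "t \<le> b" for s t
    using that by (intro has_integral_of_has_real_derivative DERIV_subset[OF u]) auto
  have i2: "(\<lambda>t. (u1 t)\<^sup>2) integrable_on {a..b}"
    by (intro integrable_continuous_interval continuous_intros u1)
  have pt: "(u t)\<^sup>2 \<le> 3/2 * (u \<xi>)\<^sup>2 + 3 * \<bar>t - \<xi>\<bar> * E" if t: "t \<in> {a..b}" for t
  proof -
    have "(u t - u \<xi>)\<^sup>2 \<le> \<bar>t - \<xi>\<bar> * E"
    proof (cases "\<xi> \<le> t")
      case True
      then show ?thesis
        using has_integral_increment_power2_le[OF _ True _ inc[OF _ True] i2] t \<xi> by (simp add: E_def)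
    next
      case False
      then have le: "t \<le> \<xi>" by simp
      then show ?thesis
        using has_integral_increment_power2_le[OF _ le _ inc[OF _ le] i2] t \<xi> by (simp add: E_def power2_commute)
    qed
    \<comment> \<open>Half of the square (2 u t - 3 u \<xi>)^2 is the difference of the two
      sides.\<close>
    moreover have "(u t)\<^sup>2 \<le> 3/2 * (u \<xi>)\<^sup>2 + 3 * (u t - u \<xi>)\<^sup>2"
      using zero_le_power2[of "2 * u t - 3 * u \<xi>"] by (simp add: power2_eq_square algebra_simps)
    ultimately show ?thesis by simp
  qed
  have c: "(\<lambda>t. (u t)\<^sup>2) integrable_on {s..t}" if "a \<le> s" "t \<le> b" for s t
    using that by (intro integrable_continuous_interval continuous_intros continuous_on_subset[OF uc]) auto
  have r: "sq_integral \<xi> b u \<le> 3/2 * (u \<xi>)\<^sup>2 * (b - \<xi>) + 3/2 * (b - \<xi>)\<^sup>2 * E"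
  proof -
    have A: "((\<lambda>t. 3/2 * (u \<xi>)\<^sup>2 + 3 * (t - \<xi>) * E) has_integral
       ((3/2 * (u \<xi>)\<^sup>2 * (b - \<xi>) + 3/2 * (b - \<xi>)\<^sup>2 * E) - (3/2 * (u \<xi>)\<^sup>2 * (\<xi> - \<xi>) + 3/2 * (\<xi> - \<xi>)\<^sup>2 * E))) {\<xi>..b}"
      using \<xi> by (intro has_integral_of_has_real_derivative) (auto intro!: derivative_eq_intros)
    have B: "((\<lambda>t. (u t)\<^sup>2) has_integral sq_integral \<xi> b u) {\<xi>..b}"
      using \<xi> by (intro integrable_integral c) auto
    have "sq_integral \<xi> b u \<le> (3/2 * (u \<xi>)\<^sup>2 * (b - \<xi>) + 3/2 * (b - \<xi>)\<^sup>2 * E) - (3/2 * (u \<xi>)\<^sup>2 * (\<xi> - \<xi>) + 3/2 * (\<xi> - \<xi>)\<^sup>2 * E)"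
    proof (rule has_integral_le[OF B A])
      fix t assume "t \<in> {\<xi>..b}"
      then show "(u t)\<^sup>2 \<le> 3/2 * (u \<xi>)\<^sup>2 + 3 * (t - \<xi>) * E" using pt[of t] \<xi> by simp
    qed
    then show ?thesis by simp
  qed
  have l: "integral {a..\<xi>} (\<lambda>t. (u t)\<^sup>2) \<le> 3/2 * (u \<xi>)\<^sup>2 * (\<xi> - a) + 3/2 * (\<xi> - a)\<^sup>2 * E"
  proof -
    have A: "((\<lambda>t. 3/2 * (u \<xi>)\<^sup>2 + 3 * (\<xi> - t) * E) has_integral
       ((3/2 * (u \<xi>)\<^sup>2 * (\<xi> - \<xi>) - 3/2 * (\<xi> - \<xi>)\<^sup>2 * E) - (3/2 * (u \<xi>)\<^sup>2 * (a - \<xi>) - 3/2 * (a - \<xi>)\<^sup>2 * E))) {a..\<xi>}"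
      using \<xi> by (intro has_integral_of_has_real_derivative) (auto intro!: derivative_eq_intros simp: field_simps)
    have B: "((\<lambda>t. (u t)\<^sup>2) has_integral integral {a..\<xi>} (\<lambda>t. (u t)\<^sup>2)) {a..\<xi>}"
      using \<xi> by (intro integrable_integral c) auto
    have "integral {a..\<xi>} (\<lambda>t. (u t)\<^sup>2) \<le> (3/2 * (u \<xi>)\<^sup>2 * (\<xi> - \<xi>) - 3/2 * (\<xi> - \<xi>)\<^sup>2 * E) - (3/2 * (u \<xi>)\<^sup>2 * (a - \<xi>) - 3/2 * (a - \<xi>)\<^sup>2 * E)"
    proof (rule has_integral_le[OF B A])
      fix t assume "t \<in> {a..\<xi>}"
      then show "(u t)\<^sup>2 \<le> 3/2 * (u \<xi>)\<^sup>2 + 3 * (\<xi> - t) * E" using pt[of t] \<xi> by simp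
    qed
    then show ?thesis by (simp add: power2_eq_square field_simps)
  qed
  have "sq_integral a b u = integral {a..\<xi>} (\<lambda>t. (u t)\<^sup>2) + sq_integral \<xi> b u"
    using \<xi> by (intro Henstock_Kurzweil_Integration.integral_combine[symmetric] c) auto
  moreover have "3/2 * (\<xi> - a)\<^sup>2 * E + 3/2 * (b - \<xi>)\<^sup>2 * E \<le> 3/2 * (b - a)\<^sup>2 * E"
  proof -
    have "0 \<le> (\<xi> - a) * (b - \<xi>)" using \<xi> by auto
    then have "(\<xi> - a)\<^sup>2 + (b - \<xi>)\<^sup>2 \<le> (b - a)\<^sup>2" by (simp add: power2_eq_square algebra_simps)
    then have "((\<xi> - a)\<^sup>2 + (b - \<xi>)\<^sup>2) * E \<le> (b - a)\<^sup>2 * E" using E0 by (intro mult_right_mono)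
    then show ?thesis by (simp add: algebra_simps)
  qed
  ultimately show ?thesis using l r by (simp add: E_def[symmetric] field_simps)
qed

text \<open>Averaging the one-point estimates in each cell bounds the integral of u^2 by the samples
  and d^2 times the integral of u1^2. The Sobolev inequality on pieces of about twelve cells turns
  the latter into a quarter of the integral of u^2, which is absorbed on the left, plus a multiple
  of the integral of w^2.\<close>

lemma W22_rep_sampling_inequality:
  fixes d c :: real and x :: "nat \<Rightarrow> real"
  assumes d: "0 < d" and m: "12 \<le> m" and c: "0 < c" and I: "finite I"
    and u: "W22_rep a (a + real m * d) u u1 w"
    and cells: "\<And>j. j < m \<Longrightarrow> c \<le> real (card {i\<in>I. x i \<in> {a + real j * d<..<a + real (Suc j) * d}})"
  defines "b \<equiv> a + real m * d"
  shows "sq_integral a b u \<le>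
     2 * d / c * (\<Sum>i\<in>I. (u (x i))\<^sup>2) + 2304 * d ^ 4 * sq_integral a b w"
proof -
  have u: "W22_rep a b u u1 w" using u by (simp add: b_def)
  note U = W22_repD[OF u]
  have ab: "a < b" using d m by (simp add: b_def)
  define S where "S j = {i\<in>I. x i \<in> {a + real j * d<..<a + real (Suc j) * d}}" for j
  have part: "integral {a..b} f = (\<Sum>j<m. integral {a + real j * d..a + real (Suc j) * d} f)"
    if "f integrable_on {a..b}" for f :: "real \<Rightarrow> real"
    using integral_equal_partition[of d f a m] that d by (simp add: b_def)
  have ii: "(\<lambda>t. (u t)\<^sup>2) integrable_on {a..b}" "(\<lambda>t. (u1 t)\<^sup>2) integrable_on {a..b}"
    by (intro integrable_continuous_interval continuous_intros U)+
  have cell: "sq_integral (a + real j * d) (a + real (Suc j) * d) u \<le>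
      3/2 * d / c * (\<Sum>i\<in>S j. (u (x i))\<^sup>2) + 3/2 * d\<^sup>2 * sq_integral (a + real j * d) (a + real (Suc j) * d) u1"
    if j: "j < m" for j
  proof -
    define a' where "a' = a + real j * d"
    define b' where "b' = a + real (Suc j) * d"
    have "real (Suc j) * d \<le> real m * d" using j d by (intro mult_right_mono) auto
    then have sub: "a \<le> a'" "b' \<le> b" using d by (auto simp: a'_def b'_def b_def)
    have len: "b' - a' = d" by (simp add: a'_def b'_def algebra_simps)
    note V = W22_repD[OF W22_rep_subinterval[OF u sub]]
    define n where "n = real (card (S j))"
    have n: "c \<le> n" using cells[OF j] by (simp add: n_def S_def)
    define L where "L = sq_integral a' b' u"
    define R where "R = sq_integral a' b' u1"
    have "L - 3/2 * d\<^sup>2 * R \<le> 3/2 * d * (u (x i))\<^sup>2" if "i \<in> S j" for i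
    proof -
      have "x i \<in> {a'..b'}" using that by (auto simp: S_def a'_def b'_def)
      from integral_power2_le_sample[OF V(1,3) this] show ?thesis by (simp add: len L_def R_def)
    qed
    then have "(\<Sum>i\<in>S j. L - 3/2 * d\<^sup>2 * R) \<le> (\<Sum>i\<in>S j. 3/2 * d * (u (x i))\<^sup>2)" by (rule sum_mono)
    then have s: "n * (L - 3/2 * d\<^sup>2 * R) \<le> 3/2 * d * (\<Sum>i\<in>S j. (u (x i))\<^sup>2)"
      by (simp add: n_def sum_distrib_left)
    \<comment> \<open>Replacing the number of points by its lower bound \<open>c\<close> is monotone
      only if the bracket is nonnegative; otherwise the left side is at most 0 anyway.\<close>
    have "c * (L - 3/2 * d\<^sup>2 * R) \<le> 3/2 * d * (\<Sum>i\<in>S j. (u (x i))\<^sup>2)"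
    proof (cases "0 \<le> L - 3/2 * d\<^sup>2 * R")
      case True
      then have "c * (L - 3/2 * d\<^sup>2 * R) \<le> n * (L - 3/2 * d\<^sup>2 * R)" using n by (intro mult_right_mono)
      with s show ?thesis by linarith
    next
      case False
      then have "c * (L - 3/2 * d\<^sup>2 * R) \<le> 0" using c by (intro mult_nonneg_nonpos) auto
      also have "0 \<le> 3/2 * d * (\<Sum>i\<in>S j. (u (x i))\<^sup>2)" using d by (intro mult_nonneg_nonneg sum_nonneg) auto
      finally show ?thesis .
    qed
    then have "L \<le> 3/2 * d / c * (\<Sum>i\<in>S j. (u (x i))\<^sup>2) + 3/2 * d\<^sup>2 * R"
      using c by (simp add: field_simps)
    then show ?thesis by (simp add: L_def R_def a'_def b'_def)
  qed
  have disj: "(\<Sum>j<m. \<Sum>i\<in>S j. (u (x i))\<^sup>2) \<le> (\<Sum>i\<in>I. (u (x i))\<^sup>2)"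
  proof -
    have "S i \<inter> S j = {}" if "i < j" for i j
    proof -
      have "real (Suc i) * d \<le> real j * d" using that d by (intro mult_right_mono) auto
      then show ?thesis by (auto simp: S_def)
    qed
    then have "S i \<inter> S j = {}" if "i \<noteq> j" for i j using that by (metis Int_commute linorder_neqE_nat)
    then have "(\<Sum>j<m. \<Sum>i\<in>S j. (u (x i))\<^sup>2) = (\<Sum>i\<in>(\<Union>j<m. S j). (u (x i))\<^sup>2)"
      using I by (intro sum.UNION_disjoint[symmetric]) (auto simp: S_def)
    also have "\<dots> \<le> (\<Sum>i\<in>I. (u (x i))\<^sup>2)"
      using I by (intro sum_mono2) (auto simp: S_def)
    finally show ?thesis .
  qed
  have "sq_integral a b u \<le> (\<Sum>j<m. 3/2 * d / c * (\<Sum>i\<in>S j. (u (x i))\<^sup>2)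
      + 3/2 * d\<^sup>2 * sq_integral (a + real j * d) (a + real (Suc j) * d) u1)"
    unfolding part[OF ii(1)] by (intro sum_mono cell) auto
  also have "\<dots> = 3/2 * d / c * (\<Sum>j<m. \<Sum>i\<in>S j. (u (x i))\<^sup>2) + 3/2 * d\<^sup>2 * sq_integral a b u1"
    unfolding part[OF ii(2)] by (simp only: sum.distrib sum_distrib_left)
  also have "\<dots> \<le> 3/2 * d / c * (\<Sum>i\<in>I. (u (x i))\<^sup>2) + 3/2 * d\<^sup>2 * sq_integral a b u1"
    using c d by (intro add_right_mono mult_left_mono disj) auto
  finally have 1: "sq_integral a b u \<le> 3/2 * d / c * (\<Sum>i\<in>I. (u (x i))\<^sup>2) + 3/2 * d\<^sup>2 * sq_integral a b u1" .
  \<comment> \<open>Pieces of length between 12 d and 24 d: the lower bound makes the absorbed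
    coefficient 3/2 * 24 / 144 = 1/4. The upper bound holds because m is at least 12, and it yields
    3/2 * 2 * 576 = 1728.\<close>
  define n where "n = m div 12"
  have n: "0 < n" "12 * n \<le> m" "m \<le> 24 * n" using m unfolding n_def by presburger+
  define h where "h = (b - a) / real n"
  have hm: "h = real m * d / real n" by (simp add: h_def b_def)
  have nr: "real (12 * n) \<le> real m" "real m \<le> real (24 * n)" using n by (simp_all only: of_nat_le_iff)
  have h: "12 * d \<le> h" "h \<le> 24 * d"
    using n(1) nr d by (simp_all add: hm field_simps)
  have sq: "144 * d\<^sup>2 \<le> h\<^sup>2" "h\<^sup>2 \<le> 576 * d\<^sup>2"
    using power_mono[OF h(1), of 2] power_mono[OF h(2), of 2] d h by (auto simp: power_mult_distrib)
  have w0: "0 \<le> sq_integral a b w" and u0: "0 \<le> sq_integral a b u"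
    by (rule Henstock_Kurzweil_Integration.integral_nonneg; use ii U in auto)+
  have "sq_integral a b u1 \<le> 24 / h\<^sup>2 * sq_integral a b u + 2 * h\<^sup>2 * sq_integral a b w"
    using W22_rep_sobolev_inequality_partition[OF ab u n(1)] by (simp add: h_def)
  also have "\<dots> \<le> 24 / (144 * d\<^sup>2) * sq_integral a b u + 2 * (576 * d\<^sup>2) * sq_integral a b w"
    using d ab by (intro add_mono mult_right_mono w0 u0 divide_left_mono sq mult_left_mono) (auto intro!: mult_pos_pos simp: h_def n)
  finally have "3/2 * d\<^sup>2 * sq_integral a b u1 \<le> 3/2 * d\<^sup>2 * (24 / (144 * d\<^sup>2) * sq_integral a b u + 2 * (576 * d\<^sup>2) * sq_integral a b w)"
    by (intro mult_left_mono) auto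
  also have "\<dots> = 1/4 * sq_integral a b u + 1728 * d ^ 4 * sq_integral a b w"
    using d by (simp add: field_simps power2_eq_square power4_eq_xxxx)
  \<comment> \<open>Absorbing a quarter divides by 3/4, so 3/2 becomes 2 and 1728 becomes
    2304.\<close>
  finally show ?thesis using 1 by (simp add: field_simps)
qed

subsection \<open>The quasi-interpolant\<close>

definition tpow :: "nat \<Rightarrow> real \<Rightarrow> real \<Rightarrow> real" where
  "tpow n c t = (max 0 (t - c)) ^ n"

lemma continuous_on_tpow [continuous_intros]: "continuous_on S (tpow n c)"
  unfolding tpow_def by (intro continuous_intros)

lemma tpow_2_has_derivative: "(tpow 2 c has_real_derivative 2 * tpow 1 c t) (at t)"
proof -
  consider "t < c" | "t = c" | "c < t" by linarith
  then show ?thesis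
  proof cases
    case 1
    have "\<forall>\<^sub>F s in nhds t. tpow 2 c s = 0"
      using eventually_nhds_in_open[of "{..<c}" t] 1 by (auto simp: tpow_def elim!: eventually_mono)
    then have "(tpow 2 c has_real_derivative 0) (at t)"
      using DERIV_cong_ev[OF refl _ refl, of "tpow 2 c" "\<lambda>_. 0" t 0] by simp
    then show ?thesis using 1 by (simp add: tpow_def)
  next
    case 2
    have "\<bar>tpow 2 c s\<bar> \<le> 1 * (s - t)\<^sup>2" for s
      using 2 by (simp add: tpow_def max_def)
    then have "(tpow 2 c has_real_derivative 0) (at t)"
      by (rule has_real_derivative_zero_of_quadratic_bound)
    then show ?thesis using 2 by (simp add: tpow_def)
  next
    case 3
    have ev: "\<forall>\<^sub>F s in nhds t. tpow 2 c s = (s - c)\<^sup>2"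
      using eventually_nhds_in_open[of "{c<..}" t] 3 by (auto simp: tpow_def elim!: eventually_mono)
    have "((\<lambda>s. (s - c)\<^sup>2) has_real_derivative 2 * (t - c)) (at t)"
      by (auto intro!: derivative_eq_intros)
    then have "(tpow 2 c has_real_derivative 2 * (t - c)) (at t)"
      using DERIV_cong_ev[OF refl ev refl, of "2 * (t - c)"] by simp
    then show ?thesis using 3 by (simp add: tpow_def)
  qed
qed

lemma tpow_3_has_derivative: "(tpow 3 c has_real_derivative 3 * tpow 2 c t) (at t)"
proof -
  have "tpow 3 c = (\<lambda>t. (t - c) * tpow 2 c t)"
    by (auto simp: tpow_def max_def power2_eq_square power3_eq_cube)
  moreover have "((\<lambda>t. (t - c) * tpow 2 c t) has_real_derivative (1 * tpow 2 c t + 2 * tpow 1 c t * (t - c))) (at t)"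
    by (intro DERIV_mult tpow_2_has_derivative) (auto intro!: derivative_eq_intros)
  moreover have "1 * tpow 2 c t + 2 * tpow 1 c t * (t - c) = 3 * tpow 2 c t"
    by (auto simp: tpow_def max_def power2_eq_square)
  ultimately show ?thesis by metis
qed

section \<open>Hat functions and their antiderivatives\<close>

text \<open>For \<open>n = 1\<close> this is the hat function at the knot j d with value 1 there;
  \<open>n = 2\<close> and \<open>n = 3\<close> are its successive antiderivatives from the left.
  For \<open>n = 3\<close> it is therefore not the compactly supported cubic B-spline: beyond the
  hat it continues as a linear function.\<close>

definition bspline :: "nat \<Rightarrow> real \<Rightarrow> nat \<Rightarrow> real \<Rightarrow> real" where
  "bspline n d j t = (tpow n ((real j - 1) * d) t - 2 * tpow n (real j * d) t
      + tpow n ((real j + 1) * d) t) / (fact n * d)"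

lemma bspline_has_derivative:
  assumes "d \<noteq> 0"
  shows "(bspline 3 d j has_real_derivative bspline 2 d j t) (at t)"
    and "(bspline 2 d j has_real_derivative bspline 1 d j t) (at t)"
proof -
  have "((\<lambda>t. (tpow 3 a t - 2 * tpow 3 b t + tpow 3 c t) / (6 * d)) has_real_derivative
      (3 * tpow 2 a t - 2 * (3 * tpow 2 b t) + 3 * tpow 2 c t) / (6 * d)) (at t)" for a b c
    by (intro DERIV_cdivide DERIV_add DERIV_diff DERIV_cmult tpow_3_has_derivative)
  moreover have "(3 * tpow 2 a t - 2 * (3 * tpow 2 b t) + 3 * tpow 2 c t) / (6 * d) = 
      (tpow 2 a t - 2 * tpow 2 b t + tpow 2 c t) / (2 * d)" for a b c
    using assms by (simp add: field_simps)
  ultimately show "(bspline 3 d j has_real_derivative bspline 2 d j t) (at t)"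
    unfolding bspline_def[abs_def] by (simp add: fact_numeral)
  have "((\<lambda>t. (tpow 2 a t - 2 * tpow 2 b t + tpow 2 c t) / (2 * d)) has_real_derivative
      (2 * tpow 1 a t - 2 * (2 * tpow 1 b t) + 2 * tpow 1 c t) / (2 * d)) (at t)" for a b c
    by (intro DERIV_cdivide DERIV_add DERIV_diff DERIV_cmult tpow_2_has_derivative)
  moreover have "(2 * tpow 1 a t - 2 * (2 * tpow 1 b t) + 2 * tpow 1 c t) / (2 * d) = 
      (tpow 1 a t - 2 * tpow 1 b t + tpow 1 c t) / d" for a b c
    using assms by (simp add: field_simps)
  ultimately show "(bspline 2 d j has_real_derivative bspline 1 d j t) (at t)"
    unfolding bspline_def[abs_def] by (simp add: fact_numeral)
qed

text \<open>The hat at \<open>j\<close> ends at (j + 1) d, and from there on its second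
  antiderivative is linear; before (j - 1) d it is zero. Hence only the two hats at the ends of a
  cell contribute terms of degree 3 on it, in the local coordinate \<open>r\<close>.\<close>

lemma bspline_on_cell:
  fixes d r :: real and j k :: nat
  assumes d: "0 < d" and r: "0 \<le> r" "r \<le> 1"
  defines "t \<equiv> (real k + r) * d"
  shows "j < k \<Longrightarrow> bspline 3 d j t = d * (t - real j * d)" "j < k \<Longrightarrow> bspline 1 d j t = 0"
    and "bspline 3 d k t = d\<^sup>2 * (r + (1 - r) ^ 3 / 6)" "bspline 1 d k t = 1 - r"
    and "bspline 3 d (Suc k) t = d\<^sup>2 * r ^ 3 / 6" "bspline 1 d (Suc k) t = r"
    and "Suc k < j \<Longrightarrow> bspline 3 d j t = 0" "Suc k < j \<Longrightarrow> bspline 1 d j t = 0"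
proof -
  have pos: "tpow n (e * d) t = (real k + r - e) ^ n * d ^ n" if "e \<le> real k + r" for n e
  proof -
    have "t - e * d = (real k + r - e) * d" by (simp add: t_def algebra_simps)
    moreover have "0 \<le> (real k + r - e) * d" using that d by simp
    ultimately show ?thesis by (simp add: tpow_def power_mult_distrib)
  qed
  have neg: "tpow n (e * d) t = 0" if "real k + r \<le> e" "n \<noteq> 0" for n e
  proof -
    have "t - e * d = (real k + r - e) * d" by (simp add: t_def algebra_simps)
    moreover have "(real k + r - e) * d \<le> 0" using that d by (simp add: mult_le_0_iff)
    ultimately show ?thesis using that by (simp add: tpow_def)
  qed
  show "bspline 3 d j t = d * (t - real j * d)" "bspline 1 d j t = 0" if "j < k"
  proof -
    have "real j + 1 \<le> real k" using that by linarith
    then have e: "real j - 1 \<le> real k + r" "real j \<le> real k + r" "real j + 1 \<le> real k + r" using r by linarith+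
    have "((X + 1) ^ 3 * d ^ 3 - 2 * (X ^ 3 * d ^ 3) + (X - 1) ^ 3 * d ^ 3) / (6 * d) = d * (X * d)" for X
      using d by (simp add: field_simps power3_eq_cube)
    from this[of "real k + r - real j"] show "bspline 3 d j t = d * (t - real j * d)"
      unfolding bspline_def pos[OF e(1)] pos[OF e(2)] pos[OF e(3)]
      by (simp add: fact_numeral t_def algebra_simps)
    show "bspline 1 d j t = 0"
      unfolding bspline_def pos[OF e(1)] pos[OF e(2)] pos[OF e(3)] by (simp add: algebra_simps)
  qed
  have e: "real k - 1 \<le> real k + r" "real k \<le> real k + r" "real k + r \<le> real k + 1" using r by linarith+
  have "((r + 1) ^ 3 * d ^ 3 - 2 * (r ^ 3 * d ^ 3) + 0) / (6 * d) = d\<^sup>2 * (r + (1 - r) ^ 3 / 6)"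
    using d by (simp add: field_simps power3_eq_cube power2_eq_square)
  then show "bspline 3 d k t = d\<^sup>2 * (r + (1 - r) ^ 3 / 6)"
    unfolding bspline_def pos[OF e(1)] pos[OF e(2)] neg[OF e(3) numeral_neq_zero] by (simp add: fact_numeral add.commute)
  show "bspline 1 d k t = 1 - r"
    unfolding bspline_def pos[OF e(1)] pos[OF e(2)] neg[OF e(3) one_neq_zero] using d by (simp add: field_simps)
  have e: "real (Suc k) - 1 \<le> real k + r" "real k + r \<le> real (Suc k)" "real k + r \<le> real (Suc k) + 1" using r by auto
  have "(r ^ 3 * d ^ 3 - 2 * 0 + 0) / (6 * d) = d\<^sup>2 * r ^ 3 / 6"
    using d by (simp add: field_simps power3_eq_cube power2_eq_square)
  then show "bspline 3 d (Suc k) t = d\<^sup>2 * r ^ 3 / 6"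
    unfolding bspline_def pos[OF e(1)] neg[OF e(2) numeral_neq_zero] neg[OF e(3) numeral_neq_zero] by (simp add: fact_numeral)
  show "bspline 1 d (Suc k) t = r"
    unfolding bspline_def pos[OF e(1)] neg[OF e(2) one_neq_zero] neg[OF e(3) one_neq_zero] using d by simp
  show "bspline 3 d j t = 0" "bspline 1 d j t = 0" if "Suc k < j"
  proof -
    have "real k + 2 \<le> real j" using that by linarith
    then have e: "real k + r \<le> real j - 1" "real k + r \<le> real j" "real k + r \<le> real j + 1" using r by linarith+
    show "bspline 3 d j t = 0" "bspline 1 d j t = 0"
      by (simp_all add: bspline_def neg e del: One_nat_def)
  qed
qed

text \<open>
  The value $0$ at $j = 0$ and $j = M$ corresponds to the linear extension of \<open>f\<close> beyond $[0,1]$.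
\<close>

definition second_difference :: "nat \<Rightarrow> (real \<Rightarrow> real) \<Rightarrow> nat \<Rightarrow> real" where
  "second_difference M f j = (if 0 < j \<and> j < M
     then (f ((real j + 1) / real M) - 2 * f (real j / real M) + f ((real j - 1) / real M)) * (real M)\<^sup>2
     else 0)"

text \<open>The Schoenberg spline in twice integrated form: an initial line plus antiderivatives of
  hats. Its second derivative is the piecewise linear function whose knot values are the second
  differences, and its value at an interior knot is the average of neighbouring values of
  \<open>f\<close> with weights 1/6, 4/6, 1/6.\<close>

definition quasi_interpolant :: "nat \<Rightarrow> (real \<Rightarrow> real) \<Rightarrow> real \<Rightarrow> real" where
  "quasi_interpolant M f t = f 0 + (f (1 / real M) - f 0) * real M * t
     + (\<Sum>j\<le>M. second_difference M f j * bspline 3 (1 / real M) j t)"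

definition quasi_interpolant1 :: "nat \<Rightarrow> (real \<Rightarrow> real) \<Rightarrow> real \<Rightarrow> real" where
  "quasi_interpolant1 M f t = (f (1 / real M) - f 0) * real M
     + (\<Sum>j\<le>M. second_difference M f j * bspline 2 (1 / real M) j t)"

definition quasi_interpolant2 :: "nat \<Rightarrow> (real \<Rightarrow> real) \<Rightarrow> real \<Rightarrow> real" where
  "quasi_interpolant2 M f t = (\<Sum>j\<le>M. second_difference M f j * bspline 1 (1 / real M) j t)"

lemma quasi_interpolant_has_derivative:
  assumes "0 < M"
  shows "(quasi_interpolant M f has_real_derivative quasi_interpolant1 M f t) (at t)"
    and "(quasi_interpolant1 M f has_real_derivative quasi_interpolant2 M f t) (at t)"
    and "continuous_on S (quasi_interpolant2 M f)"
proof -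
  have d: "1 / real M \<noteq> 0" using assms by simp
  show "(quasi_interpolant M f has_real_derivative quasi_interpolant1 M f t) (at t)"
    unfolding quasi_interpolant_def[abs_def] quasi_interpolant1_def
    by (rule derivative_eq_intros bspline_has_derivative[OF d] refl)+ (simp add: mult.commute)
  show "(quasi_interpolant1 M f has_real_derivative quasi_interpolant2 M f t) (at t)"
    unfolding quasi_interpolant1_def[abs_def] quasi_interpolant2_def
    by (rule derivative_eq_intros bspline_has_derivative[OF d] refl)+ (simp add: mult.commute)
  show "continuous_on S (quasi_interpolant2 M f)"
    unfolding quasi_interpolant2_def[abs_def] bspline_def[abs_def]
    by (intro continuous_intros) (use assms in auto)
qed

lemma sum_band:
  fixes D h a :: "nat \<Rightarrow> real"
  assumes "k < M" "\<And>j. j < k \<Longrightarrow> h j = a j" "\<And>j. Suc k < j \<Longrightarrow> h j = 0"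
  shows "(\<Sum>j\<le>M. D j * h j) = (\<Sum>j<k. D j * a j) + D k * h k + D (Suc k) * h (Suc k)"
proof -
  have "(\<Sum>j\<le>M. D j * h j) = (\<Sum>j\<le>Suc k. D j * h j)"
    by (rule sum.mono_neutral_right) (use assms in auto)
  also have "\<dots> = (\<Sum>j<k. D j * h j) + D k * h k + D (Suc k) * h (Suc k)"
    by (simp add: lessThan_Suc_atMost[symmetric])
  also have "(\<Sum>j<k. D j * h j) = (\<Sum>j<k. D j * a j)"
    by (rule sum.cong) (use assms in auto)
  finally show ?thesis .
qed

text \<open>Every linear piece changes the slope at its knot from one chord of \<open>f\<close> to
  the next. Together with the initial chord these changes telescope to the chord over cell
  \<open>k\<close>.\<close>

lemma quasi_interpolant_linear_part:
  fixes f :: "real \<Rightarrow> real"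
  assumes "k < M"
  shows "f 0 + (f (1 / real M) - f 0) * real M * t + (\<Sum>j<k. second_difference M f j * (1 / real M * (t - real j * (1 / real M))))
     + second_difference M f k * (1 / real M * (t - real k * (1 / real M)))
     = f (real k / real M) + (f ((real k + 1) / real M) - f (real k / real M)) * (real M * t - real k)"
  using assms
proof (induction k)
  case 0
  then show ?case by (simp add: second_difference_def)
next
  case (Suc k)
  have M: "0 < M" using Suc.prems by simp
  have "f 0 + (f (1 / real M) - f 0) * real M * t + (\<Sum>j<Suc k. second_difference M f j * (1 / real M * (t - real j * (1 / real M))))
     = f (real k / real M) + (f ((real k + 1) / real M) - f (real k / real M)) * (real M * t - real k)"
    using Suc.IH Suc.prems by (simp add: add.assoc)
  moreover have "second_difference M f (Suc k) * (1 / real M * (t - real (Suc k) * (1 / real M)))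
     = (f ((real (Suc k) + 1) / real M) - 2 * f (real (Suc k) / real M) + f (real k / real M)) * (real M * t - real (Suc k))"
    using Suc.prems M by (simp add: second_difference_def power2_eq_square field_simps)
  ultimately show ?case by (simp add: algebra_simps)
qed

lemma quasi_interpolant_on_cell:
  fixes f :: "real \<Rightarrow> real"
  assumes k: "k < M" and r: "0 \<le> r" "r \<le> 1"
  defines "t \<equiv> (real k + r) / real M"
  shows "quasi_interpolant M f t = f (real k / real M) + (f ((real k + 1) / real M) - f (real k / real M)) * r
      + ((1 - r) ^ 3 * second_difference M f k + r ^ 3 * second_difference M f (Suc k)) / (6 * (real M)\<^sup>2)"
    and "quasi_interpolant2 M f t = (1 - r) * second_difference M f k + r * second_difference M f (Suc k)"
proof -
  have M: "0 < real M" using k by simp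
  define d where "d = 1 / real M"
  have d: "0 < d" using M by (simp add: d_def)
  have t: "t = (real k + r) * d" by (simp add: t_def d_def)
  note B = bspline_on_cell[OF d r, where k = k, folded t]
  define D where "D = second_difference M f"
  have "(\<Sum>j\<le>M. D j * bspline 3 d j t) = (\<Sum>j<k. D j * (d * (t - real j * d))) + D k * bspline 3 d k t + D (Suc k) * bspline 3 d (Suc k) t"
    by (rule sum_band[OF k B(1) B(7)])
  then have s3: "(\<Sum>j\<le>M. D j * bspline 3 d j t) = (\<Sum>j<k. D j * (d * (t - real j * d))) + D k * (d * (t - real k * d))
      + ((1 - r) ^ 3 * D k + r ^ 3 * D (Suc k)) * (d\<^sup>2 / 6)"
  proof -
    have "t - real k * d = r * d" by (simp add: t algebra_simps)
    then show ?thesis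
      using \<open>(\<Sum>j\<le>M. D j * bspline 3 d j t) = _\<close> unfolding B(3,5)
      by (simp add: field_simps power2_eq_square)
  qed
  have Mt: "real M * t - real k = r" using M by (simp add: t_def)
  have "quasi_interpolant M f t = f (real k / real M) + (f ((real k + 1) / real M) - f (real k / real M)) * r
      + ((1 - r) ^ 3 * D k + r ^ 3 * D (Suc k)) * (d\<^sup>2 / 6)"
    using quasi_interpolant_linear_part[OF k, of f t, unfolded Mt] s3 unfolding quasi_interpolant_def d_def D_def by linarith
  then show "quasi_interpolant M f t = f (real k / real M) + (f ((real k + 1) / real M) - f (real k / real M)) * r
      + ((1 - r) ^ 3 * second_difference M f k + r ^ 3 * second_difference M f (Suc k)) / (6 * (real M)\<^sup>2)"
    by (simp add: D_def d_def power_divide)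
  have "(\<Sum>j\<le>M. D j * bspline 1 d j t) = (\<Sum>j<k. D j * 0) + D k * bspline 1 d k t + D (Suc k) * bspline 1 d (Suc k) t"
    by (rule sum_band[OF k B(2) B(8)])
  then show "quasi_interpolant2 M f t = (1 - r) * second_difference M f k + r * second_difference M f (Suc k)"
    unfolding quasi_interpolant2_def d_def[symmetric] D_def[symmetric] by (simp only: B(4,6)) simp
qed

text \<open>
  Both inequalities expand $\int \varphi (w-c)^2 \ge 0$ for a ramp $\varphi$. Adding them for adjacent
  intervals and taking the second difference as $c$ gives Jensen's inequality for its square.
\<close>

lemma W22_rep_ramp:
  assumes ab: "a < b" and u: "W22_rep a b u u1 w"
  defines "d \<equiv> b - a"
  shows "2 * c * (d * u1 b - (u b - u a)) / d - c\<^sup>2 * d / 2 \<le> integral {a..b} (\<lambda>t. (t - a) / d * (w t)\<^sup>2)" (is ?thesis1)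
    and "2 * c * ((u b - u a) - d * u1 a) / d - c\<^sup>2 * d / 2 \<le> integral {a..b} (\<lambda>t. (b - t) / d * (w t)\<^sup>2)" (is ?thesis2)
    and "integral {a..b} (\<lambda>t. (t - a) / d * (w t)\<^sup>2) + integral {a..b} (\<lambda>t. (b - t) / d * (w t)\<^sup>2) = sq_integral a b w" (is ?thesis3)
    and "0 \<le> integral {a..b} (\<lambda>t. (t - a) / d * (w t)\<^sup>2)" "0 \<le> integral {a..b} (\<lambda>t. (b - t) / d * (w t)\<^sup>2)"
proof -
  note U = W22_repD[OF u]
  have d: "0 < d" using ab by (simp add: d_def)
  have w2: "(\<lambda>t. (w t)\<^sup>2) absolutely_integrable_on {a..b}"
    using U(8) by (intro nonnegative_absolutely_integrable_1) auto
  have ramp: "(\<lambda>t. \<phi> t / d * (w t)\<^sup>2) integrable_on {a..b}" if "continuous_on {a..b} \<phi>" for \<phi>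
  proof -
    have "continuous_on {a..b} (\<lambda>t. \<phi> t / d)" using d that by (intro continuous_intros) auto
    from absolutely_integrable_mult_continuous[OF w2 this] show ?thesis
      unfolding absolutely_integrable_on_def by (simp only: mult.commute)
  qed
  have i: "(\<lambda>t. (t - a) / d * (w t)\<^sup>2) integrable_on {a..b}" "(\<lambda>t. (b - t) / d * (w t)\<^sup>2) integrable_on {a..b}"
    by (intro ramp continuous_intros)+
  show "0 \<le> integral {a..b} (\<lambda>t. (t - a) / d * (w t)\<^sup>2)" "0 \<le> integral {a..b} (\<lambda>t. (b - t) / d * (w t)\<^sup>2)"
    using d by (intro Henstock_Kurzweil_Integration.integral_nonneg i mult_nonneg_nonneg; simp)+
  have "integral {a..b} (\<lambda>t. (t - a) / d * (w t)\<^sup>2) + integral {a..b} (\<lambda>t. (b - t) / d * (w t)\<^sup>2)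
     = integral {a..b} (\<lambda>t. (t - a) / d * (w t)\<^sup>2 + (b - t) / d * (w t)\<^sup>2)"
    by (rule Henstock_Kurzweil_Integration.integral_add[OF i, symmetric])
  also have "(\<lambda>t. (t - a) / d * (w t)\<^sup>2 + (b - t) / d * (w t)\<^sup>2) = (\<lambda>t. (w t)\<^sup>2)"
  proof
    fix t
    have "(t - a) / d + (b - t) / d = 1" using d by (simp add: d_def diff_divide_distrib[symmetric] add_divide_distrib[symmetric])
    then show "(t - a) / d * (w t)\<^sup>2 + (b - t) / d * (w t)\<^sup>2 = (w t)\<^sup>2"
      by (simp only: distrib_right[symmetric] mult_1)
  qed
  finally show ?thesis3 .
  have main: "2 * c * J / d - c\<^sup>2 * d / 2 \<le> integral {a..b} (\<lambda>t. \<phi> t / d * (w t)\<^sup>2)"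
    if \<phi>0: "\<And>t. t \<in> {a..b} \<Longrightarrow> 0 \<le> \<phi> t" and J: "((\<lambda>t. w t * \<phi> t) has_integral J) {a..b}"
      and \<phi>: "(\<phi> has_integral d\<^sup>2 / 2) {a..b}" and i: "(\<lambda>t. \<phi> t / d * (w t)\<^sup>2) integrable_on {a..b}" for \<phi> J
  proof -
    have "((\<lambda>t. \<phi> t / d * (w t)\<^sup>2 - (2 * c / d) * (w t * \<phi> t) + (c\<^sup>2 / d) * \<phi> t) has_integral
       (integral {a..b} (\<lambda>t. \<phi> t / d * (w t)\<^sup>2) - (2 * c / d) * J + (c\<^sup>2 / d) * (d\<^sup>2 / 2))) {a..b}"
      by (intro has_integral_add has_integral_diff has_integral_mult_right integrable_integral i J \<phi>)
    moreover have "0 \<le> \<phi> t / d * (w t)\<^sup>2 - (2 * c / d) * (w t * \<phi> t) + (c\<^sup>2 / d) * \<phi> t" if "t \<in> {a..b}" for t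
    proof -
      have "\<phi> t / d * (w t)\<^sup>2 - (2 * c / d) * (w t * \<phi> t) + (c\<^sup>2 / d) * \<phi> t = \<phi> t / d * (w t - c)\<^sup>2"
        using d by (simp add: field_simps power2_eq_square)
      also have "0 \<le> \<dots>" using \<phi>0[OF that] d by simp
      finally show ?thesis .
    qed
    ultimately have "0 \<le> integral {a..b} (\<lambda>t. \<phi> t / d * (w t)\<^sup>2) - (2 * c / d) * J + (c\<^sup>2 / d) * (d\<^sup>2 / 2)"
      by (rule has_integral_nonneg)
    moreover have "(c\<^sup>2 / d) * (d\<^sup>2 / 2) = c\<^sup>2 * d / 2" using d by (simp add: power2_eq_square)
    moreover have "(2 * c / d) * J = 2 * c * J / d" by simp
    ultimately show ?thesis by linarith
  qed
  have inc: "(u1 has_integral (u b - u a)) {a..b}"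
    using ab by (intro has_integral_of_has_real_derivative U) auto
  have "((\<lambda>t. w t * (t - a) + u1 t * 1) has_integral (u1 b * (b - a) - u1 a * (a - a))) {a..b}"
    using ab by (intro W22_rep_by_parts[OF _ u]) (auto intro!: derivative_eq_intros)
  from has_integral_diff[OF this inc] have 1: "((\<lambda>t. w t * (t - a)) has_integral (d * u1 b - (u b - u a))) {a..b}"
    by (simp add: d_def mult.commute)
  have "((\<lambda>t. w t * (b - t) + u1 t * (- 1)) has_integral (u1 b * (b - b) - u1 a * (b - a))) {a..b}"
    using ab by (intro W22_rep_by_parts[OF _ u]) (auto intro!: derivative_eq_intros)
  from has_integral_add[OF this inc] have 2: "((\<lambda>t. w t * (b - t)) has_integral ((u b - u a) - d * u1 a)) {a..b}"
    by (simp add: d_def mult.commute)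
  have 3: "((\<lambda>t. t - a) has_integral d\<^sup>2 / 2) {a..b}"
  proof -
    have "((\<lambda>t. t - a) has_integral ((b - a)\<^sup>2 / 2 - (a - a)\<^sup>2 / 2)) {a..b}"
      using ab by (intro has_integral_of_has_real_derivative) (auto intro!: derivative_eq_intros)
    then show ?thesis by (simp add: d_def)
  qed
  have 4: "((\<lambda>t. b - t) has_integral d\<^sup>2 / 2) {a..b}"
  proof -
    have "((\<lambda>t. b - t) has_integral (- ((b - b)\<^sup>2) / 2 - (- ((b - a)\<^sup>2) / 2))) {a..b}"
      using ab by (intro has_integral_of_has_real_derivative) (auto intro!: derivative_eq_intros simp: field_simps)
    then show ?thesis by (simp add: d_def)
  qed
  show ?thesis1 using main[OF _ 1 3 i(1)] by simp
  show ?thesis2 using main[OF _ 2 4 i(2)] by simp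
qed

text \<open>Subtracting the linear function of slope \<open>u1 a\<close> does not affect the
  interpolation error and leaves \<open>G\<close> with Lipschitz constant sqrt E. The weights 1 - r
  and r meet distances r d and (1 - r) d, and 2 r (1 - r) is at most 1/2.\<close>

lemma W22_rep_linear_interpolation_error:
  assumes ab: "a < b" and u: "W22_rep a b u u1 w" and r: "0 \<le> r" "r \<le> 1"
  defines "d \<equiv> b - a"
  shows "(u a + (u b - u a) * r - u (a + r * d))\<^sup>2 \<le> d ^ 3 / 4 * sq_integral a b w"
proof -
  note U = W22_repD[OF u]
  have d: "0 < d" using ab by (simp add: d_def)
  define E where "E = d * sq_integral a b w"
  define G where "G s = u s - u1 a * s" for s
  define t where "t = a + r * d"
  have "r * d \<le> 1 * d" using r d by (intro mult_right_mono) auto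
  then have "t \<le> a + 1 * d" unfolding t_def by (rule add_left_mono)
  moreover have "a \<le> t" using r d by (simp add: t_def)
  ultimately have t: "t \<in> {a..b}" by (simp add: d_def)
  have E0: "0 \<le> E" unfolding E_def
    using d U by (intro mult_nonneg_nonneg Henstock_Kurzweil_Integration.integral_nonneg) auto
  have lip: "norm (G y - G z) \<le> sqrt E * norm (y - z)" if "y \<in> {a..b}" "z \<in> {a..b}" for y z
  proof (rule field_differentiable_bound[where S = "{a..b}" and f' = "\<lambda>s. u1 s - u1 a"])
    show "(G has_real_derivative u1 s - u1 a) (at s within {a..b})" if "s \<in> {a..b}" for s
      unfolding G_def[abs_def] using that by (auto intro!: derivative_eq_intros U)
    show "norm (u1 s - u1 a) \<le> sqrt E" if "s \<in> {a..b}" for s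
      using W22_rep_deriv_oscillation[OF u _ that, of a] ab by (simp add: abs_le_sqrtI E_def d_def)
  qed (use that in auto)
  have ta: "\<bar>a - t\<bar> = r * d" "\<bar>b - t\<bar> = (1 - r) * d"
  proof -
    have "b - t = (1 - r) * d" by (simp add: t_def d_def algebra_simps)
    then show "\<bar>b - t\<bar> = (1 - r) * d" using r d by simp
    show "\<bar>a - t\<bar> = r * d" using r d by (simp add: t_def)
  qed
  have rr: "2 * (r * (1 - r)) \<le> 1 / 2" using zero_le_power2[of "2 * r - 1"] by (simp add: power2_eq_square algebra_simps)
  have "u a + (u b - u a) * r - u t = (1 - r) * (G a - G t) + r * (G b - G t)"
    by (simp add: G_def t_def d_def algebra_simps)
  also have "\<bar>\<dots>\<bar> \<le> (1 - r) * \<bar>G a - G t\<bar> + r * \<bar>G b - G t\<bar>"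
    using r by (intro order.trans[OF abs_triangle_ineq]) (simp add: abs_mult)
  also have "\<dots> \<le> (1 - r) * (sqrt E * (r * d)) + r * (sqrt E * ((1 - r) * d))"
    using lip[of a t] lip[of b t] t ab r by (intro add_mono mult_left_mono) (auto simp: ta)
  also have "\<dots> = 2 * (r * (1 - r)) * (sqrt E * d)" by (simp add: algebra_simps)
  also have "\<dots> \<le> 1 / 2 * (sqrt E * d)"
    using rr E0 d by (intro mult_right_mono) auto
  finally have "\<bar>u a + (u b - u a) * r - u t\<bar>\<^sup>2 \<le> (1 / 2 * (sqrt E * d))\<^sup>2"
    by (intro power_mono) auto
  also have "\<dots> = d ^ 3 / 4 * sq_integral a b w"
    using E0 by (simp add: power_mult_distrib power_divide E_def) (simp add: power2_eq_square power3_eq_cube)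
  finally show ?thesis by (simp add: t_def)
qed

text \<open>All local quantities (\<open>W k\<close> and d times the squared second differences) sum
  to at most \<open>s\<close> over the cells. Bounding one of them by the whole sum gives the
  uniform estimate; adding them up after integration over cells of length d gains the extra power of
  d.\<close>

lemma quasi_interpolant_bounds:
  fixes M :: nat
  assumes M: "0 < M" and f: "W22_rep 0 1 f f1 w"
  defines "s \<equiv> sq_integral 0 1 w"
  shows "integral {0..1} (\<lambda>t. (quasi_interpolant2 M f t)\<^sup>2) \<le> s"
    and "t \<in> {0..1} \<Longrightarrow> (quasi_interpolant M f t - f t)\<^sup>2 \<le> s / real M ^ 3"
    and "integral {0..1} (\<lambda>t. (quasi_interpolant M f t - f t)\<^sup>2) \<le> s / real M ^ 4"
proof -
  note F = W22_repD[OF f]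
  define d where "d = 1 / real M"
  have d: "0 < d" using M by (simp add: d_def)
  define p where "p k = 0 + real k * d" for k
  have p: "p k = real k / real M" "p (Suc k) = (real k + 1) / real M" for k by (simp_all add: p_def d_def add.commute)
  have pd: "p (Suc k) - p k = d" "p k < p (Suc k)" for k using d by (simp_all add: p_def algebra_simps)
  have sub: "0 \<le> p k" "p (Suc k) \<le> 1" if "k < M" for k
    using that M by (auto simp: p field_simps)
  have rep: "W22_rep (p k) (p (Suc k)) f f1 w" if "k < M" for k
    by (rule W22_rep_subinterval[OF f sub[OF that]])
  have part: "integral {0..1} h = (\<Sum>k<M. integral {p k..p (Suc k)} h)"
    if "h integrable_on {0..1}" for h :: "real \<Rightarrow> real"
    using integral_equal_partition[of d h 0 M] that d M by (simp add: p_def d_def)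
  define D where "D = second_difference M f"
  have D0: "D 0 = 0" "D M = 0" by (auto simp: D_def second_difference_def)
  define A where "A k = integral {p k..p (Suc k)} (\<lambda>t. (t - p k) / d * (w t)\<^sup>2)" for k
  define B where "B k = integral {p k..p (Suc k)} (\<lambda>t. (p (Suc k) - t) / d * (w t)\<^sup>2)" for k
  define W where "W k = sq_integral (p k) (p (Suc k)) w" for k
  have AB: "0 \<le> A k" "0 \<le> B k" "A k + B k = W k" if "k < M" for k
    using W22_rep_ramp(3-5)[OF pd(2) rep[OF that]] unfolding pd A_def B_def W_def by auto
  have sW: "s = (\<Sum>k<M. W k)" unfolding s_def W_def by (rule part) (rule F)
  have V1: "d * (D k)\<^sup>2 \<le> (if k = 0 then 0 else A (k - 1)) + B k" if k: "k < M" for k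
  proof (cases k)
    case 0
    then show ?thesis using D0 AB(2)[OF k] by simp
  next
    case (Suc j)
    have j: "j < M" using k Suc by simp
    \<comment> \<open>With the second difference itself as the constant, the derivative
      \<open>f1 (p k)\<close> at the common knot cancels between the two adjacent cells.\<close>
    have a: "2 * D k * (d * f1 (p k) - (f (p k) - f (p j))) / d - (D k)\<^sup>2 * d / 2 \<le> A j"
      using W22_rep_ramp(1)[OF pd(2) rep[OF j], of "D k"] unfolding pd A_def Suc .
    have b: "2 * D k * ((f (p (Suc k)) - f (p k)) - d * f1 (p k)) / d - (D k)\<^sup>2 * d / 2 \<le> B k"
      using W22_rep_ramp(2)[OF pd(2) rep[OF k], of "D k"] unfolding pd B_def .
    have "D k = (f (p (Suc k)) - 2 * f (p k) + f (p j)) / d\<^sup>2"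
      using k Suc by (simp add: D_def second_difference_def p d_def power_divide)
    then have e: "f (p (Suc k)) - 2 * f (p k) + f (p j) = D k * d\<^sup>2" using d by simp
    have "2 * D k * (d * f1 (p k) - (f (p k) - f (p j))) / d + 2 * D k * ((f (p (Suc k)) - f (p k)) - d * f1 (p k)) / d
        = 2 * D k * (f (p (Suc k)) - 2 * f (p k) + f (p j)) / d"
      by (simp add: add_divide_distrib[symmetric] algebra_simps)
    also have "\<dots> = 2 * (D k)\<^sup>2 * d" unfolding e using d by (simp add: power2_eq_square)
    finally have "2 * (D k)\<^sup>2 * d - (D k)\<^sup>2 * d \<le> A j + B k" using a b by linarith
    then show ?thesis using Suc by (simp add: mult.commute)
  qed
  \<comment> \<open>Each cell integral splits as W = A + B, with A charged to the knot on its right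
    and B to the knot on its left, so nothing is counted twice.\<close>
  have sV: "(\<Sum>k<M. d * (D k)\<^sup>2) \<le> s"
  proof -
    obtain M' where M': "M = Suc M'" using M by (cases M) auto
    have "(\<Sum>k<M. d * (D k)\<^sup>2) \<le> (\<Sum>k<M. (if k = 0 then 0 else A (k - 1)) + B k)"
      by (intro sum_mono V1) simp
    also have "\<dots> = (\<Sum>k<M'. A k) + (\<Sum>k<M. B k)"
      unfolding sum.distrib M' by (subst sum.lessThan_Suc_shift) simp
    also have "\<dots> \<le> (\<Sum>k<M. A k) + (\<Sum>k<M. B k)"
      using AB(1)[of M'] by (simp add: M')
    also have "\<dots> = s" unfolding sW sum.distrib[symmetric] by (intro sum.cong AB(3)) auto
    finally show ?thesis .
  qed
  \<comment> \<open>The index shift is harmless because the second differences vanish at both 0 and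
    M.\<close>
  have sV': "(\<Sum>k<M. d * (D (Suc k))\<^sup>2) \<le> s"
  proof -
    have "(\<Sum>k<M. d * (D (Suc k))\<^sup>2) - (\<Sum>k<M. d * (D k)\<^sup>2) = 0"
      using sum_lessThan_telescope[of "\<lambda>k. d * (D k)\<^sup>2" M] D0 by (simp add: sum_subtractf)
    then show ?thesis using sV by simp
  qed
  have s0: "0 \<le> s" unfolding s_def by (rule Henstock_Kurzweil_Integration.integral_nonneg) (use F in auto)
  have Vs: "d * (D k)\<^sup>2 \<le> s" "d * (D (Suc k))\<^sup>2 \<le> s" "W k \<le> s" if "k < M" for k
  proof -
    show "d * (D k)\<^sup>2 \<le> s" by (rule order.trans[OF member_le_sum[of k "{..<M}" "\<lambda>k. d * (D k)\<^sup>2"] sV]) (use that d in auto)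
    show "d * (D (Suc k))\<^sup>2 \<le> s" by (rule order.trans[OF member_le_sum[of k "{..<M}" "\<lambda>k. d * (D (Suc k))\<^sup>2"] sV']) (use that d in auto)
    have "0 \<le> W k" if "k < M" for k using AB[OF that] by linarith
    then show "W k \<le> s" unfolding sW by (intro member_le_sum) (use that in auto)
  qed
  have cellE: "\<exists>r. 0 \<le> r \<and> r \<le> 1 \<and> t = (real k + r) / real M" if "t \<in> {p k..p (Suc k)}" for t k
    using that M by (intro exI[of _ "real M * t - real k"]) (auto simp: p field_simps)
  \<comment> \<open>From the square of a sum being at most twice the sum of the squares: 2 * 1/4 for
    the chord and 2 * 1/36 = 1/18 for the cubic correction.\<close>
  define R where "R k = d ^ 3 * (W k / 2 + (d * (D k)\<^sup>2 + d * (D (Suc k))\<^sup>2) / 18)" for k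
  have ub: "(quasi_interpolant M f t - f t)\<^sup>2 \<le> R k" if k: "k < M" and t: "t \<in> {p k..p (Suc k)}" for k t
  proof -
    obtain r where r: "0 \<le> r" "r \<le> 1" "t = (real k + r) / real M" using cellE[OF t] by blast
    have t': "t = p k + r * d" using r by (simp add: p d_def add_divide_distrib)
    define e where "e = f (p k) + (f (p (Suc k)) - f (p k)) * r - f t"
    define g where "g = (1 - r) ^ 3 * D k + r ^ 3 * D (Suc k)"
    have q: "quasi_interpolant M f t - f t = e + d\<^sup>2 / 6 * g"
      using quasi_interpolant_on_cell(1)[OF k r(1,2), of f] unfolding r(3)[symmetric] e_def g_def p(2) unfolding p(1) D_def d_def
      by (simp add: power_divide mult.commute)
    have "(quasi_interpolant M f t - f t)\<^sup>2 \<le> 2 * e\<^sup>2 + 2 * (d\<^sup>2 / 6 * g)\<^sup>2"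
      using zero_le_power2[of "e - d\<^sup>2 / 6 * g"] unfolding q by (simp add: power2_eq_square algebra_simps)
    moreover have "e\<^sup>2 \<le> d ^ 3 / 4 * W k"
      using W22_rep_linear_interpolation_error[OF pd(2) rep[OF k] r(1,2)] unfolding pd e_def t' W_def .
    moreover have "g\<^sup>2 \<le> (D k)\<^sup>2 + (D (Suc k))\<^sup>2"
    proof -
      define x where "x = (1 - r) ^ 3" define y where "y = r ^ 3"
      have b: "x \<le> 1 - r" "y \<le> r" "0 \<le> x" "0 \<le> y"
        using r power_decreasing[of 1 3 r] power_decreasing[of 1 3 "1 - r"] by (auto simp: x_def y_def)
      then have "x * x \<le> x * 1" "y * y \<le> y * 1" using r by (intro mult_left_mono; linarith)+
      then have xy: "x\<^sup>2 + y\<^sup>2 \<le> 1" using b unfolding power2_eq_square by linarith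
      have "g\<^sup>2 \<le> (x\<^sup>2 + y\<^sup>2) * ((D k)\<^sup>2 + (D (Suc k))\<^sup>2)"
        using zero_le_power2[of "x * D (Suc k) - y * D k"] unfolding g_def x_def[symmetric] y_def[symmetric]
        by (simp add: power2_eq_square algebra_simps)
      also have "\<dots> \<le> 1 * ((D k)\<^sup>2 + (D (Suc k))\<^sup>2)" using xy by (intro mult_right_mono) auto
      finally show ?thesis by simp
    qed
    then have "2 * (d\<^sup>2 / 6 * g)\<^sup>2 \<le> d ^ 4 / 18 * ((D k)\<^sup>2 + (D (Suc k))\<^sup>2)"
      using mult_left_mono[of "g\<^sup>2" "(D k)\<^sup>2 + (D (Suc k))\<^sup>2" "d ^ 4 / 18"] d
      by (simp add: power_mult_distrib power_divide)
    moreover have "d ^ 4 / 18 * ((D k)\<^sup>2 + (D (Suc k))\<^sup>2) + 2 * (d ^ 3 / 4 * W k) = R k"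
      by (simp add: R_def power4_eq_xxxx power3_eq_cube field_simps)
    ultimately show ?thesis by linarith
  qed
  have qc: "continuous_on X (quasi_interpolant M f)" "continuous_on X (quasi_interpolant2 M f)" for X
    using quasi_interpolant_has_derivative[OF M]
    by (auto intro!: continuous_at_imp_continuous_on DERIV_isCont)
  have d3: "d ^ 3 = 1 / real M ^ 3" by (simp add: d_def power_divide)
  show "(quasi_interpolant M f t - f t)\<^sup>2 \<le> s / real M ^ 3" if t: "t \<in> {0..1}"
  proof -
    \<comment> \<open>At t = 1 the floor would give the index M; the last cell is used
      instead.\<close>
    obtain k where k: "k < M" "t \<in> {p k..p (Suc k)}"
    proof (cases "t = 1")
      case True
      then show ?thesis using M by (intro that[of "M - 1"]) (auto simp: p of_nat_diff)
    next
      case False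
      define k where "k = nat \<lfloor>t * real M\<rfloor>"
      have k': "real k \<le> t * real M" "t * real M < real k + 1"
        using t by (auto simp: k_def)
      have "t * real M < 1 * real M" using t False M by (intro mult_strict_right_mono) auto
      then have "k < M" using k' by linarith
      then show ?thesis using k' M by (intro that[of k]) (auto simp: p field_simps)
    qed
    have "R k \<le> d ^ 3 * (s / 2 + (s + s) / 18)"
      unfolding R_def using Vs[OF k(1)] d by (intro mult_left_mono add_mono divide_right_mono) auto
    also have "\<dots> \<le> d ^ 3 * s" using s0 d by (intro mult_left_mono) auto
    finally show ?thesis using ub[OF k] by (simp add: d3)
  qed
  have fi: "(\<lambda>t. (quasi_interpolant M f t - f t)\<^sup>2) integrable_on {x..y}" if "0 \<le> x" "y \<le> 1" for x y
    by (intro integrable_continuous_interval continuous_intros qc continuous_on_subset[OF F(2)]) (use that in auto)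
  have "integral {0..1} (\<lambda>t. (quasi_interpolant M f t - f t)\<^sup>2) \<le> (\<Sum>k<M. d * R k)"
    unfolding part[OF fi[OF order.refl order.refl]]
  proof (rule sum_mono)
    fix k assume "k \<in> {..<M}"
    then have k: "k < M" by simp
    have "integral {p k..p (Suc k)} (\<lambda>t. (quasi_interpolant M f t - f t)\<^sup>2) \<le> integral {p k..p (Suc k)} (\<lambda>t. R k)"
      by (intro integral_le ub[OF k] fi sub k) auto
    then show "integral {p k..p (Suc k)} (\<lambda>t. (quasi_interpolant M f t - f t)\<^sup>2) \<le> d * R k"
      using pd[of k] by simp
  qed
  also have "\<dots> = d ^ 4 * ((\<Sum>k<M. W k) / 2 + ((\<Sum>k<M. d * (D k)\<^sup>2) + (\<Sum>k<M. d * (D (Suc k))\<^sup>2)) / 18)"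
    unfolding R_def sum_distrib_left[symmetric] sum.distrib sum_divide_distrib[symmetric]
    by (simp add: power4_eq_xxxx power3_eq_cube)
  also have "\<dots> \<le> d ^ 4 * (s / 2 + (s + s) / 18)"
    using sV sV' d by (intro mult_left_mono add_mono divide_right_mono) (auto simp: sW)
  also have "\<dots> \<le> d ^ 4 * s" using s0 d by (intro mult_left_mono) auto
  finally show "integral {0..1} (\<lambda>t. (quasi_interpolant M f t - f t)\<^sup>2) \<le> s / real M ^ 4"
    by (simp add: d_def power_divide)
  have q2: "(quasi_interpolant2 M f t)\<^sup>2 \<le> (p (Suc k) - t) / d * (D k)\<^sup>2 + (t - p k) / d * (D (Suc k))\<^sup>2"
    if k: "k < M" and t: "t \<in> {p k..p (Suc k)}" for k t
  proof -
    obtain r where r: "0 \<le> r" "r \<le> 1" "t = (real k + r) / real M" using cellE[OF t] by blast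
    have t': "(t - p k) / d = r" "(p (Suc k) - t) / d = 1 - r"
      using r d M by (simp_all add: p d_def field_simps)
    have q: "quasi_interpolant2 M f t = (1 - r) * D k + r * D (Suc k)"
      using quasi_interpolant_on_cell(2)[OF k r(1,2), of f] unfolding r(3)[symmetric] by (simp add: D_def)
    have "(1 - r) * (D k)\<^sup>2 + r * (D (Suc k))\<^sup>2 - ((1 - r) * D k + r * D (Suc k))\<^sup>2 = r * (1 - r) * (D k - D (Suc k))\<^sup>2"
      by (simp add: power2_eq_square algebra_simps)
    moreover have "0 \<le> r * (1 - r) * (D k - D (Suc k))\<^sup>2" using r by simp
    ultimately show ?thesis unfolding t' q by linarith
  qed
  have q2i: "(\<lambda>t. (quasi_interpolant2 M f t)\<^sup>2) integrable_on {x..y}" for x y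
    by (intro integrable_continuous_interval continuous_intros qc)
  have "integral {0..1} (\<lambda>t. (quasi_interpolant2 M f t)\<^sup>2) \<le> (\<Sum>k<M. d * (D k)\<^sup>2 / 2 + d * (D (Suc k))\<^sup>2 / 2)"
    unfolding part[OF q2i]
  proof (rule sum_mono)
    fix k assume "k \<in> {..<M}"
    then have k: "k < M" by simp
    have "((\<lambda>t. (p (Suc k) - t) / d * (D k)\<^sup>2 + (t - p k) / d * (D (Suc k))\<^sup>2) has_integral
      ((- ((p (Suc k) - p (Suc k))\<^sup>2) / (2 * d) * (D k)\<^sup>2 + (p (Suc k) - p k)\<^sup>2 / (2 * d) * (D (Suc k))\<^sup>2)
       - (- ((p (Suc k) - p k)\<^sup>2) / (2 * d) * (D k)\<^sup>2 + (p k - p k)\<^sup>2 / (2 * d) * (D (Suc k))\<^sup>2))) {p k..p (Suc k)}"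
      using pd[of k] d by (intro has_integral_of_has_real_derivative) (auto intro!: derivative_eq_intros simp: field_simps)
    then have i: "((\<lambda>t. (p (Suc k) - t) / d * (D k)\<^sup>2 + (t - p k) / d * (D (Suc k))\<^sup>2) has_integral
       (d * (D k)\<^sup>2 / 2 + d * (D (Suc k))\<^sup>2 / 2)) {p k..p (Suc k)}"
      unfolding pd using d by (simp add: power2_eq_square add.commute)
    show "integral {p k..p (Suc k)} (\<lambda>t. (quasi_interpolant2 M f t)\<^sup>2) \<le> d * (D k)\<^sup>2 / 2 + d * (D (Suc k))\<^sup>2 / 2"
      by (rule has_integral_le[OF integrable_integral[OF q2i] i q2[OF k]])
  qed
  also have "\<dots> \<le> s" using sV sV' unfolding sum.distrib sum_divide_distrib[symmetric] by linarith
  finally show "integral {0..1} (\<lambda>t. (quasi_interpolant2 M f t)\<^sup>2) \<le> s" .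
qed

subsection \<open>A basis of the spline space\<close>

definition piecewise_cubic :: "nat \<Rightarrow> (real \<Rightarrow> real) \<Rightarrow> bool" where
  "piecewise_cubic M g \<longleftrightarrow> (\<forall>j\<in>{1..M}. \<exists>c :: real poly. degree c \<le> 3 \<and>
     (\<forall>t\<in>{(real j - 1) / real M .. real j / real M}. g t = poly c t))"

lemma piecewise_cubic_poly: "degree c \<le> 3 \<Longrightarrow> piecewise_cubic M (poly c)"
  by (auto simp: piecewise_cubic_def)

lemma piecewise_cubic_add:
  assumes "piecewise_cubic M g" "piecewise_cubic M h"
  shows "piecewise_cubic M (\<lambda>t. g t + h t)"
  unfolding piecewise_cubic_def
proof
  fix j assume "j \<in> {1..M}"
  then obtain b c :: "real poly" where
    "degree b \<le> 3" "\<forall>t\<in>{(real j - 1) / real M .. real j / real M}. g t = poly b t"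
    "degree c \<le> 3" "\<forall>t\<in>{(real j - 1) / real M .. real j / real M}. h t = poly c t"
    using assms unfolding piecewise_cubic_def by meson
  then show "\<exists>c :: real poly. degree c \<le> 3 \<and>
     (\<forall>t\<in>{(real j - 1) / real M .. real j / real M}. g t + h t = poly c t)"
    by (intro exI[of _ "b + c"]) (auto intro: degree_add_le)
qed

lemma piecewise_cubic_cmult:
  assumes "piecewise_cubic M g"
  shows "piecewise_cubic M (\<lambda>t. a * g t)"
  unfolding piecewise_cubic_def
proof
  fix j assume "j \<in> {1..M}"
  then obtain b :: "real poly" where
    "degree b \<le> 3" "\<forall>t\<in>{(real j - 1) / real M .. real j / real M}. g t = poly b t"
    using assms unfolding piecewise_cubic_def by meson
  then show "\<exists>c :: real poly. degree c \<le> 3 \<and>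
     (\<forall>t\<in>{(real j - 1) / real M .. real j / real M}. a * g t = poly c t)"
    by (intro exI[of _ "smult a b"]) (auto intro: order.trans[OF degree_smult_le])
qed

lemma piecewise_cubic_sum:
  assumes "\<And>i. i \<in> I \<Longrightarrow> piecewise_cubic M (g i)"
  shows "piecewise_cubic M (\<lambda>t. \<Sum>i\<in>I. g i t)"
  using assms
proof (induction I rule: infinite_finite_induct)
  case (insert i I)
  then show ?case using piecewise_cubic_add[of M "g i" "\<lambda>t. \<Sum>i\<in>I. g i t"] by simp
qed (auto simp: piecewise_cubic_def intro!: exI[of _ 0])

text \<open>A cell lies entirely on one side of the knot. The knot index is an integer rather than a
  natural number because the hat at 0 reaches back to -1/M.\<close>

lemma piecewise_cubic_tpow:
  fixes c :: int
  shows "piecewise_cubic M (tpow 3 (of_int c / real M))"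
  unfolding piecewise_cubic_def
proof
  fix j assume j: "j \<in> {1..M}"
  then have M: "0 < real M" by auto
  show "\<exists>p :: real poly. degree p \<le> 3 \<and>
     (\<forall>t\<in>{(real j - 1) / real M .. real j / real M}. tpow 3 (of_int c / real M) t = poly p t)"
  proof (cases "c \<le> int j - 1")
    case True
    then have "real_of_int c \<le> real_of_int (int j - 1)" by (simp only: of_int_le_iff)
    then have "of_int c / real M \<le> (real j - 1) / real M" using M by (intro divide_right_mono) auto
    then show ?thesis
      by (intro exI[of _ "[:- (of_int c / real M), 1:] ^ 3"])
        (auto simp: tpow_def degree_power_eq intro!: arg_cong[of _ _ "\<lambda>x. x ^ 3"])
  next
    case False
    then have "real_of_int (int j) \<le> real_of_int c" unfolding of_int_le_iff by simp
    then have "real j / real M \<le> of_int c / real M" using M by (intro divide_right_mono) auto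
    then show ?thesis by (intro exI[of _ 0]) (auto simp: tpow_def)
  qed
qed

lemma quasi_interpolant_in_spline_space:
  assumes M: "0 < M"
  shows "quasi_interpolant M f \<in> spline_space M"
proof -
  define D :: "nat \<Rightarrow> real \<Rightarrow> real" where
    "D k = (if k = 0 then quasi_interpolant M f else if k = 1 then quasi_interpolant1 M f else quasi_interpolant2 M f)" for k
  note q = quasi_interpolant_has_derivative[OF M, where f = f]
  have "Ck_on 2 {0..1} (quasi_interpolant M f)"
    unfolding Ck_on_def
  proof (intro exI[of _ D] conjI allI impI ballI)
    fix i :: nat and t :: real assume "i < 2"
    then have "i = 0 \<or> i = 1" by auto
    then show "(D i has_real_derivative D (Suc i) t) (at t within {0..1})"
      by (auto simp: D_def intro: has_field_derivative_at_within q)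
  qed (auto simp: D_def q)
  moreover have "piecewise_cubic M (quasi_interpolant M f)"
  proof -
    have b: "piecewise_cubic M (bspline 3 (1 / real M) j)" for j
    proof -
      have e: "(real j - 1) * (1 / real M) = of_int (int j - 1) / real M" "real j * (1 / real M) = of_int (int j) / real M"
        "(real j + 1) * (1 / real M) = of_int (int j + 1) / real M" by auto
      have "piecewise_cubic M (\<lambda>t. (1 / (fact 3 * (1 / real M))) * ((tpow 3 (of_int (int j - 1) / real M) t
          + (- 2) * tpow 3 (of_int (int j) / real M) t) + tpow 3 (of_int (int j + 1) / real M) t))"
        by (intro piecewise_cubic_cmult piecewise_cubic_add piecewise_cubic_tpow)
      then show ?thesis unfolding bspline_def[abs_def] e by (simp add: mult.commute)
    qed
    have "piecewise_cubic M (\<lambda>t. poly [:f 0, (f (1 / real M) - f 0) * real M:] t + (\<Sum>j\<le>M. second_difference M f j * bspline 3 (1 / real M) j t))"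
      by (intro piecewise_cubic_add piecewise_cubic_sum piecewise_cubic_cmult b piecewise_cubic_poly)
        (simp add: degree_pCons_eq_if)
    then show ?thesis unfolding quasi_interpolant_def[abs_def] by (simp add: mult.commute)
  qed
  ultimately show ?thesis by (simp add: spline_space_def piecewise_cubic_def)
qed

lemma spline_space_lincomb:
  assumes u: "u \<in> spline_space M" and v: "v \<in> spline_space M"
  shows "(\<lambda>t. a * u t + b * v t) \<in> spline_space M"
proof -
  obtain D where D: "D 0 = u" "\<And>i t. i < 2 \<Longrightarrow> t \<in> {0..1} \<Longrightarrow> (D i has_real_derivative D (Suc i) t) (at t within {0..1})"
    "continuous_on {0..1} (D 2)" using u by (auto simp: spline_space_def Ck_on_def)
  obtain E where E: "E 0 = v" "\<And>i t. i < 2 \<Longrightarrow> t \<in> {0..1} \<Longrightarrow> (E i has_real_derivative E (Suc i) t) (at t within {0..1})"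
    "continuous_on {0..1} (E 2)" using v by (auto simp: spline_space_def Ck_on_def)
  have "Ck_on 2 {0..1} (\<lambda>t. a * u t + b * v t)"
    unfolding Ck_on_def
    by (rule exI[of _ "\<lambda>i t. a * D i t + b * E i t"])
      (auto simp: D(1) E(1) intro!: DERIV_add DERIV_cmult D E continuous_intros)
  moreover have "piecewise_cubic M (\<lambda>t. a * u t + b * v t)"
    using u v by (intro piecewise_cubic_add piecewise_cubic_cmult) (auto simp: spline_space_def piecewise_cubic_def)
  ultimately show ?thesis by (simp add: spline_space_def piecewise_cubic_def)
qed

lemma spline_space_obtain_rep:
  assumes "v \<in> spline_space M"
  obtains v1 v2 where "W22_rep 0 1 v v1 v2" "continuous_on {0..1} v2"
proof -
  obtain D where D: "D 0 = v" "\<And>i t. i < 2 \<Longrightarrow> t \<in> {0..1} \<Longrightarrow> (D i has_real_derivative D (Suc i) t) (at t within {0..1})"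
    "continuous_on {0..1} (D 2)" using assms by (auto simp: spline_space_def Ck_on_def)
  have "W22_rep 0 1 v (D 1) (D 2)"
    using D(2)[of 0] D(2)[of 1] D(1,3) by (intro W22_rep_C2) (auto simp: numeral_2_eq_2)
  then show ?thesis using D(3) by (rule that)
qed

section \<open>Truncated powers span the spline space\<close>

lemma deriv_eq_pderiv_on_Icc:
  fixes v :: "real \<Rightarrow> real"
  assumes ab: "a < b" and t: "t \<in> {a..b}" and sub: "{a..b} \<subseteq> T"
    and v: "(v has_real_derivative v') (at t within T)" and P: "\<And>s. s \<in> {a..b} \<Longrightarrow> v s = poly P s"
  shows "v' = poly (pderiv P) t"
proof -
  have "(v has_real_derivative v') (at t within {a..b})" by (rule DERIV_subset[OF v sub])
  then have 1: "(poly P has_real_derivative v') (at t within {a..b})"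
    unfolding has_field_derivative_def by (rule has_derivative_transform[OF t, rotated]) (simp add: P)
  have 2: "(poly P has_real_derivative poly (pderiv P) t) (at t within {a..b})"
    by (rule has_field_derivative_at_within[OF poly_DERIV])
  show ?thesis
    using 1 2 ab t unfolding has_real_derivative_iff_has_vector_derivative
    by (metis vector_derivative_unique_within trivial_limit_within islimpt_Icc)
qed

text \<open>Applied to the difference of two adjacent cubic pieces, which agree to second order at
  their common knot. One truncated cubic then accounts for the passage from one cell to the
  next.\<close>

lemma cubic_with_triple_root:
  fixes R :: "real poly"
  assumes deg: "degree R \<le> 3" and z: "poly R p = 0" "poly (pderiv R) p = 0" "poly (pderiv (pderiv R)) p = 0"
  shows "poly R t = coeff R 3 * (t - p) ^ 3"
proof -
  obtain r0 r1 r2 r3 where R: "R = [:r0, r1, r2, r3:]"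
  proof
    show "R = [:coeff R 0, coeff R 1, coeff R 2, coeff R 3:]"
    proof (rule poly_eqI)
      fix n :: nat
      consider "n = 0" | "n = 1" | "n = 2" | "n = 3" | "3 < n" by linarith
      then show "coeff R n = coeff [:coeff R 0, coeff R 1, coeff R 2, coeff R 3:] n"
      proof cases
        case 5
        then obtain m where m: "n = Suc (Suc (Suc (Suc m)))"
          by (metis Suc_lessE less_natE numeral_3_eq_3)
        show ?thesis using 5 deg by (simp add: coeff_eq_0 m)
      qed (auto simp: numeral_2_eq_2 numeral_3_eq_3)
    qed
  qed
  have c3: "coeff R 3 = r3" by (simp add: R numeral_3_eq_3)
  have "r2 = - 3 * r3 * p" using z(3) by (simp add: R pderiv_pCons algebra_simps)
  moreover have "r1 + 2 * r2 * p + 3 * r3 * p\<^sup>2 = 0"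
    using z(2) by (simp add: R pderiv_pCons algebra_simps power2_eq_square)
  moreover have "r0 + r1 * p + r2 * p\<^sup>2 + r3 * p ^ 3 = 0"
    using z(1) by (simp add: R algebra_simps power2_eq_square power3_eq_cube)
  ultimately have "r2 = - 3 * r3 * p" "r1 = 3 * r3 * p\<^sup>2" "r0 = - r3 * p ^ 3"
    by (auto simp: algebra_simps power2_eq_square power3_eq_cube)
  then show ?thesis unfolding c3
    by (simp add: R algebra_simps power2_eq_square power3_eq_cube)
qed

text \<open>
  On $[0,1]$ the index $k = 3$ is the monomial $t^3$, and the index $k = 3 + j$ belongs to the
  knot $j/M$.
\<close>

definition spline_basis :: "nat \<Rightarrow> nat \<Rightarrow> real \<Rightarrow> real" where
  "spline_basis M k t = (if k < 3 then t ^ k else tpow 3 (real (k - 3) / real M) t)"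

text \<open>The expansion is built from left to right: the first cell gives a cubic polynomial, and
  every interior knot adds a multiple of one truncated cubic. The number \<open>M + 3\<close> of
  functions becomes the factor of \<sigma>^2 in the noise bound.\<close>

lemma spline_space_basis:
  assumes M: "0 < M" and v: "v \<in> spline_space M"
  obtains c where "\<And>t. t \<in> {0..1} \<Longrightarrow> v t = (\<Sum>k<M + 3. c k * spline_basis M k t)"
proof -
  define p where "p j = real j / real M" for j
  have pm: "p j < p (Suc j)" "0 \<le> p j" for j using M by (auto simp: p_def divide_strict_right_mono)
  have p1: "p j \<le> 1" if "j \<le> M" for j using that M by (simp add: p_def)
  obtain D where D: "D 0 = v" "\<And>i t. i < 2 \<Longrightarrow> t \<in> {0..1} \<Longrightarrow> (D i has_real_derivative D (Suc i) t) (at t within {0..1})"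
    using v by (auto simp: spline_space_def Ck_on_def)
  have "\<exists>c. degree c \<le> 3 \<and> (\<forall>t\<in>{p j..p (Suc j)}. v t = poly c t)" if "j < M" for j
  proof -
    have "\<forall>j\<in>{1..M}. \<exists>c. degree c \<le> 3 \<and> (\<forall>t\<in>{(real j - 1) / real M .. real j / real M}. v t = poly c t)"
      using v by (simp add: spline_space_def)
    from bspec[OF this, of "Suc j"] that show ?thesis by (simp add: p_def)
  qed
  then obtain C where C: "\<And>j. j < M \<Longrightarrow> degree (C j) \<le> 3" "\<And>j t. j < M \<Longrightarrow> t \<in> {p j..p (Suc j)} \<Longrightarrow> v t = poly (C j) t"
    by metis
  have sub: "{p j..p (Suc j)} \<subseteq> {0..1}" if "j < M" for j
    using pm(2)[of j] p1[of "Suc j"] that by auto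
  have C1: "D 1 t = poly (pderiv (C j)) t" if "j < M" "t \<in> {p j..p (Suc j)}" for j t
  proof (rule deriv_eq_pderiv_on_Icc[OF pm(1) that(2) sub[OF that(1)]])
    show "(v has_real_derivative D 1 t) (at t within {0..1})"
      using D(2)[of 0 t] D(1) sub[OF that(1)] that(2) by auto
  qed (rule C(2)[OF that(1)])
  have C2: "D 2 t = poly (pderiv (pderiv (C j))) t" if "j < M" "t \<in> {p j..p (Suc j)}" for j t
  proof (rule deriv_eq_pderiv_on_Icc[OF pm(1) that(2) sub[OF that(1)]])
    show "(D 1 has_real_derivative D 2 t) (at t within {0..1})"
      using D(2)[of 1 t] sub[OF that(1)] that(2) by (auto simp: numeral_2_eq_2)
  qed (rule C1[OF that(1)])
  \<comment> \<open>The second clause is needed for the induction: past the last knot used, the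
    partial sum continues the last cubic piece to all larger \<open>t\<close>, so the next truncated
    power has only to add the difference of two cubics.\<close>
  have "\<exists>c. (\<forall>t\<in>{0..p n}. v t = (\<Sum>k<n + 3. c k * spline_basis M k t)) \<and>
      (\<forall>t\<ge>p (n - 1). (\<Sum>k<n + 3. c k * spline_basis M k t) = poly (C (n - 1)) t)" if "1 \<le> n" "n \<le> M" for n
    using that
  proof (induction n rule: dec_induct)
    case base
    have "(\<Sum>k<1 + 3. coeff (C 0) k * spline_basis M k t) = poly (C 0) t" if "0 \<le> t" for t
    proof -
      have "poly (C 0) t = (\<Sum>k\<le>3. coeff (C 0) k * t ^ k)"
        unfolding poly_altdef using C(1)[of 0] M
        by (intro sum.mono_neutral_left) (auto simp: coeff_eq_0)
      also have "\<dots> = (\<Sum>k<1 + 3. coeff (C 0) k * spline_basis M k t)"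
        using that by (intro sum.cong) (auto simp: spline_basis_def tpow_def less_Suc_eq numeral_3_eq_3)
      finally show ?thesis by simp
    qed
    then show ?case using C(2)[of 0] M by (intro exI[of _ "coeff (C 0)"]) (auto simp: p_def)
  next
    case (step n)
    then have n: "1 \<le> n" "n < M" by auto
    obtain c where c: "\<forall>t\<in>{0..p n}. v t = (\<Sum>k<n + 3. c k * spline_basis M k t)"
      "\<forall>t\<ge>p (n - 1). (\<Sum>k<n + 3. c k * spline_basis M k t) = poly (C (n - 1)) t"
      using step by auto
    define R where "R = C n - C (n - 1)"
    have pn: "p n \<in> {p n..p (Suc n)}" "p n \<in> {p (n - 1)..p (Suc (n - 1))}"
      using pm(1)[of n] pm(1)[of "n - 1"] n by auto
    have n1: "n - 1 < M" using n by auto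
    have R: "poly R t = coeff R 3 * (t - p n) ^ 3" for t
    proof (rule cubic_with_triple_root)
      show "degree R \<le> 3" unfolding R_def using C(1)[of n] C(1)[of "n - 1"] n by (intro degree_diff_le) auto
      show "poly R (p n) = 0" using C(2)[OF n(2) pn(1)] C(2)[OF n1 pn(2)] by (simp add: R_def)
      show "poly (pderiv R) (p n) = 0" using C1[OF n(2) pn(1)] C1[OF n1 pn(2)] by (simp add: R_def pderiv_diff)
      show "poly (pderiv (pderiv R)) (p n) = 0" using C2[OF n(2) pn(1)] C2[OF n1 pn(2)] by (simp add: R_def pderiv_diff)
    qed
    define c' where "c' = c(n + 3 := coeff R 3)"
    have s: "(\<Sum>k<Suc n + 3. c' k * spline_basis M k t) = (\<Sum>k<n + 3. c k * spline_basis M k t) + coeff R 3 * tpow 3 (p n) t" for t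
    proof -
      have "(\<Sum>k<Suc n + 3. c' k * spline_basis M k t) =
          (\<Sum>k<n + 3. c' k * spline_basis M k t) + c' (n + 3) * spline_basis M (n + 3) t"
        unfolding add_Suc by (rule sum.lessThan_Suc)
      also have "(\<Sum>k<n + 3. c' k * spline_basis M k t) = (\<Sum>k<n + 3. c k * spline_basis M k t)"
        by (rule sum.cong) (auto simp: c'_def)
      finally show ?thesis by (simp add: c'_def spline_basis_def p_def)
    qed
    have big: "(\<Sum>k<Suc n + 3. c' k * spline_basis M k t) = poly (C n) t" if "p n \<le> t" for t
    proof -
      have "p (n - 1) \<le> t" using that pm(1)[of "n - 1"] n by simp
      then show ?thesis using c(2) that R[of t] unfolding s by (simp add: tpow_def R_def)
    qed
    have "v t = (\<Sum>k<Suc n + 3. c' k * spline_basis M k t)" if t: "t \<in> {0..p (Suc n)}" for t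
    proof (cases "t \<le> p n")
      case True
      then show ?thesis using c(1) t unfolding s by (simp add: tpow_def)
    next
      case False
      then show ?thesis using big[of t] C(2)[OF n(2), of t] t by simp
    qed
    then show ?case using big by (intro exI[of _ c']) simp
  qed
  from this[of M] obtain c where "\<forall>t\<in>{0..p M}. v t = (\<Sum>k<M + 3. c k * spline_basis M k t)"
    using M by auto
  moreover have "p M = 1" using M by (simp add: p_def)
  ultimately show ?thesis by (intro that) auto
qed

subsection \<open>Noise and Chernoff bounds\<close>

text \<open>Without normalisation, linearly dependent vectors simply produce zero vectors. The rank
  may then vary with \<open>X\<close> without a case distinction, and every vector stays a
  measurable expression in \<open>X\<close>.\<close>

lemma measurable_Gram_Schmidt:
  fixes \<phi> :: "nat \<Rightarrow> 'b \<Rightarrow> nat \<Rightarrow> real"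
  assumes I: "finite I" and m: "\<And>k i. i \<in> I \<Longrightarrow> (\<lambda>X. \<phi> k X i) \<in> borel_measurable S"
  shows "\<exists>b. (\<forall>k<n. \<forall>i\<in>I. (\<lambda>X. b k X i) \<in> borel_measurable S) \<and>
     (\<forall>X. \<forall>k<n. \<forall>l<k. (\<Sum>i\<in>I. b k X i * b l X i) = 0) \<and>
     (\<forall>X c. \<exists>e. \<forall>i\<in>I. (\<Sum>k<n. c k * \<phi> k X i) = (\<Sum>k<n. e k * b k X i))"
proof (induction n)
  case 0
  show ?case by simp
next
  case (Suc n)
  then obtain b where H: "(\<forall>k<n. \<forall>i\<in>I. (\<lambda>X. b k X i) \<in> borel_measurable S) \<and>
     (\<forall>X. \<forall>k<n. \<forall>l<k. (\<Sum>i\<in>I. b k X i * b l X i) = 0) \<and>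
     (\<forall>X c. \<exists>e. \<forall>i\<in>I. (\<Sum>k<n. c k * \<phi> k X i) = (\<Sum>k<n. e k * b k X i))"
    by (elim exE)
  have bm: "(\<lambda>X. b k X i) \<in> borel_measurable S" if "k < n" "i \<in> I" for k i
    using H that by simp
  have orth: "(\<Sum>i\<in>I. b k X i * b l X i) = 0" if "k < n" "l < k" for X k l
    using H that by simp
  have span: "\<exists>e. \<forall>i\<in>I. (\<Sum>k<n. c k * \<phi> k X i) = (\<Sum>k<n. e k * b k X i)" for X c
    using H by simp
  \<comment> \<open>For a zero vector the quotient is 0 by the convention for division, which is the
    right coefficient because the numerator vanishes as well.\<close>
  define q where "q l X = (\<Sum>i\<in>I. \<phi> n X i * b l X i) / (\<Sum>i\<in>I. (b l X i)\<^sup>2)" for l X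
  define r where "r X i = \<phi> n X i - (\<Sum>l<n. q l X * b l X i)" for X i
  define b' where "b' = b(n := r)"
  have b': "b' n = r" "\<And>k. k < n \<Longrightarrow> b' k = b k" by (auto simp: b'_def)
  have rm: "(\<lambda>X. r X i) \<in> borel_measurable S" if "i \<in> I" for i
    unfolding r_def q_def
    using m bm that by (intro borel_measurable_diff borel_measurable_sum borel_measurable_times
        borel_measurable_divide borel_measurable_power) auto
  have orth2: "(\<Sum>i\<in>I. b k X i * b l X i) = 0" if "k < n" "l < n" "k \<noteq> l" for k l X
    using orth[of k l X] orth[of l k X] that by (cases "l < k") (auto simp: mult.commute)
  have ro: "(\<Sum>i\<in>I. r X i * b l X i) = 0" if l: "l < n" for l X
  proof -
    have "(\<Sum>i\<in>I. r X i * b l X i) = (\<Sum>i\<in>I. \<phi> n X i * b l X i) - (\<Sum>i\<in>I. \<Sum>k<n. q k X * (b k X i * b l X i))"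
      by (simp add: r_def left_diff_distrib sum_subtractf sum_distrib_right mult.assoc)
    also have "(\<Sum>i\<in>I. \<Sum>k<n. q k X * (b k X i * b l X i)) = (\<Sum>k<n. q k X * (\<Sum>i\<in>I. b k X i * b l X i))"
      by (subst sum.swap) (simp add: sum_distrib_left)
    also have "\<dots> = (\<Sum>k\<in>{l}. q k X * (\<Sum>i\<in>I. b k X i * b l X i))"
      using l by (intro sum.mono_neutral_right) (auto simp: orth2)
    also have "\<dots> = q l X * (\<Sum>i\<in>I. (b l X i)\<^sup>2)" by (simp add: power2_eq_square)
    also have "\<dots> = (\<Sum>i\<in>I. \<phi> n X i * b l X i)"
    proof (cases "(\<Sum>i\<in>I. (b l X i)\<^sup>2) = 0")
      case True
      then have "\<forall>i\<in>I. b l X i = 0" using I by (simp add: sum_nonneg_eq_0_iff)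
      then show ?thesis by simp
    qed (simp add: q_def)
    finally show ?thesis by simp
  qed
  have "\<exists>e. \<forall>i\<in>I. (\<Sum>k<Suc n. c k * \<phi> k X i) = (\<Sum>k<Suc n. e k * b' k X i)" for X c
  proof -
    obtain e where e: "\<forall>i\<in>I. (\<Sum>k<n. c k * \<phi> k X i) = (\<Sum>k<n. e k * b k X i)" using span[of c X] by (elim exE)
    define e' where "e' k = (if k < n then e k + c n * q k X else c n)" for k
    have "(\<Sum>k<Suc n. c k * \<phi> k X i) = (\<Sum>k<Suc n. e' k * b' k X i)" if "i \<in> I" for i
    proof -
      have "(\<Sum>k<Suc n. e' k * b' k X i) = (\<Sum>k<n. e k * b k X i + c n * (q k X * b k X i)) + c n * r X i"
        by (simp add: e'_def b' algebra_simps)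
      also have "\<dots> = (\<Sum>k<n. c k * \<phi> k X i) + c n * \<phi> n X i"
        using e that by (simp add: sum.distrib r_def sum_distrib_left[symmetric] algebra_simps)
      finally show ?thesis by simp
    qed
    then show ?thesis by (intro exI[of _ e'] ballI)
  qed
  moreover have "(\<lambda>X. b' k X i) \<in> borel_measurable S" if "k < Suc n" "i \<in> I" for k i
    using that rm bm by (cases "k = n") (auto simp: b')
  moreover have "(\<Sum>i\<in>I. b' k X i * b' l X i) = 0" if "k < Suc n" "l < k" for k l X
    using that ro orth by (cases "k = n") (auto simp: b')
  ultimately show ?case by (intro exI[of _ b'] conjI allI impI ballI)
qed

text \<open>The first factor is the squared norm of the projection of \<eta> onto the span of the
  \<open>b k\<close>, with zero vectors contributing 0. The estimate is the Cauchy-Schwarz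
  inequality for coefficients in the normalised basis.\<close>

lemma orthogonal_projection_bound:
  fixes b :: "nat \<Rightarrow> nat \<Rightarrow> real"
  assumes I: "finite I" and orth: "\<And>k l. k < n \<Longrightarrow> l < k \<Longrightarrow> (\<Sum>i\<in>I. b k i * b l i) = 0"
    and v: "\<And>i. i \<in> I \<Longrightarrow> v i = (\<Sum>k<n. e k * b k i)"
  shows "(\<Sum>i\<in>I. \<eta> i * v i)\<^sup>2 \<le> (\<Sum>k<n. (\<Sum>i\<in>I. \<eta> i * b k i)\<^sup>2 / (\<Sum>i\<in>I. (b k i)\<^sup>2)) * (\<Sum>i\<in>I. (v i)\<^sup>2)"
proof -
  define B where "B k = (\<Sum>i\<in>I. (b k i)\<^sup>2)" for k
  define a where "a k = (\<Sum>i\<in>I. \<eta> i * b k i)" for k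
  have B0: "0 \<le> B k" for k by (simp add: B_def sum_nonneg)
  have orth2: "(\<Sum>i\<in>I. b k i * b l i) = (if k = l then B k else 0)" if "k < n" "l < n" for k l
    using orth[of k l] orth[of l k] that by (cases k l rule: linorder_cases) (auto simp: mult.commute B_def power2_eq_square)
  have "(\<Sum>i\<in>I. (v i)\<^sup>2) = (\<Sum>i\<in>I. \<Sum>k<n. \<Sum>l<n. e k * e l * (b k i * b l i))"
    by (intro sum.cong) (auto simp: v power2_eq_square sum_product mult_ac)
  also have "\<dots> = (\<Sum>k<n. \<Sum>l<n. e k * e l * (\<Sum>i\<in>I. b k i * b l i))"
    by (simp only: sum.swap[of _ _ I] sum_distrib_left)
  also have "\<dots> = (\<Sum>k<n. \<Sum>l<n. if k = l then (e k)\<^sup>2 * B k else 0)"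
    by (intro sum.cong) (auto simp: orth2 power2_eq_square)
  also have "\<dots> = (\<Sum>k<n. (e k)\<^sup>2 * B k)" by simp
  finally have v2: "(\<Sum>i\<in>I. (v i)\<^sup>2) = (\<Sum>k<n. (e k)\<^sup>2 * B k)" .
  have "(\<Sum>i\<in>I. \<eta> i * v i) = (\<Sum>i\<in>I. \<Sum>k<n. e k * (\<eta> i * b k i))"
    by (intro sum.cong) (auto simp: v sum_distrib_left mult_ac)
  also have "\<dots> = (\<Sum>k<n. e k * a k)"
    by (simp only: sum.swap[of _ _ I] sum_distrib_left a_def)
  \<comment> \<open>Normalising is legitimate even if \<open>B k = 0\<close>, as then
    \<open>b k\<close> is zero on \<open>I\<close> and both sides vanish.\<close>
  also have "\<dots> = (\<Sum>k<n. (e k * sqrt (B k)) * (a k / sqrt (B k)))"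
  proof (intro sum.cong refl)
    fix k
    show "e k * a k = (e k * sqrt (B k)) * (a k / sqrt (B k))"
    proof (cases "B k = 0")
      case True
      then have "\<forall>i\<in>I. b k i = 0" using I by (simp add: B_def sum_nonneg_eq_0_iff)
      then show ?thesis by (simp add: a_def)
    qed simp
  qed
  finally have "(\<Sum>i\<in>I. \<eta> i * v i)\<^sup>2 \<le> (\<Sum>k<n. (e k * sqrt (B k))\<^sup>2) * (\<Sum>k<n. (a k / sqrt (B k))\<^sup>2)"
    using Cauchy_Schwarz_ineq_sum[of "\<lambda>k. e k * sqrt (B k)" "\<lambda>k. a k / sqrt (B k)" "{..<n}"] by simp
  also have "\<dots> = (\<Sum>i\<in>I. (v i)\<^sup>2) * (\<Sum>k<n. (a k)\<^sup>2 / B k)"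
    unfolding v2 by (simp add: power_mult_distrib power_divide B0)
  finally show ?thesis by (simp add: a_def B_def mult.commute)
qed

section \<open>Moments of the noise and exponential tails\<close>

context prob_space
begin

text \<open>Given the points, \<open>Q\<close> is the squared component of the noise along one
  direction, and uncorrelated noise has variance \<sigma>^2 in every direction. Independence is used
  on the expanded square, whose terms are a coefficient \<open>g i j\<close> bounded by 1 times
  \<eta> i \<eta> j. The result is an inequality since the vector may vanish, in which case the sum
  of the \<open>g i i\<close> is 0 instead of 1.\<close>

lemma projected_noise_expectation:
  fixes b :: "(nat \<Rightarrow> real) \<Rightarrow> nat \<Rightarrow> real" and \<eta> x :: "nat \<Rightarrow> 'a \<Rightarrow> real"
  assumes I: "finite I"
    and bm: "\<And>i. i \<in> I \<Longrightarrow> (\<lambda>X. b X i) \<in> borel_measurable (Pi\<^sub>M I (\<lambda>_. borel))"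
    and int: "\<And>i j. i \<in> I \<Longrightarrow> j \<in> I \<Longrightarrow> integrable M (\<lambda>\<omega>. \<eta> i \<omega> * \<eta> j \<omega>)"
    and cov: "\<And>i j. i \<in> I \<Longrightarrow> j \<in> I \<Longrightarrow> expectation (\<lambda>\<omega>. \<eta> i \<omega> * \<eta> j \<omega>) = (if i = j then \<sigma>\<^sup>2 else 0)"
    and indep: "indep_var (Pi\<^sub>M I (\<lambda>_. borel)) (\<lambda>\<omega>. \<lambda>i\<in>I. x i \<omega>) (Pi\<^sub>M I (\<lambda>_. borel)) (\<lambda>\<omega>. \<lambda>i\<in>I. \<eta> i \<omega>)"
  defines "Q \<equiv> \<lambda>\<omega>. (\<Sum>i\<in>I. \<eta> i \<omega> * b (\<lambda>i\<in>I. x i \<omega>) i)\<^sup>2 / (\<Sum>i\<in>I. (b (\<lambda>i\<in>I. x i \<omega>) i)\<^sup>2)"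
  shows "integrable M Q" "expectation Q \<le> \<sigma>\<^sup>2"
proof -
  define g where "g i j X = b X i * b X j / (\<Sum>i\<in>I. (b X i)\<^sup>2)" for i j X
  define X where "X \<omega> = (\<lambda>i\<in>I. x i \<omega>)" for \<omega>
  have gm: "g i j \<in> borel_measurable (Pi\<^sub>M I (\<lambda>_. borel))" if "i \<in> I" "j \<in> I" for i j
    unfolding g_def[abs_def] using bm that by (intro borel_measurable_divide borel_measurable_times
        borel_measurable_sum borel_measurable_power) auto
  have gb: "\<bar>g i j Y\<bar> \<le> 1" if "i \<in> I" "j \<in> I" for i j Y
  proof -
    define B where "B = (\<Sum>i\<in>I. (b Y i)\<^sup>2)"
    have B0: "0 \<le> B" by (simp add: B_def sum_nonneg)
    have "(b Y k)\<^sup>2 \<le> B" if "k \<in> I" for k unfolding B_def using I that by (intro member_le_sum) auto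
    then have "\<bar>b Y k\<bar> \<le> sqrt B" if "k \<in> I" for k using that by (intro abs_le_sqrtI) auto
    then have "\<bar>b Y i\<bar> * \<bar>b Y j\<bar> \<le> sqrt B * sqrt B" using that B0 by (intro mult_mono) auto
    then have "\<bar>b Y i * b Y j\<bar> \<le> B" using B0 by (simp add: abs_mult)
    then show ?thesis using B0 by (cases "B = 0") (auto simp: g_def B_def[symmetric] abs_mult divide_le_eq)
  qed
  have Xm: "X \<in> measurable M (Pi\<^sub>M I (\<lambda>_. borel))"
    using indep_var_rv1[OF indep] by (simp add: X_def[abs_def])
  have gX: "integrable M (\<lambda>\<omega>. g i j (X \<omega>))" if "i \<in> I" "j \<in> I" for i j
    using gb[OF that] by (intro integrable_const_bound[where B = 1] measurable_compose[OF Xm gm[OF that]]) auto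
  have ind: "indep_var borel (\<lambda>\<omega>. g i j (X \<omega>)) borel (\<lambda>\<omega>. \<eta> i \<omega> * \<eta> j \<omega>)" if "i \<in> I" "j \<in> I" for i j
  proof -
    have "(\<lambda>e. e i * e j) \<in> borel_measurable (Pi\<^sub>M I (\<lambda>_. borel :: real measure))"
      using that by (intro borel_measurable_times measurable_component_singleton)
    from indep_var_compose[OF indep gm[OF that] this] show ?thesis
      using that by (simp add: comp_def X_def)
  qed
  have Q: "Q = (\<lambda>\<omega>. \<Sum>i\<in>I. \<Sum>j\<in>I. g i j (X \<omega>) * (\<eta> i \<omega> * \<eta> j \<omega>))"
    unfolding Q_def g_def X_def[symmetric] power2_eq_square[of "\<Sum>i\<in>I. \<eta> i _ * b _ i"] sum_product sum_divide_distrib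
    by (intro ext sum.cong) (auto simp: mult_ac)
  have trm: "integrable M (\<lambda>\<omega>. g i j (X \<omega>) * (\<eta> i \<omega> * \<eta> j \<omega>))"
    "expectation (\<lambda>\<omega>. g i j (X \<omega>) * (\<eta> i \<omega> * \<eta> j \<omega>)) = expectation (\<lambda>\<omega>. g i j (X \<omega>)) * (if i = j then \<sigma>\<^sup>2 else 0)"
    if "i \<in> I" "j \<in> I" for i j
    using indep_var_integrable[OF ind[OF that] gX[OF that] int[OF that]]
      indep_var_lebesgue_integral[OF ind[OF that] gX[OF that] int[OF that]] cov[OF that] by auto
  show "integrable M Q" unfolding Q by (intro Bochner_Integration.integrable_sum trm)
  have "expectation Q = (\<Sum>i\<in>I. \<Sum>j\<in>I. expectation (\<lambda>\<omega>. g i j (X \<omega>)) * (if i = j then \<sigma>\<^sup>2 else 0))"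
    unfolding Q by (simp add: Bochner_Integration.integral_sum Bochner_Integration.integrable_sum trm cong: sum.cong)
  also have "\<dots> = (\<Sum>i\<in>I. expectation (\<lambda>\<omega>. g i i (X \<omega>)) * \<sigma>\<^sup>2)"
    using I by (intro sum.cong) (auto simp: if_distrib[where f = "\<lambda>z. _ * z"] sum.delta' cong: if_cong)
  also have "\<dots> = \<sigma>\<^sup>2 * expectation (\<lambda>\<omega>. \<Sum>i\<in>I. g i i (X \<omega>))"
    by (subst Bochner_Integration.integral_sum) (auto intro: gX simp: sum_distrib_left mult.commute)
  also have "\<dots> \<le> \<sigma>\<^sup>2 * 1"
  proof (intro mult_left_mono)
    have "expectation (\<lambda>\<omega>. \<Sum>i\<in>I. g i i (X \<omega>)) \<le> expectation (\<lambda>\<omega>. 1)"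
    proof (rule integral_mono)
      show "integrable M (\<lambda>\<omega>. \<Sum>i\<in>I. g i i (X \<omega>))" by (intro Bochner_Integration.integrable_sum gX)
      show "(\<Sum>i\<in>I. g i i (X \<omega>)) \<le> 1" for \<omega>
        by (simp add: g_def sum_divide_distrib[symmetric] power2_eq_square)
    qed simp
    then show "expectation (\<lambda>\<omega>. \<Sum>i\<in>I. g i i (X \<omega>)) \<le> 1" by (simp add: prob_space)
  qed simp
  finally show "expectation Q \<le> \<sigma>\<^sup>2" by simp
qed

text \<open>The strict inequality in the event covers m = 0, which occurs for vanishing noise: then
  \<open>Q\<close> is 0 almost surely.\<close>

lemma Markov_event:
  assumes Q: "integrable M Q" "\<And>\<omega>. 0 \<le> Q \<omega>" and E: "expectation Q \<le> m" and \<epsilon>: "0 < \<epsilon>"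
  shows "prob {\<omega> \<in> space M. m / \<epsilon> < Q \<omega>} \<le> \<epsilon>"
proof (cases "0 < m")
  case True
  have Qm [measurable]: "Q \<in> borel_measurable M" using Q(1) by simp
  have "prob {\<omega> \<in> space M. m / \<epsilon> < Q \<omega>} \<le> prob {\<omega> \<in> space M. m / \<epsilon> \<le> Q \<omega>}"
    by (intro finite_measure_mono) auto
  also have "\<dots> \<le> expectation Q / (m / \<epsilon>)"
    using True \<epsilon> Q by (intro integral_Markov_inequality_measure[where A = "space M"]) auto
  also have "\<dots> \<le> m / (m / \<epsilon>)" using E True \<epsilon> by (intro divide_right_mono) auto
  finally show ?thesis using True by simp
next
  case False
  have Qm [measurable]: "Q \<in> borel_measurable M" using Q(1) by simp
  have "0 \<le> expectation Q" using Q(2) by simp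
  then have z: "expectation Q = 0" "m = 0" using E False by linarith+
  then have "AE \<omega> in M. Q \<omega> = 0" using integral_nonneg_eq_0_iff_AE[OF Q(1)] Q(2) by simp
  then have "AE \<omega> in M. \<not> m / \<epsilon> < Q \<omega>" by eventually_elim (simp add: z)
  then have "prob {\<omega> \<in> space M. m / \<epsilon> < Q \<omega>} = 0"
    by (intro prob_eq_0[THEN iffD2]) (auto elim!: eventually_mono)
  then show ?thesis using \<epsilon> by simp
qed

text \<open>Convexity puts exp (t z) below the chord 1 + (exp t - 1) z, so the variables may take
  any values in the unit interval. Multiplying the hypothesis on the mean by exp t - 1 lets
  \<open>t\<close> have either sign, and one statement serves both tails.\<close>

lemma Chernoff_bound:
  fixes Z :: "nat \<Rightarrow> 'a \<Rightarrow> real"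
  assumes I: "finite I" and ind: "indep_vars (\<lambda>_. borel) Z I"
    and Z: "\<And>i \<omega>. i \<in> I \<Longrightarrow> \<omega> \<in> space M \<Longrightarrow> Z i \<omega> \<in> {0..1}"
    and E: "\<And>i. i \<in> I \<Longrightarrow> (exp t - 1) * expectation (Z i) \<le> (exp t - 1) * \<mu>"
  shows "prob {\<omega> \<in> space M. a \<le> t * (\<Sum>i\<in>I. Z i \<omega>)} \<le> exp (real (card I) * (exp t - 1) * \<mu> - a)"
proof -
  have Zm [measurable]: "Z i \<in> borel_measurable M" if "i \<in> I" for i
    using ind that by (auto simp: indep_vars_def)
  have Zi: "integrable M (Z i)" if "i \<in> I" for i
    using Z that by (intro integrable_const_bound[where B = 1] Zm) auto
  have cvx: "exp (t * z) \<le> 1 + (exp t - 1) * z" if "z \<in> {0..1}" for z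
  proof -
    have "exp ((1 - z) *\<^sub>R 0 + z *\<^sub>R t) \<le> (1 - z) * exp 0 + z * exp t"
      using that by (intro convex_onD[OF exp_convex]) auto
    then show ?thesis by (simp add: algebra_simps)
  qed
  have ei: "integrable M (\<lambda>\<omega>. exp (t * Z i \<omega>))" if "i \<in> I" for i
  proof (rule integrable_const_bound[where B = "1 + \<bar>exp t - 1\<bar>"])
    show "AE \<omega> in M. norm (exp (t * Z i \<omega>)) \<le> 1 + \<bar>exp t - 1\<bar>"
    proof (intro AE_I2)
      fix \<omega> assume "\<omega> \<in> space M"
      then have z: "Z i \<omega> \<in> {0..1}" using Z that by blast
      have "(exp t - 1) * Z i \<omega> \<le> \<bar>exp t - 1\<bar> * 1" using z
        by (intro order.trans[OF mult_right_mono[OF abs_ge_self] mult_left_mono]) auto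
      then show "norm (exp (t * Z i \<omega>)) \<le> 1 + \<bar>exp t - 1\<bar>" using cvx[OF z] by simp
    qed
  qed (use that in measurable)
  have ee: "expectation (\<lambda>\<omega>. exp (t * Z i \<omega>)) \<le> exp ((exp t - 1) * \<mu>)" if "i \<in> I" for i
  proof -
    have "expectation (\<lambda>\<omega>. exp (t * Z i \<omega>)) \<le> expectation (\<lambda>\<omega>. 1 + (exp t - 1) * Z i \<omega>)"
      using that by (intro integral_mono ei cvx Z Bochner_Integration.integrable_add integrable_mult_right Zi) auto
    also have "\<dots> = 1 + (exp t - 1) * expectation (Z i)"
      using Zi[OF that] by (simp add: prob_space)
    also have "\<dots> \<le> 1 + (exp t - 1) * \<mu>" using E[OF that] by simp
    also have "\<dots> \<le> exp ((exp t - 1) * \<mu>)" by (rule exp_ge_add_one_self)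
    finally show ?thesis .
  qed
  have ind': "indep_vars (\<lambda>_. borel) (\<lambda>i \<omega>. exp (t * Z i \<omega>)) I"
    by (rule indep_vars_compose2[OF ind]) measurable
  note prod = indep_vars_integrable[OF I ind' ei] indep_vars_lebesgue_integral[OF I ind' ei]
  have ps: "(\<Prod>i\<in>I. exp (t * Z i \<omega>)) = exp (t * (\<Sum>i\<in>I. Z i \<omega>))" for \<omega>
    by (simp add: exp_sum[OF I] sum_distrib_left)
  have "prob {\<omega> \<in> space M. a \<le> t * (\<Sum>i\<in>I. Z i \<omega>)} = prob {\<omega> \<in> space M. exp a \<le> (\<Prod>i\<in>I. exp (t * Z i \<omega>))}"
    unfolding ps by simp
  also have "\<dots> \<le> expectation (\<lambda>\<omega>. \<Prod>i\<in>I. exp (t * Z i \<omega>)) / exp a"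
    by (intro integral_Markov_inequality_measure[where A = "space M"] prod) (auto intro!: AE_I2 prod_nonneg)
  also have "\<dots> \<le> (\<Prod>i\<in>I. exp ((exp t - 1) * \<mu>)) / exp a"
  proof (intro divide_right_mono)
    have "expectation (\<lambda>\<omega>. \<Prod>i\<in>I. exp (t * Z i \<omega>)) = (\<Prod>i\<in>I. expectation (\<lambda>\<omega>. exp (t * Z i \<omega>)))"
      by (rule prod(2))
    also have "\<dots> \<le> (\<Prod>i\<in>I. exp ((exp t - 1) * \<mu>))"
      by (intro prod_mono conjI ee Bochner_Integration.integral_nonneg) auto
    finally show "expectation (\<lambda>\<omega>. \<Prod>i\<in>I. exp (t * Z i \<omega>)) \<le> (\<Prod>i\<in>I. exp ((exp t - 1) * \<mu>))" .
  qed simp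
  also have "\<dots> = exp (real (card I) * (exp t - 1) * \<mu> - a)"
    by (simp add: exp_diff exp_of_nat_mult[symmetric] mult.assoc)
  finally show ?thesis .
qed

end

subsection \<open>The error bound\<close>

lemma nonneg_of_quadratic_perturbation:
  fixes L R :: real
  assumes "\<And>h. 0 < h \<Longrightarrow> h \<le> 1 \<Longrightarrow> 0 \<le> 2 * h * L + h\<^sup>2 * R" "0 \<le> R"
  shows "0 \<le> L"
proof (rule ccontr)
  assume L: "\<not> 0 \<le> L"
  \<comment> \<open>Chosen so that h R stays at most -L, which makes 2 L + h R negative.\<close>
  define h where "h = min 1 (- L / (R + 1))"
  have "0 < - L / (R + 1)" using L assms(2) by (intro divide_pos_pos) auto
  then have h: "0 < h" "h \<le> 1" "h \<le> - L / (R + 1)" unfolding h_def by linarith+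
  have "h * R \<le> h * (R + 1)" using h by (intro mult_left_mono) auto
  also have "\<dots> \<le> - L" using h(3) pos_le_divide_eq[of "R + 1" h "- L"] assms(2) by linarith
  finally have "h * (2 * L + h * R) < 0" using h L by (intro mult_pos_neg) auto
  then show False using assms(1)[OF h(1,2)] by (simp add: power2_eq_square algebra_simps)
qed

text \<open>The first variation towards \<open>g\<close> is nonnegative, which is stronger than
  comparing the two functional values: it leaves the extra terms -W and -\<alpha> J2. Here -W
  cancels exactly the part \<open>W\<close> produced when the noise term is split, so the sum of
  squares at the points is bounded with constant 1.\<close>

lemma tikhonov_minimizer_bound:
  fixes x \<eta> z :: "nat \<Rightarrow> real"
  assumes \<alpha>: "0 < \<alpha>"
    and min: "is_arg_min (tikhonov N x \<alpha> z) (\<lambda>g. g \<in> spline_space M) f\<^sub>N"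
    and z: "\<And>i. z i = f (x i) + \<eta> i"
    and g: "g \<in> spline_space M"
    and rn: "W22_rep 0 1 f\<^sub>N n1 n2" "continuous_on {0..1} n2"
    and rg: "W22_rep 0 1 g g1 g2" "continuous_on {0..1} g2"
    and Q: "0 \<le> Q" "\<And>w. w \<in> spline_space M \<Longrightarrow> (\<Sum>i=1..N. \<eta> i * w (x i))\<^sup>2 \<le> Q * (\<Sum>i=1..N. (w (x i))\<^sup>2)"
  shows "1 / real N * (\<Sum>i=1..N. (f\<^sub>N (x i) - f (x i))\<^sup>2) + \<alpha> * sq_integral 0 1 n2
     \<le> Q / real N + 1 / real N * (\<Sum>i=1..N. (g (x i) - f (x i))\<^sup>2) + \<alpha> * sq_integral 0 1 g2"
proof -
  have fN: "f\<^sub>N \<in> spline_space M" and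
    le: "\<And>v. v \<in> spline_space M \<Longrightarrow> tikhonov N x \<alpha> z f\<^sub>N \<le> tikhonov N x \<alpha> z v"
    using min by (auto simp: is_arg_min_def not_less)
  have tik: "tikhonov N x \<alpha> z v = 1 / real N * (\<Sum>i=1..N. (v (x i) - z i)\<^sup>2) + \<alpha> * sq_integral 0 1 v2"
    if "W22_rep 0 1 v v1 v2" for v v1 v2
    using W22_rep_L2norm_weak_deriv[OF _ that] by (simp add: tikhonov_def)
  define w where "w t = f\<^sub>N t - g t" for t
  have ws: "w \<in> spline_space M"
    using spline_space_lincomb[OF fN g, of 1 "-1"] by (simp add: w_def[abs_def])
  define c where "c = 1 / real N"
  have c0: "0 \<le> c" by (simp add: c_def)
  define T where "T = (\<Sum>i=1..N. (f\<^sub>N (x i) - z i) * (- w (x i)))"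
  define W where "W = (\<Sum>i=1..N. (w (x i))\<^sup>2)"
  define J0 where "J0 = sq_integral 0 1 n2"
  define Jg where "Jg = sq_integral 0 1 g2"
  define J1 where "J1 = integral {0..1} (\<lambda>t. n2 t * (g2 t - n2 t))"
  define J2 where "J2 = integral {0..1} (\<lambda>t. (g2 t - n2 t)\<^sup>2)"
  have W0: "0 \<le> W" by (simp add: W_def sum_nonneg)
  have J20: "0 \<le> J2" unfolding J2_def
    by (intro Henstock_Kurzweil_Integration.integral_nonneg integrable_continuous_interval continuous_intros rn rg) auto
  have has: "((\<lambda>t. (n2 t)\<^sup>2) has_integral J0) {0..1}" "((\<lambda>t. (g2 t)\<^sup>2) has_integral Jg) {0..1}"
    "((\<lambda>t. n2 t * (g2 t - n2 t)) has_integral J1) {0..1}" "((\<lambda>t. (g2 t - n2 t)\<^sup>2) has_integral J2) {0..1}"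
    unfolding J0_def Jg_def J1_def J2_def
    by (intro integrable_integral integrable_continuous_interval continuous_intros rn rg)+
  define L where "L = c * T + \<alpha> * J1"
  define R where "R = c * W + \<alpha> * J2"
  have R0: "0 \<le> R" unfolding R_def using \<alpha> c0 W0 J20 by (intro add_nonneg_nonneg mult_nonneg_nonneg) auto
  have expand: "tikhonov N x \<alpha> z (\<lambda>t. (1 - h) * f\<^sub>N t + h * g t) = tikhonov N x \<alpha> z f\<^sub>N + (2 * h * L + h\<^sup>2 * R)" for h
  proof -
    have s: "(\<Sum>i=1..N. ((1 - h) * f\<^sub>N (x i) + h * g (x i) - z i)\<^sup>2) = (\<Sum>i=1..N. (f\<^sub>N (x i) - z i)\<^sup>2)
        + 2 * h * T + h\<^sup>2 * W"
      unfolding T_def W_def sum_distrib_left sum.distrib[symmetric]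
      by (intro sum.cong refl) (simp add: w_def power2_eq_square algebra_simps)
    have "((\<lambda>t. (n2 t)\<^sup>2 + (2 * h) * (n2 t * (g2 t - n2 t)) + h\<^sup>2 * (g2 t - n2 t)\<^sup>2) has_integral
       J0 + (2 * h) * J1 + h\<^sup>2 * J2) {0..1}"
      by (intro has_integral_add has_integral_mult_right has)
    also have "(\<lambda>t. (n2 t)\<^sup>2 + (2 * h) * (n2 t * (g2 t - n2 t)) + h\<^sup>2 * (g2 t - n2 t)\<^sup>2) = (\<lambda>t. ((1 - h) * n2 t + h * g2 t)\<^sup>2)"
      by (auto simp: power2_eq_square algebra_simps)
    finally have i: "integral {0..1} (\<lambda>t. ((1 - h) * n2 t + h * g2 t)\<^sup>2) = J0 + (2 * h) * J1 + h\<^sup>2 * J2"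
      by (rule integral_unique)
    show ?thesis
      unfolding tik[OF W22_rep_lincomb[OF rn(1) rg(1)]] tik[OF rn(1)] s i L_def R_def c_def[symmetric] J0_def[symmetric]
      by (simp only: distrib_left mult_ac add_ac)
  qed
  have L: "0 \<le> L"
  proof (rule nonneg_of_quadratic_perturbation[OF _ R0])
    fix h :: real
    have "tikhonov N x \<alpha> z f\<^sub>N \<le> tikhonov N x \<alpha> z f\<^sub>N + (2 * h * L + h\<^sup>2 * R)"
      using le[OF spline_space_lincomb[OF fN g]] by (simp only: expand[symmetric])
    then show "0 \<le> 2 * h * L + h\<^sup>2 * R" by linarith
  qed
  define S where "S = (\<Sum>i=1..N. \<eta> i * w (x i))"
  \<comment> \<open>The projection bound gives S^2 at most Q W, and the arithmetic-geometric mean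
    inequality separates the two factors.\<close>
  have "2 * S \<le> Q + W"
  proof -
    have "(2 * S)\<^sup>2 \<le> 4 * (Q * W)" using Q(2)[OF ws] by (simp add: S_def W_def power_mult_distrib)
    also have "\<dots> \<le> (Q + W)\<^sup>2" using zero_le_power2[of "Q - W"] by (simp add: power2_eq_square algebra_simps)
    finally show ?thesis by (rule power2_le_imp_le) (use Q(1) W0 in simp)
  qed
  then have SQ: "c * (2 * S) \<le> c * (Q + W)" using c0 by (rule mult_left_mono)
  define G where "G = (\<Sum>i=1..N. (g (x i) - f (x i))\<^sup>2)"
  have e1: "(\<Sum>i=1..N. (f\<^sub>N (x i) - f (x i))\<^sup>2) = G - W + 2 * S - 2 * T"
    unfolding G_def W_def S_def T_def sum_distrib_left sum.distrib[symmetric] sum_subtractf[symmetric]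
    by (intro sum.cong refl) (simp add: z w_def power2_eq_square algebra_simps)
  have e2: "J0 = Jg - J2 - 2 * J1"
  proof -
    have "((\<lambda>t. (g2 t)\<^sup>2 - (g2 t - n2 t)\<^sup>2 - 2 * (n2 t * (g2 t - n2 t))) has_integral Jg - J2 - 2 * J1) {0..1}"
      by (intro has_integral_diff has_integral_mult_right has)
    also have "(\<lambda>t. (g2 t)\<^sup>2 - (g2 t - n2 t)\<^sup>2 - 2 * (n2 t * (g2 t - n2 t))) = (\<lambda>t. (n2 t)\<^sup>2)"
      by (auto simp: power2_eq_square algebra_simps)
    finally show ?thesis unfolding J0_def by (rule integral_unique)
  qed
  have d0: "0 \<le> \<alpha> * J2" using \<alpha> J20 by simp
  have "c * (G - W + 2 * S - 2 * T) + \<alpha> * J0 = c * G + \<alpha> * Jg - c * W + c * (2 * S) - 2 * L - \<alpha> * J2"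
    unfolding e2 L_def by (simp add: algebra_simps)
  then have "c * (\<Sum>i=1..N. (f\<^sub>N (x i) - f (x i))\<^sup>2) + \<alpha> * J0 \<le> c * Q + c * G + \<alpha> * Jg"
    using SQ L d0 unfolding e1 by (simp add: distrib_left)
  then show ?thesis by (simp add: c_def G_def J0_def Jg_def)
qed

section \<open>Arithmetic of the constants\<close>

text \<open>The triangle inequality for a weighted Euclidean norm in the plane. It separates the
  noise parts \<open>u1\<close>, \<open>u2\<close> of the two norms from their deterministic parts
  \<open>v1\<close>, \<open>v2\<close>, which contribute different terms to the final
  constants.\<close>

lemma sqrt_weighted_triangle:
  fixes a b :: real
  assumes ab: "0 \<le> a" "0 \<le> b" and n: "0 \<le> n1" "n1 \<le> u1 + v1" "0 \<le> n2" "n2 \<le> u2 + v2"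
    and X: "X \<le> a * n1\<^sup>2 + b * n2\<^sup>2"
  shows "sqrt X \<le> sqrt (a * u1\<^sup>2 + b * u2\<^sup>2) + sqrt (a * v1\<^sup>2 + b * v2\<^sup>2)"
proof -
  have sq: "(sqrt a * y)\<^sup>2 + (sqrt b * z)\<^sup>2 = a * y\<^sup>2 + b * z\<^sup>2" for y z
    using ab by (simp add: power_mult_distrib)
  have "sqrt X \<le> sqrt (a * (u1 + v1)\<^sup>2 + b * (u2 + v2)\<^sup>2)"
    using n ab by (intro real_sqrt_le_mono order.trans[OF X] add_mono mult_left_mono power_mono) auto
  also have "\<dots> = sqrt ((sqrt a * u1 + sqrt a * v1)\<^sup>2 + (sqrt b * u2 + sqrt b * v2)\<^sup>2)"
    unfolding distrib_left[symmetric] sq ..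
  also have "\<dots> \<le> sqrt ((sqrt a * u1)\<^sup>2 + (sqrt b * u2)\<^sup>2) + sqrt ((sqrt a * v1)\<^sup>2 + (sqrt b * v2)\<^sup>2)"
    by (rule real_sqrt_sum_squares_triangle_ineq)
  finally show ?thesis unfolding sq .
qed

text \<open>
  Here \<open>n1\<close> is the empirical norm of the error, \<open>n2\<close> the $L^2$ norm of its second derivative on
  $I'$, and \<open>e\<close> the square of the parameter $\epsilon$ in the Sobolev inequality.
\<close>

lemma error_bounds_arithmetic:
  fixes \<tau> d \<beta> \<gamma> \<delta> s A n1 n2 :: real
  assumes \<tau>: "0 \<le> \<tau>" and d: "0 < d" and \<gamma>: "0 < \<gamma>" and \<beta>: "0 \<le> \<beta>" and \<delta>: "0 < \<delta>" and s: "0 \<le> s" and A: "0 \<le> A"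
    and A2: "A\<^sup>2 \<le> (9/4 * \<beta> + 1) * s\<^sup>2 * d ^ 4 + \<tau> * s\<^sup>2"
    and n1: "0 \<le> n1" "n1 \<le> 2 * sqrt (\<tau> / \<delta>) + A"
    and n2: "0 \<le> n2" "n2 \<le> 2 * sqrt (1 / \<delta>) + (A / sqrt (\<tau> + d ^ 4) + s)"
    and E0: "E0 \<le> 4 / \<gamma> * n1\<^sup>2 + 2304 * d ^ 4 * n2\<^sup>2"
  shows "sqrt E0 \<le> C1' s \<gamma> \<delta> * \<tau> powr (1/2) + C2' s \<beta> \<gamma> \<delta> * d\<^sup>2"
    and "\<lbrakk>e = max (sqrt \<tau> / 2) (64 * d\<^sup>2); 0 \<le> K; E1 \<le> K * (E0 / e + e * n2\<^sup>2)\<rbrakk> \<Longrightarrow>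
      sqrt E1 \<le> C3' K s \<beta> \<gamma> \<delta> * \<tau> powr (1/4) + C4' K s \<beta> \<gamma> \<delta> * d"
proof -
  define \<alpha> where "\<alpha> = \<tau> + d ^ 4"
  have \<alpha>: "0 < \<alpha>" "d ^ 4 \<le> \<alpha>" using \<tau> d by (auto simp: \<alpha>_def add_nonneg_pos)
  define B where "B = A / sqrt \<alpha> + s"
  \<comment> \<open>Division by \<alpha> removes both \<tau> and d: the sum \<tau> + d^4 is \<alpha>
    itself, and d^4 in the \<beta> term is at most \<alpha>.\<close>
  have B2: "B\<^sup>2 \<le> (9/2 * \<beta> + 4) * s\<^sup>2"
  proof -
    have "A\<^sup>2 \<le> 9/4 * \<beta> * s\<^sup>2 * d ^ 4 + s\<^sup>2 * \<alpha>" using A2 by (simp add: \<alpha>_def algebra_simps)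
    also have "\<dots> \<le> 9/4 * \<beta> * s\<^sup>2 * \<alpha> + s\<^sup>2 * \<alpha>" using \<alpha> \<beta> by (intro add_right_mono mult_left_mono) auto
    finally have "A\<^sup>2 / \<alpha> \<le> (9/4 * \<beta> + 1) * s\<^sup>2" using \<alpha> by (simp add: divide_le_eq algebra_simps)
    moreover have "(A / sqrt \<alpha>)\<^sup>2 = A\<^sup>2 / \<alpha>" using \<alpha> by (simp add: power_divide)
    moreover have "B\<^sup>2 \<le> 2 * (A / sqrt \<alpha>)\<^sup>2 + 2 * s\<^sup>2"
    proof -
      have "(y + z)\<^sup>2 \<le> 2 * y\<^sup>2 + 2 * z\<^sup>2" for y z :: real
        using zero_le_power2[of "y - z"] by (simp add: power2_eq_square algebra_simps)
      then show ?thesis by (simp add: B_def)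
    qed
    ultimately show ?thesis by (simp add: algebra_simps)
  qed
  note tri = sqrt_weighted_triangle[OF _ _ n1 n2[folded \<alpha>_def B_def]]
  have p12: "\<tau> powr (1/2) = sqrt \<tau>" using \<tau> by (simp add: powr_half_sqrt)
  have p14: "\<tau> powr (1/4) = sqrt (sqrt \<tau>)"
  proof -
    have "sqrt (sqrt \<tau>) = (\<tau> powr (1/2)) powr (1/2)" using \<tau> by (simp add: powr_half_sqrt)
    then show ?thesis by (simp add: powr_powr)
  qed
  have pm: "z powr (-1/2) = sqrt (1 / z)" if "0 < z" for z :: real
  proof -
    have "z powr (-1/2) = inverse (z powr (1/2))" using powr_minus[of z "1/2"] by simp
    also have "\<dots> = inverse (sqrt z)" using that by (simp add: powr_half_sqrt)
    also have "\<dots> = sqrt (1 / z)" by (simp add: real_sqrt_divide inverse_eq_divide)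
    finally show ?thesis .
  qed
  have sd: "sqrt (d\<^sup>2) = d" "sqrt (d ^ 4) = d\<^sup>2" "sqrt (s\<^sup>2) = s"
    using d s real_sqrt_power[of "d\<^sup>2" 2] by (auto simp: power2_eq_square power4_eq_xxxx real_sqrt_mult)
  show "sqrt E0 \<le> C1' s \<gamma> \<delta> * \<tau> powr (1/2) + C2' s \<beta> \<gamma> \<delta> * d\<^sup>2"
  proof -
    have "sqrt E0 \<le> sqrt (4 / \<gamma> * (2 * sqrt (\<tau> / \<delta>))\<^sup>2 + 2304 * d ^ 4 * (2 * sqrt (1 / \<delta>))\<^sup>2) + sqrt (4 / \<gamma> * A\<^sup>2 + 2304 * d ^ 4 * B\<^sup>2)"
      using \<gamma> d by (intro tri E0) auto
    also have "4 / \<gamma> * (2 * sqrt (\<tau> / \<delta>))\<^sup>2 + 2304 * d ^ 4 * (2 * sqrt (1 / \<delta>))\<^sup>2 = 16 / (\<delta> * \<gamma>) * \<tau> + 9216 * (1 / \<delta>) * d ^ 4"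
      using \<tau> \<delta> \<gamma> by (simp add: power_mult_distrib field_simps)
    \<comment> \<open>Enlargement to the constants of the theorem: 64 and 32768 are the squares of
      the noise constants 8 and 4 sqrt 2 * 32 in \<open>C1'\<close> and \<open>C2'\<close>.\<close>
    also have "sqrt \<dots> \<le> sqrt (64 / (\<delta> * \<gamma>) * \<tau> + 32768 * (1 / \<delta>) * d ^ 4)"
      using \<tau> \<delta> \<gamma> d by (intro real_sqrt_le_mono add_mono mult_right_mono divide_right_mono) auto
    also have "\<dots> \<le> sqrt (64 / (\<delta> * \<gamma>) * \<tau>) + sqrt (32768 * (1 / \<delta>) * d ^ 4)"
      using \<tau> \<delta> \<gamma> d by (intro sqrt_add_le_add_sqrt) auto
    also have "\<dots> = 8 / sqrt (\<delta> * \<gamma>) * sqrt \<tau> + 4 * sqrt 2 * 32 * sqrt (1 / \<delta>) * d\<^sup>2"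
    proof -
      have "sqrt 64 = 8" by (rule real_sqrt_unique) auto
      moreover have "sqrt 32768 = 4 * sqrt 2 * 32" by (rule real_sqrt_unique) (auto simp: power_mult_distrib)
      ultimately show ?thesis by (simp only: real_sqrt_mult real_sqrt_divide sd)
    qed
    also have "4 / \<gamma> * A\<^sup>2 + 2304 * d ^ 4 * B\<^sup>2 \<le> 8 / \<gamma> * s\<^sup>2 * \<tau> + s\<^sup>2 * ((18 * \<beta> + 8) / \<gamma> + 72 * 32\<^sup>2 * \<beta> + 64 * 32\<^sup>2) * d ^ 4"
    proof -
      have "4 / \<gamma> * A\<^sup>2 \<le> 4 / \<gamma> * ((9/4 * \<beta> + 1) * s\<^sup>2 * d ^ 4 + \<tau> * s\<^sup>2)"
        using \<gamma> A2 by (intro mult_left_mono) auto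
      also have "\<dots> \<le> 8 / \<gamma> * ((9/4 * \<beta> + 1) * s\<^sup>2 * d ^ 4 + \<tau> * s\<^sup>2)"
        using \<gamma> \<beta> \<tau> by (intro mult_right_mono divide_right_mono) auto
      also have "\<dots> = 8 / \<gamma> * s\<^sup>2 * \<tau> + (18 * \<beta> + 8) / \<gamma> * (s\<^sup>2 * d ^ 4)" using \<gamma> by (simp add: field_simps)
      finally have 1: "4 / \<gamma> * A\<^sup>2 \<le> 8 / \<gamma> * s\<^sup>2 * \<tau> + (18 * \<beta> + 8) / \<gamma> * (s\<^sup>2 * d ^ 4)" .
      have "2304 * d ^ 4 * B\<^sup>2 \<le> 2304 * d ^ 4 * ((9/2 * \<beta> + 4) * s\<^sup>2)" using B2 by (intro mult_left_mono) auto
      also have "\<dots> = (10368 * \<beta> + 9216) * (s\<^sup>2 * d ^ 4)" by (simp add: algebra_simps)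
      also have "\<dots> \<le> (72 * 32\<^sup>2 * \<beta> + 64 * 32\<^sup>2) * (s\<^sup>2 * d ^ 4)" using \<beta> by (intro mult_right_mono) auto
      finally show ?thesis using 1 by (simp add: algebra_simps)
    qed
    also have "sqrt (8 / \<gamma> * s\<^sup>2 * \<tau> + s\<^sup>2 * ((18 * \<beta> + 8) / \<gamma> + 72 * 32\<^sup>2 * \<beta> + 64 * 32\<^sup>2) * d ^ 4)
       \<le> sqrt (8 / \<gamma> * s\<^sup>2 * \<tau>) + sqrt (s\<^sup>2 * ((18 * \<beta> + 8) / \<gamma> + 72 * 32\<^sup>2 * \<beta> + 64 * 32\<^sup>2) * d ^ 4)"
      using \<gamma> \<beta> \<tau> by (intro sqrt_add_le_add_sqrt) auto
    also have "\<dots> = 2 * sqrt 2 * sqrt (1 / \<gamma>) * s * sqrt \<tau> + s * sqrt ((18 * \<beta> + 8) / \<gamma> + 72 * 32\<^sup>2 * \<beta> + 64 * 32\<^sup>2) * d\<^sup>2"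
    proof -
      have "sqrt (8 * (1 / \<gamma>)) = 2 * sqrt 2 * sqrt (1 / \<gamma>)"
      proof -
        have "sqrt 8 = 2 * sqrt 2" by (rule real_sqrt_unique) (auto simp: power_mult_distrib)
        then show ?thesis by (simp only: real_sqrt_mult)
      qed
      then show ?thesis by (simp only: real_sqrt_mult sd mult_1_right times_divide_eq_right)
    qed
    finally have "sqrt E0 \<le> 8 / sqrt (\<delta> * \<gamma>) * sqrt \<tau> + 4 * sqrt 2 * 32 * sqrt (1 / \<delta>) * d\<^sup>2 +
      (2 * sqrt 2 * sqrt (1 / \<gamma>) * s * sqrt \<tau> + s * sqrt ((18 * \<beta> + 8) / \<gamma> + 72 * 32\<^sup>2 * \<beta> + 64 * 32\<^sup>2) * d\<^sup>2)"
      by simp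
    also have "\<dots> = C1' s \<gamma> \<delta> * sqrt \<tau> + C2' s \<beta> \<gamma> \<delta> * d\<^sup>2"
      unfolding C1'_def C2'_def Kstar_def pm[OF \<gamma>] pm[OF \<delta>] by (simp only: distrib_left distrib_right add_ac mult_ac)
    finally show ?thesis unfolding p12 .
  qed
  show "sqrt E1 \<le> C3' K s \<beta> \<gamma> \<delta> * \<tau> powr (1/4) + C4' K s \<beta> \<gamma> \<delta> * d"
    if e: "e = max (sqrt \<tau> / 2) (64 * d\<^sup>2)" and K: "0 \<le> K" and E1: "E1 \<le> K * (E0 / e + e * n2\<^sup>2)"
  proof -
    define r where "r = sqrt \<tau>"
    have r: "0 \<le> r" "\<tau> = r * r" using \<tau> by (auto simp: r_def)
    have "0 < d\<^sup>2" using d by simp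
    \<comment> \<open>As a maximum, \<open>e\<close> dominates each entry, which bounds the
      quotients \<tau>/e and d^4/e, and it is at most their sum, which bounds the term with
      \<open>e\<close> itself.\<close>
    then have e0: "0 < e" "64 * d\<^sup>2 \<le> e" "r / 2 \<le> e" "e \<le> r / 2 + 64 * d\<^sup>2"
      using r(1) unfolding e r_def[symmetric] by linarith+
    have te: "\<tau> / e \<le> 2 * r"
    proof -
      have "r * r \<le> 2 * r * e" using e0(3) mult_left_mono[OF e0(3) r(1)] by (simp add: mult_ac)
      then show ?thesis using e0 by (simp add: divide_le_eq r)
    qed
    have de: "d ^ 4 / e \<le> d\<^sup>2 / 64"
    proof -
      have "64 * d ^ 4 \<le> d\<^sup>2 * e" using mult_left_mono[OF e0(2), of "d\<^sup>2"] by (simp add: power4_eq_xxxx power2_eq_square mult_ac)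
      then show ?thesis using e0 by (simp add: divide_le_eq)
    qed
    define a where "a = 4 / \<gamma> / e"
    define b where "b = 2304 * (d ^ 4 / e) + e"
    have ab0: "0 \<le> a" "0 \<le> b" using \<gamma> e0 by (auto simp: a_def b_def)
    \<comment> \<open>The 100 is 2304/64 = 36 from the sampling inequality plus 64 from
      \<open>e\<close>.\<close>
    have b: "b \<le> r / 2 + 100 * d\<^sup>2" using de e0 by (simp add: b_def)
    have "E0 / e + e * n2\<^sup>2 \<le> (4 / \<gamma> * n1\<^sup>2 + 2304 * d ^ 4 * n2\<^sup>2) / e + e * n2\<^sup>2"
      using E0 e0 by (intro add_right_mono divide_right_mono) auto
    also have "\<dots> = a * n1\<^sup>2 + b * n2\<^sup>2" by (simp add: a_def b_def add_divide_distrib distrib_right)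
    finally have X: "sqrt (E0 / e + e * n2\<^sup>2) \<le> sqrt (a * (2 * sqrt (\<tau> / \<delta>))\<^sup>2 + b * (2 * sqrt (1 / \<delta>))\<^sup>2) + sqrt (a * A\<^sup>2 + b * B\<^sup>2)"
      by (intro tri ab0)
    have "a * (2 * sqrt (\<tau> / \<delta>))\<^sup>2 + b * (2 * sqrt (1 / \<delta>))\<^sup>2 = 16 / (\<gamma> * \<delta>) * (\<tau> / e) + 4 / \<delta> * b"
      using \<tau> \<delta> \<gamma> e0 by (simp add: a_def power_mult_distrib field_simps)
    also have "\<dots> \<le> 16 / (\<gamma> * \<delta>) * (2 * r) + 4 / \<delta> * (r / 2 + 100 * d\<^sup>2)"
      using te b \<gamma> \<delta> by (intro add_mono mult_left_mono) auto
    also have "\<dots> = (32 / \<gamma> + 2) / \<delta> * r + 400 / \<delta> * d\<^sup>2" using \<gamma> \<delta> by (simp add: field_simps)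
    \<comment> \<open>Again an enlargement to the stated constants; 512 = 4^2 * 32 matches the noise
      term of \<open>C4'\<close>.\<close>
    also have "\<dots> \<le> (64 / \<gamma> + 2) / \<delta> * r + 512 / \<delta> * d\<^sup>2"
      using \<gamma> \<delta> r by (intro add_mono mult_right_mono divide_right_mono) auto
    finally have "sqrt (a * (2 * sqrt (\<tau> / \<delta>))\<^sup>2 + b * (2 * sqrt (1 / \<delta>))\<^sup>2) \<le> sqrt ((64 / \<gamma> + 2) / \<delta> * r + 512 / \<delta> * d\<^sup>2)"
      by (rule real_sqrt_le_mono)
    also have "\<dots> \<le> sqrt ((64 / \<gamma> + 2) / \<delta> * r) + sqrt (512 / \<delta> * d\<^sup>2)"
      using \<gamma> \<delta> r by (intro sqrt_add_le_add_sqrt) auto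
    also have "\<dots> = sqrt (1 / \<delta>) * sqrt (64 / \<gamma> + 2) * sqrt r + 4 * sqrt (1 / \<delta>) * sqrt 32 * d"
    proof -
      have "sqrt 512 = 4 * sqrt 32" using real_sqrt_mult[of 16 32] by simp
      then have "sqrt (512 * (1 / \<delta>) * d\<^sup>2) = 4 * sqrt (1 / \<delta>) * sqrt 32 * d"
        by (simp only: real_sqrt_mult sd mult_ac)
      moreover have "sqrt ((64 / \<gamma> + 2) * (1 / \<delta>) * r) = sqrt (1 / \<delta>) * sqrt (64 / \<gamma> + 2) * sqrt r"
        by (simp only: real_sqrt_mult mult_ac)
      ultimately show ?thesis by simp
    qed
    finally have N: "sqrt (a * (2 * sqrt (\<tau> / \<delta>))\<^sup>2 + b * (2 * sqrt (1 / \<delta>))\<^sup>2) \<le>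
       sqrt (1 / \<delta>) * sqrt (64 / \<gamma> + 2) * sqrt r + 4 * sqrt (1 / \<delta>) * sqrt 32 * d" .
    have "a * A\<^sup>2 \<le> a * ((9/4 * \<beta> + 1) * s\<^sup>2 * d ^ 4 + \<tau> * s\<^sup>2)" using ab0 A2 by (intro mult_left_mono) auto
    also have "\<dots> = 4 / \<gamma> * ((9/4 * \<beta> + 1) * s\<^sup>2) * (d ^ 4 / e) + 4 / \<gamma> * s\<^sup>2 * (\<tau> / e)"
      using e0 \<gamma> by (simp add: a_def field_simps)
    also have "\<dots> \<le> 4 / \<gamma> * ((9/4 * \<beta> + 1) * s\<^sup>2) * (d\<^sup>2 / 64) + 4 / \<gamma> * s\<^sup>2 * (2 * r)"
      using te de \<gamma> \<beta> by (intro add_mono mult_left_mono) auto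
    also have "\<dots> = (9 * \<beta> + 4) / (2 * 32 * \<gamma>) * (s\<^sup>2 * d\<^sup>2) + 8 / \<gamma> * (s\<^sup>2 * r)" using \<gamma> by (simp add: field_simps)
    finally have 1: "a * A\<^sup>2 \<le> (9 * \<beta> + 4) / (2 * 32 * \<gamma>) * (s\<^sup>2 * d\<^sup>2) + 8 / \<gamma> * (s\<^sup>2 * r)" .
    have "b * B\<^sup>2 \<le> (r / 2 + 100 * d\<^sup>2) * ((9/2 * \<beta> + 4) * s\<^sup>2)" using b B2 ab0 r by (intro mult_mono) auto
    also have "\<dots> = (9/4 * \<beta> + 2) * (s\<^sup>2 * r) + (450 * \<beta> + 400) * (s\<^sup>2 * d\<^sup>2)" by (simp add: algebra_simps)
    also have "\<dots> \<le> (9/2 * \<beta> + 4) * (s\<^sup>2 * r) + (36 * 32 * \<beta> + 32 * 32) * (s\<^sup>2 * d\<^sup>2)"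
      using \<beta> r by (intro add_mono mult_right_mono) auto
    finally have "a * A\<^sup>2 + b * B\<^sup>2 \<le> s\<^sup>2 * (8 / \<gamma> + 9/2 * \<beta> + 4) * r + s\<^sup>2 * ((9 * \<beta> + 4) / (2 * 32 * \<gamma>) + 36 * 32 * \<beta> + 32 * 32) * d\<^sup>2"
      using 1 by (simp add: distrib_left distrib_right mult_ac)
    then have "sqrt (a * A\<^sup>2 + b * B\<^sup>2) \<le> sqrt (s\<^sup>2 * (8 / \<gamma> + 9/2 * \<beta> + 4) * r + s\<^sup>2 * ((9 * \<beta> + 4) / (2 * 32 * \<gamma>) + 36 * 32 * \<beta> + 32 * 32) * d\<^sup>2)"
      by (rule real_sqrt_le_mono)
    also have "\<dots> \<le> sqrt (s\<^sup>2 * (8 / \<gamma> + 9/2 * \<beta> + 4) * r) + sqrt (s\<^sup>2 * ((9 * \<beta> + 4) / (2 * 32 * \<gamma>) + 36 * 32 * \<beta> + 32 * 32) * d\<^sup>2)"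
      using \<gamma> \<beta> r by (intro sqrt_add_le_add_sqrt) auto
    also have "\<dots> = s * sqrt (8 / \<gamma> + 9/2 * \<beta> + 4) * sqrt r + s * sqrt ((9 * \<beta> + 4) / (2 * 32 * \<gamma>) + 36 * 32 * \<beta> + 32 * 32) * d"
      by (simp only: real_sqrt_mult sd)
    finally have D: "sqrt (a * A\<^sup>2 + b * B\<^sup>2) \<le> s * sqrt (8 / \<gamma> + 9/2 * \<beta> + 4) * sqrt r + s * sqrt ((9 * \<beta> + 4) / (2 * 32 * \<gamma>) + 36 * 32 * \<beta> + 32 * 32) * d" .
    have "sqrt E1 \<le> sqrt K * sqrt (E0 / e + e * n2\<^sup>2)"
      using real_sqrt_le_mono[OF E1] by (simp add: real_sqrt_mult)
    also have "\<dots> \<le> sqrt K * ((sqrt (1 / \<delta>) * sqrt (64 / \<gamma> + 2) * sqrt r + 4 * sqrt (1 / \<delta>) * sqrt 32 * d) +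
       (s * sqrt (8 / \<gamma> + 9/2 * \<beta> + 4) * sqrt r + s * sqrt ((9 * \<beta> + 4) / (2 * 32 * \<gamma>) + 36 * 32 * \<beta> + 32 * 32) * d))"
      using X N D K by (intro mult_left_mono) auto
    also have "\<dots> = C3' K s \<beta> \<gamma> \<delta> * sqrt r + C4' K s \<beta> \<gamma> \<delta> * d"
      unfolding C3'_def C4'_def Kstar_def pm[OF \<delta>] by (simp only: distrib_left distrib_right add_ac mult_ac)
    finally show ?thesis unfolding p14 r_def .
  qed
qed

lemma L2_triangle_diff:
  fixes u v :: "real \<Rightarrow> real"
  assumes u: "(\<lambda>t. (u t)\<^sup>2) integrable_on S" and uv: "(\<lambda>t. u t * v t) integrable_on S"
    and v: "(\<lambda>t. (v t)\<^sup>2) integrable_on S"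
  shows "sqrt (integral S (\<lambda>t. (u t - v t)\<^sup>2)) \<le> sqrt (integral S (\<lambda>t. (u t)\<^sup>2)) + sqrt (integral S (\<lambda>t. (v t)\<^sup>2))"
proof -
  define A where "A = integral S (\<lambda>t. (u t)\<^sup>2)"
  define B where "B = integral S (\<lambda>t. u t * v t)"
  define C where "C = integral S (\<lambda>t. (v t)\<^sup>2)"
  have AC: "0 \<le> A" "0 \<le> C" unfolding A_def C_def by (rule Henstock_Kurzweil_Integration.integral_nonneg; use u v in auto)+
  have "((\<lambda>t. (u t)\<^sup>2 - 2 * (u t * v t) + (v t)\<^sup>2) has_integral (A - 2 * B + C)) S"
    unfolding A_def B_def C_def
    by (intro has_integral_add has_integral_diff has_integral_mult_right integrable_integral u uv v)
  also have "(\<lambda>t. (u t)\<^sup>2 - 2 * (u t * v t) + (v t)\<^sup>2) = (\<lambda>t. (u t - v t)\<^sup>2)"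
    by (auto simp: power2_eq_square algebra_simps)
  finally have i: "integral S (\<lambda>t. (u t - v t)\<^sup>2) = A - 2 * B + C" by (rule integral_unique)
  have "B\<^sup>2 \<le> A * C" using Cauchy_Schwarz_integral_on[OF u uv v] by (simp add: A_def B_def C_def)
  then have "\<bar>B\<bar> \<le> sqrt A * sqrt C" using abs_le_sqrtI[of B "A * C"] by (simp add: real_sqrt_mult)
  then have "A - 2 * B + C \<le> (sqrt A + sqrt C)\<^sup>2" using AC by (simp add: power2_sum)
  then have "sqrt (A - 2 * B + C) \<le> sqrt A + sqrt C" using AC by (intro real_le_lsqrt) auto
  then show ?thesis unfolding i A_def[symmetric] C_def[symmetric] .
qed

text \<open>Testing with the identity function, whose derivative has positive norm, rules out a
  negative constant. This is needed to take square roots monotonically.\<close>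

lemma sobolev_constant_nonneg:
  assumes L: "0 < L" and e: "0 < \<epsilon>\<^sub>0" and K: "sobolev_constant K \<epsilon>\<^sub>0 L"
  shows "0 \<le> K"
proof (rule ccontr)
  assume neg: "\<not> 0 \<le> K"
  have rep: "W22_rep 0 L (\<lambda>t. t) (\<lambda>_. 1) (\<lambda>_. 0)"
    by (rule W22_rep_C2) (auto intro!: derivative_eq_intros)
  have "(L2norm 0 L (deriv (\<lambda>t. t)))\<^sup>2 \<le> K * ((L2norm 0 L (\<lambda>t. t))\<^sup>2 / \<epsilon>\<^sub>0\<^sup>2 + \<epsilon>\<^sub>0\<^sup>2 * (L2norm 0 L (weak_deriv 2 0 L (\<lambda>t. t)))\<^sup>2)"
  proof -
    have "\<forall>u\<in>W22 0 L. \<forall>\<epsilon>\<in>{0<..\<epsilon>\<^sub>0}. (L2norm 0 L (deriv u))\<^sup>2 \<le>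
        K * ((L2norm 0 L u)\<^sup>2 / \<epsilon>\<^sup>2 + \<epsilon>\<^sup>2 * (L2norm 0 L (weak_deriv 2 0 L u))\<^sup>2)"
      using spec[OF spec[OF K[unfolded sobolev_constant_def], of 0], of L] by (rule mp) simp
    from bspec[OF bspec[OF this W22_rep_in_W22[OF L rep]], of \<epsilon>\<^sub>0] e show ?thesis by simp
  qed
  also have "\<dots> \<le> 0" using neg by (intro mult_nonpos_nonneg) auto
  finally show False using L unfolding W22_rep_L2norm_deriv[OF rep] by simp
qed

section \<open>The estimates for a fixed outcome\<close>

text \<open>The random part of the argument enters only through \<open>cells\<close>,
  \<open>u\<close> and the bounds on \<open>Q\<close>, which hold outside the exceptional set. The
  empirical norm and the second derivative of the error are bounded first; sampling and Sobolev
  inequalities then do the rest.\<close>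

lemma deterministic_error_bound:
  fixes M N p q :: nat and d \<sigma> \<alpha> \<beta> \<gamma> \<delta> K\<^sub>\<sigma> :: real and f f\<^sub>N :: "real \<Rightarrow> real" and x \<eta> z :: "nat \<Rightarrow> real"
  assumes M: "3 \<le> M" "M \<le> N" and d: "d = 1 / real M" and \<sigma>: "0 \<le> \<sigma>" and \<beta>: "0 \<le> \<beta>" and \<gamma>: "0 < \<gamma>" and \<delta>: "0 < \<delta>"
    and pq: "p + 12 \<le> q" "q \<le> M"
    and rep: "W22_rep 0 1 f f1 w"
    and x: "\<And>i. i \<in> {1..N} \<Longrightarrow> x i \<in> {0..1}"
    and z: "\<And>i. z i = f (x i) + \<eta> i"
    and \<alpha>: "\<alpha> = real M * \<sigma>\<^sup>2 / real N + d ^ 4"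
    and min: "is_arg_min (tikhonov N x \<alpha> z) (\<lambda>g. g \<in> spline_space M) f\<^sub>N"
    and K: "sobolev_constant K\<^sub>\<sigma> (max (sqrt \<sigma>) ((real q - real p) * d)) ((real q - real p) * d)"
    and cells: "\<And>j. j < q - p \<Longrightarrow> real N * \<gamma> * d / 2 \<le>
        real (card {i\<in>{1..N}. x i \<in> {real p * d + real j * d<..<real p * d + real (Suc j) * d}})"
    and s: "s = sqrt (sq_integral 0 1 w)"
    and u: "(\<Sum>i=1..N. (quasi_interpolant M f (x i) - f (x i))\<^sup>2) \<le> real N * (9/4 * \<beta> * s\<^sup>2 * d ^ 4)"
    and Q: "0 \<le> Q" "Q \<le> 4 * real M * \<sigma>\<^sup>2 / \<delta>"
      "\<And>v. v \<in> spline_space M \<Longrightarrow> (\<Sum>i=1..N. \<eta> i * v (x i))\<^sup>2 \<le> Q * (\<Sum>i=1..N. (v (x i))\<^sup>2)"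
  defines "e\<^sub>N \<equiv> \<lambda>t. f\<^sub>N t - f t" and "\<tau> \<equiv> real M * \<sigma>\<^sup>2 / real N"
  shows "L2norm (real p * d) (real q * d) e\<^sub>N \<le> C1' s \<gamma> \<delta> * \<tau> powr (1/2) + C2' s \<beta> \<gamma> \<delta> / (real M)\<^sup>2"
    and "L2norm (real p * d) (real q * d) (deriv e\<^sub>N) \<le> C3' K\<^sub>\<sigma> s \<beta> \<gamma> \<delta> * \<tau> powr (1/4) + C4' K\<^sub>\<sigma> s \<beta> \<gamma> \<delta> / real M"
proof -
  have M0: "0 < M" and N0: "0 < N" using M by auto
  have d0: "0 < d" using M0 by (simp add: d)
  have \<tau>: "0 \<le> \<tau>" by (simp add: \<tau>_def)
  have \<alpha>': "\<alpha> = \<tau> + d ^ 4" by (simp add: \<alpha> \<tau>_def)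
  have \<alpha>0: "0 < \<alpha>" using \<tau> d0 by (simp add: \<alpha>' add_nonneg_pos)
  note F = W22_repD[OF rep]
  have w0: "0 \<le> sq_integral 0 1 w"
    by (rule Henstock_Kurzweil_Integration.integral_nonneg) (use F in auto)
  have s2: "s\<^sup>2 = sq_integral 0 1 w" and s0: "0 \<le> s" using w0 by (auto simp: s)
  define g where "g = quasi_interpolant M f"
  define g2 where "g2 = quasi_interpolant2 M f"
  have rg: "W22_rep 0 1 g (quasi_interpolant1 M f) g2" and g2c: "continuous_on {0..1} g2"
    unfolding g_def g2_def
    by (intro W22_rep_C2 has_field_derivative_at_within[OF quasi_interpolant_has_derivative(1)[OF M0]]
        has_field_derivative_at_within[OF quasi_interpolant_has_derivative(2)[OF M0]]
        quasi_interpolant_has_derivative(3)[OF M0])+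
  have gs: "g \<in> spline_space M" unfolding g_def by (rule quasi_interpolant_in_spline_space[OF M0])
  have "f\<^sub>N \<in> spline_space M" using min by (simp add: is_arg_min_def)
  then obtain v1 v2 where rv: "W22_rep 0 1 f\<^sub>N v1 v2" "continuous_on {0..1} v2"
    by (rule spline_space_obtain_rep)
  define S where "S = 1 / real N * (\<Sum>i=1..N. (e\<^sub>N (x i))\<^sup>2)"
  define V where "V = sq_integral 0 1 v2"
  have S0: "0 \<le> S" by (simp add: S_def sum_nonneg)
  have V0: "0 \<le> V" unfolding V_def
    by (rule Henstock_Kurzweil_Integration.integral_nonneg) (use W22_repD(8)[OF rv(1)] in auto)
  define A where "A = sqrt ((9/4 * \<beta> + 1) * s\<^sup>2 * d ^ 4 + \<tau> * s\<^sup>2)"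
  have A2: "A\<^sup>2 = (9/4 * \<beta> + 1) * s\<^sup>2 * d ^ 4 + \<tau> * s\<^sup>2" and A0: "0 \<le> A" using \<beta> \<tau> by (auto simp: A_def)
  have "S + \<alpha> * V \<le> Q / real N + 1 / real N * (\<Sum>i=1..N. (g (x i) - f (x i))\<^sup>2) + \<alpha> * sq_integral 0 1 g2"
    unfolding S_def V_def e\<^sub>N_def by (rule tikhonov_minimizer_bound[OF \<alpha>0 min z gs rv rg g2c Q(1,3)])
  also have "\<dots> \<le> 4 * \<tau> / \<delta> + 9/4 * \<beta> * s\<^sup>2 * d ^ 4 + \<alpha> * s\<^sup>2"
  proof (intro add_mono mult_left_mono)
    have "Q / real N \<le> (4 * real M * \<sigma>\<^sup>2 / \<delta>) / real N" using Q(2) by (intro divide_right_mono) auto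
    then show "Q / real N \<le> 4 * \<tau> / \<delta>" by (simp add: \<tau>_def mult_ac)
    show "1 / real N * (\<Sum>i=1..N. (g (x i) - f (x i))\<^sup>2) \<le> 9/4 * \<beta> * s\<^sup>2 * d ^ 4"
      using u N0 by (simp add: g_def divide_le_eq mult_ac)
    show "sq_integral 0 1 g2 \<le> s\<^sup>2"
      unfolding s2 g2_def by (rule quasi_interpolant_bounds(1)[OF M0 rep])
  qed (use \<alpha>0 in auto)
  also have "\<dots> = 4 * \<tau> / \<delta> + A\<^sup>2" unfolding A2 \<alpha>' by (simp add: algebra_simps)
  finally have SV: "S + \<alpha> * V \<le> 4 * \<tau> / \<delta> + A\<^sup>2" .
  have sq: "sqrt (4 * \<tau> / \<delta> + A\<^sup>2) \<le> 2 * sqrt (\<tau> / \<delta>) + A"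
  proof -
    have "sqrt (4 * \<tau> / \<delta> + A\<^sup>2) \<le> sqrt (4 * (\<tau> / \<delta>)) + sqrt (A\<^sup>2)"
      using sqrt_add_le_add_sqrt[of "4 * (\<tau> / \<delta>)" "A\<^sup>2"] \<tau> \<delta> by simp
    also have "\<dots> = 2 * sqrt (\<tau> / \<delta>) + A" using A0 by (simp only: real_sqrt_mult real_sqrt_abs) simp
    finally show ?thesis .
  qed
  have n1: "sqrt S \<le> 2 * sqrt (\<tau> / \<delta>) + A"
    using SV V0 \<alpha>0 by (intro order.trans[OF real_sqrt_le_mono sq]) (smt (verit) mult_nonneg_nonneg)
  have V: "sqrt V \<le> 2 * sqrt (1 / \<delta>) + A / sqrt \<alpha>"
  proof -
    have "sqrt \<alpha> * sqrt V \<le> 2 * sqrt (\<tau> / \<delta>) + A"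
      unfolding real_sqrt_mult[symmetric] using SV S0 by (intro order.trans[OF real_sqrt_le_mono sq]) linarith
    \<comment> \<open>As \<alpha> dominates \<tau>, division by sqrt \<alpha> leaves a noise
      contribution to the second derivative that depends on \<delta> alone.\<close>
    also have "\<dots> \<le> 2 * (sqrt \<alpha> * sqrt (1 / \<delta>)) + A"
      unfolding real_sqrt_mult[symmetric] using \<delta> d0 by (intro add_right_mono mult_left_mono real_sqrt_le_mono) (auto simp: \<alpha>' divide_right_mono)
    finally have "sqrt \<alpha> * sqrt V \<le> sqrt \<alpha> * (2 * sqrt (1 / \<delta>) + A / sqrt \<alpha>)"
      using \<alpha>0 by (simp add: distrib_left)
    then show ?thesis by (rule mult_left_le_imp_le) (use \<alpha>0 in simp)
  qed
  define a where "a = real p * d"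
  define b where "b = real q * d"
  have pq': "real p + 12 \<le> real q" "real q \<le> real M" using pq by linarith+
  have sub: "0 \<le> a" "b \<le> 1" using d0 M0 pq' by (auto simp: a_def b_def d)
  have ba: "b - a = (real q - real p) * d" by (simp add: a_def b_def algebra_simps)
  have len: "12 * d \<le> b - a" unfolding ba using pq' d0 by (intro mult_right_mono) auto
  then have ab: "a < b" using d0 by simp
  have b: "b = a + real (q - p) * d" using pq by (simp add: a_def b_def of_nat_diff algebra_simps)
  have re: "W22_rep a b e\<^sub>N (\<lambda>t. v1 t - f1 t) (\<lambda>t. v2 t - w t)"
    unfolding e\<^sub>N_def by (intro W22_rep_diff W22_rep_subinterval[OF rv(1)] W22_rep_subinterval[OF rep] sub)
  define E0 where "E0 = sq_integral a b e\<^sub>N"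
  define E2 where "E2 = integral {a..b} (\<lambda>t. (v2 t - w t)\<^sup>2)"
  have E20: "0 \<le> E2" unfolding E2_def
    by (rule Henstock_Kurzweil_Integration.integral_nonneg) (use W22_repD(8)[OF re] in auto)
  have n2: "sqrt E2 \<le> 2 * sqrt (1 / \<delta>) + (A / sqrt (\<tau> + d ^ 4) + s)"
  proof -
    \<comment> \<open>The penalty controls the second derivative on the whole unit interval, so the
      error on \<open>I'\<close> is enlarged to that interval.\<close>
    have r01: "W22_rep 0 1 (\<lambda>t. f\<^sub>N t - f t) (\<lambda>t. v1 t - f1 t) (\<lambda>t. v2 t - w t)"
      by (rule W22_rep_diff[OF rv(1) rep])
    have "E2 \<le> integral {0..1} (\<lambda>t. (v2 t - w t)\<^sup>2)"
      unfolding E2_def using sub by (intro integral_subset_le W22_repD(8)[OF re] W22_repD(8)[OF r01]) auto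
    then have "sqrt E2 \<le> sqrt (integral {0..1} (\<lambda>t. (v2 t - w t)\<^sup>2))" by (rule real_sqrt_le_mono)
    also have "\<dots> \<le> sqrt V + s"
      unfolding V_def s
    proof (rule L2_triangle_diff)
      have "(\<lambda>t. w t * v2 t) integrable_on {0..1}"
        using absolutely_integrable_mult_continuous[OF F(5) rv(2)] by (simp add: absolutely_integrable_on_def)
      then show "(\<lambda>t. v2 t * w t) integrable_on {0..1}" by (simp add: mult.commute)
    qed (rule W22_repD(8)[OF rv(1)] F(8))+
    finally show ?thesis using V by (simp add: \<alpha>')
  qed
  have E0: "E0 \<le> 4 / \<gamma> * (sqrt S)\<^sup>2 + 2304 * d ^ 4 * (sqrt E2)\<^sup>2"
  proof -
    have "E0 \<le> 2 * d / (real N * \<gamma> * d / 2) * (\<Sum>i=1..N. (e\<^sub>N (x i))\<^sup>2) + 2304 * d ^ 4 * E2"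
      unfolding E0_def E2_def b
    proof (rule W22_rep_sampling_inequality[OF d0])
      show "12 \<le> q - p" using pq by simp
      show "0 < real N * \<gamma> * d / 2" using N0 \<gamma> d0 by simp
      show "W22_rep a (a + real (q - p) * d) e\<^sub>N (\<lambda>t. v1 t - f1 t) (\<lambda>t. v2 t - w t)"
        using re unfolding b .
      show "real N * \<gamma> * d / 2 \<le> real (card {i \<in> {1..N}. x i \<in> {a + real j * d<..<a + real (Suc j) * d}})"
        if "j < q - p" for j using cells[OF that] unfolding a_def .
    qed simp
    also have "2 * d / (real N * \<gamma> * d / 2) * (\<Sum>i=1..N. (e\<^sub>N (x i))\<^sup>2) = 4 / \<gamma> * S"
      using d0 N0 \<gamma> by (simp add: S_def field_simps)
    finally show ?thesis using S0 E20 by simp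
  qed
  note ar = error_bounds_arithmetic[OF \<tau> d0 \<gamma> \<beta> \<delta> s0 A0 eq_refl[OF A2] _ n1 _ n2 E0]
  have L2: "L2norm X Y h = sqrt ((L2norm X Y h)\<^sup>2)" for X Y h
    unfolding L2norm_def by (simp add: set_lebesgue_integral_def)
  have dM: "d\<^sup>2 = 1 / (real M)\<^sup>2" by (simp add: d power_divide)
  have eL: "(L2norm a b e\<^sub>N)\<^sup>2 = E0"
    unfolding E0_def by (intro square_integrable_power2 square_integrable_continuous W22_repD(2)[OF re])
  have "L2norm a b e\<^sub>N = sqrt E0" by (subst L2) (simp add: eL)
  then show "L2norm (real p * d) (real q * d) e\<^sub>N \<le> C1' s \<gamma> \<delta> * \<tau> powr (1/2) + C2' s \<beta> \<gamma> \<delta> / (real M)\<^sup>2"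
    using ar(1) S0 E20 by (simp add: dM a_def b_def)
  \<comment> \<open>Up to constant factors this balances E0 / e against e times the squared norm of
    the second derivative: \<open>E0\<close> is of order \<tau> + d^4 and that norm of order
    1.\<close>
  define e where "e = max (sqrt \<tau> / 2) (64 * d\<^sup>2)"
  define E1 where "E1 = (L2norm a b (deriv e\<^sub>N))\<^sup>2"
  have e0: "0 < e" using d0 by (simp add: e_def less_max_iff_disj)
  \<comment> \<open>Both entries must be admissible: N at least M gives sqrt \<tau> at most
    \<sigma>, and sqrt (64 d^2) = 8 d is at most the length of \<open>I'\<close>, which has twelve
    cells or more.\<close>
  have \<epsilon>: "sqrt e \<in> {0<..max (sqrt \<sigma>) ((real q - real p) * d)}"
  proof -
    have "\<tau> \<le> \<sigma>\<^sup>2"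
    proof -
      have "real M * \<sigma>\<^sup>2 \<le> real N * \<sigma>\<^sup>2" using M by (intro mult_right_mono) auto
      then show ?thesis using N0 by (simp add: \<tau>_def divide_le_eq mult.commute)
    qed
    then have "sqrt \<tau> \<le> \<sigma>" using \<sigma> by (intro real_le_lsqrt) auto
    then have "sqrt (sqrt \<tau> / 2) \<le> sqrt \<sigma>" using \<sigma> \<tau> by (intro real_sqrt_le_mono) (smt (verit) field_sum_of_halves real_sqrt_ge_zero)
    moreover have "sqrt (64 * d\<^sup>2) \<le> (real q - real p) * d"
    proof -
      have "sqrt (64 * d\<^sup>2) = 8 * d" using d0 by (intro real_sqrt_unique) (auto simp: power_mult_distrib)
      then show ?thesis using len d0 unfolding ba by simp
    qed
    moreover have "sqrt e = max (sqrt (sqrt \<tau> / 2)) (sqrt (64 * d\<^sup>2))"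
      unfolding e_def by (simp add: max_def)
    ultimately have "sqrt e \<le> max (sqrt \<sigma>) ((real q - real p) * d)" by (metis max.mono)
    then show ?thesis using e0 by simp
  qed
  have "e\<^sub>N \<in> W22 a b" by (rule W22_rep_in_W22[OF ab re])
  then have "E1 \<le> K\<^sub>\<sigma> * ((L2norm a b e\<^sub>N)\<^sup>2 / (sqrt e)\<^sup>2 + (sqrt e)\<^sup>2 * (L2norm a b (weak_deriv 2 a b e\<^sub>N))\<^sup>2)"
    using K \<epsilon> ba unfolding sobolev_constant_def E1_def by blast
  then have "E1 \<le> K\<^sub>\<sigma> * (E0 / e + e * (sqrt E2)\<^sup>2)"
    using e0 E20 by (simp add: eL W22_rep_L2norm_weak_deriv[OF ab re] E2_def)
  moreover have "0 \<le> K\<^sub>\<sigma>"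
    by (rule sobolev_constant_nonneg[OF _ _ K]) (use len d0 in \<open>auto simp: ba less_max_iff_disj\<close>)
  ultimately have "sqrt E1 \<le> C3' K\<^sub>\<sigma> s \<beta> \<gamma> \<delta> * \<tau> powr (1/4) + C4' K\<^sub>\<sigma> s \<beta> \<gamma> \<delta> * d"
    using ar(2)[OF _ _ e_def] S0 E20 by simp
  moreover have "L2norm a b (deriv e\<^sub>N) = sqrt E1" unfolding E1_def by (rule L2)
  ultimately show "L2norm (real p * d) (real q * d) (deriv e\<^sub>N) \<le> C3' K\<^sub>\<sigma> s \<beta> \<gamma> \<delta> * \<tau> powr (1/4) + C4' K\<^sub>\<sigma> s \<beta> \<gamma> \<delta> / real M"
    by (simp add: a_def b_def d)
qed

section \<open>Tail bounds for the observation points\<close>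

context prob_space
begin

lemma expectation_indicator_ge:
  fixes X :: "'a \<Rightarrow> real"
  assumes X: "distributed M lborel X (\<lambda>t. ennreal (indicator {0..1} t * \<rho> t))"
    and \<rho>: "continuous_on {0..1} \<rho>" "\<And>t. t \<in> {0..1} \<Longrightarrow> 0 \<le> \<rho> t"
    and ab: "0 \<le> a" "a \<le> b" "b \<le> 1" and \<gamma>: "\<And>t. t \<in> {a<..<b} \<Longrightarrow> \<gamma> \<le> \<rho> t"
  shows "\<gamma> * (b - a) \<le> expectation (\<lambda>\<omega>. indicator {a<..<b} (X \<omega>))"
proof -
  have sub: "{a<..<b} \<subseteq> {0..1}" using ab by auto
  have c: "set_integrable lborel {a<..<b} h" if "continuous_on {0..1} h" for h :: "real \<Rightarrow> real"
    by (rule set_integrable_subset[OF borel_integrable_atLeastAtMost'[OF that] _ sub]) simp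
  have "expectation (\<lambda>\<omega>. indicator {a<..<b} (X \<omega>)) = (LINT t|lborel. (indicator {0..1} t * \<rho> t) * indicator {a<..<b} t)"
    by (rule distributed_integral[OF X, symmetric]) (auto simp: \<rho> split: split_indicator)
  also have "\<dots> = (LINT t:{a<..<b}|lborel. \<rho> t)"
    unfolding set_lebesgue_integral_def using sub
    by (intro Bochner_Integration.integral_cong) (auto split: split_indicator)
  also have "\<dots> \<ge> (LINT t:{a<..<b}|lborel. \<gamma>)"
    by (rule set_integral_mono) (auto intro: c \<rho> \<gamma>)
  also have "(LINT t:{a<..<b}|lborel. \<gamma>) = \<gamma> * (b - a)"
    using ab by (simp add: set_lebesgue_integral_def mult.commute)
  finally show ?thesis .
qed

lemma expectation_continuous_le:
  fixes X :: "'a \<Rightarrow> real"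
  assumes X: "distributed M lborel X (\<lambda>t. ennreal (indicator {0..1} t * \<rho> t))"
    and \<rho>: "continuous_on {0..1} \<rho>" "\<And>t. t \<in> {0..1} \<Longrightarrow> 0 \<le> \<rho> t" "\<And>t. t \<in> {0..1} \<Longrightarrow> \<rho> t \<le> \<beta>"
    and v: "continuous_on {0..1} v" "\<And>t. t \<in> {0..1} \<Longrightarrow> 0 \<le> v t"
  shows "expectation (\<lambda>\<omega>. indicator {0..1} (X \<omega>) * v (X \<omega>)) \<le> \<beta> * integral {0..1} v"
proof -
  have vm: "(\<lambda>t. indicator {0..1} t * v t) \<in> borel_measurable borel"
    using borel_measurable_continuous_on_indicator[OF _ v(1)] by simp
  have "expectation (\<lambda>\<omega>. indicator {0..1} (X \<omega>) * v (X \<omega>)) = (LINT t|lborel. (indicator {0..1} t * \<rho> t) * (indicator {0..1} t * v t))"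
    by (rule distributed_integral[OF X, symmetric]) (use vm in \<open>auto simp: \<rho> split: split_indicator\<close>)
  also have "\<dots> = (LINT t:{0..1}|lborel. \<rho> t * v t)"
    unfolding set_lebesgue_integral_def
    by (intro Bochner_Integration.integral_cong) (auto split: split_indicator)
  also have "\<dots> \<le> (LINT t:{0..1}|lborel. \<beta> * v t)"
    by (intro set_integral_mono borel_integrable_atLeastAtMost' continuous_intros \<rho> v mult_right_mono)
  also have "\<dots> = integral {0..1} (\<lambda>t. \<beta> * v t)"
    by (intro set_borel_integral_eq_integral borel_integrable_atLeastAtMost' continuous_intros v)
  finally show ?thesis by simp
qed

text \<open>The Chernoff bound with t = -1. As exp (-1) is at most 3/8, the exponent is at most (3/8
  - 1 + 1/2) times the expected lower bound on the count, that is -1/8 of it.\<close>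

lemma few_points_prob:
  fixes x :: "nat \<Rightarrow> 'a \<Rightarrow> real"
  assumes I: "finite I" and ind: "indep_vars (\<lambda>_. borel) x I" and A: "A \<in> sets borel" and \<mu>: "0 \<le> \<mu>"
    and E: "\<And>i. i \<in> I \<Longrightarrow> \<mu> \<le> expectation (\<lambda>\<omega>. indicator A (x i \<omega>))"
  shows "prob {\<omega> \<in> space M. (\<Sum>i\<in>I. indicator A (x i \<omega>)) \<le> real (card I) * \<mu> / 2} \<le> exp (- (real (card I) * \<mu> / 8))"
proof -
  have e1: "exp (- 1) \<le> (3/8 :: real)"
  proof -
    \<comment> \<open>The quadratic Taylor polynomial at 1/4 is 1 + 1/4 + 1/32 = 41/32, and its
      fourth power exceeds 8/3.\<close>
    have "(41/32)^4 \<le> exp (1/4 :: real) ^ 4"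
      using exp_lower_Taylor_quadratic[of "1/4::real"] by (intro power_mono) (auto simp: power2_eq_square)
    also have "exp (1/4 :: real) ^ 4 = exp 1" by (simp add: exp_of_nat_mult[symmetric])
    finally have "8/3 \<le> exp (1::real)" by (simp add: power4_eq_xxxx)
    then show ?thesis by (simp add: exp_minus field_simps)
  qed
  have ind': "indep_vars (\<lambda>_. borel) (\<lambda>i \<omega>. indicat_real A (x i \<omega>)) I"
    by (rule indep_vars_compose2[OF ind]) (use A in simp)
  have "prob {\<omega> \<in> space M. - (real (card I) * \<mu> / 2) \<le> - 1 * (\<Sum>i\<in>I. indicator A (x i \<omega>))}
     \<le> exp (real (card I) * (exp (- 1) - 1) * \<mu> - - (real (card I) * \<mu> / 2))"
  proof (rule Chernoff_bound[OF I ind'])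
    show "(exp (- 1) - 1) * expectation (\<lambda>\<omega>. indicator A (x i \<omega>)) \<le> (exp (- 1) - 1) * \<mu>" if "i \<in> I" for i
      using E[OF that] e1 by (intro mult_left_mono_neg) auto
  qed (auto split: split_indicator)
  also have "\<dots> \<le> exp (- (real (card I) * \<mu> / 8))"
  proof -
    have "real (card I) * \<mu> * exp (- 1) \<le> real (card I) * \<mu> * (3/8)"
      using e1 \<mu> by (intro mult_left_mono) auto
    then show ?thesis by (simp add: algebra_simps)
  qed
  finally show ?thesis by simp
qed

text \<open>The Chernoff bound with t = 1. The factor 9/4 leaves 3 - 1 - 9/4 = -1/4 in the exponent
  when exp 1 is replaced by 3, which is more than the -1/8 needed to match the cell bound.\<close>

lemma large_sum_prob:
  fixes x :: "nat \<Rightarrow> 'a \<Rightarrow> real" and h :: "real \<Rightarrow> real"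
  assumes I: "finite I" and ind: "indep_vars (\<lambda>_. borel) x I" and h: "h \<in> borel_measurable borel" and \<mu>: "0 \<le> \<mu>"
    and h01: "\<And>t. h t \<in> {0..1}"
    and E: "\<And>i. i \<in> I \<Longrightarrow> expectation (\<lambda>\<omega>. h (x i \<omega>)) \<le> \<mu>"
  shows "prob {\<omega> \<in> space M. 9/4 * real (card I) * \<mu> \<le> (\<Sum>i\<in>I. h (x i \<omega>))} \<le> exp (- (real (card I) * \<mu> / 8))"
proof -
  have ind': "indep_vars (\<lambda>_. borel) (\<lambda>i \<omega>. h (x i \<omega>)) I"
    by (rule indep_vars_compose2[OF ind]) (use h in simp)
  have "prob {\<omega> \<in> space M. 9/4 * real (card I) * \<mu> \<le> 1 * (\<Sum>i\<in>I. h (x i \<omega>))}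
     \<le> exp (real (card I) * (exp 1 - 1) * \<mu> - 9/4 * real (card I) * \<mu>)"
    by (rule Chernoff_bound[OF I ind']) (use h01 E in \<open>auto intro!: mult_left_mono\<close>)
  also have "\<dots> \<le> exp (- (real (card I) * \<mu> / 8))"
  proof -
    have "real (card I) * \<mu> * exp 1 \<le> real (card I) * \<mu> * 3"
      using exp_le \<mu> by (intro mult_left_mono) auto
    moreover have "0 \<le> real (card I) * \<mu>" using \<mu> by simp
    ultimately show ?thesis by (simp add: algebra_simps)
  qed
  finally show ?thesis by simp
qed

end

text \<open>The condition on \<open>N\<close> has the square of c = \<gamma> d in the denominator;
  one factor c is exchanged for 1/m through m c \<le> 1, so the exponential is at most
  (\<delta>/4)^m. The number of events m + 1 is at most 2^m, and (\<delta>/2)^m is at most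
  \<delta>/2.\<close>

lemma exceptional_prob_arithmetic:
  fixes N \<gamma> d \<delta> :: real and m :: nat
  assumes m: "1 \<le> m" "real m * (\<gamma> * d) \<le> 1" and pos: "0 < \<gamma>" "0 < d" and \<delta>: "0 < \<delta>" "\<delta> < 1"
    and N: "8 * ln (4 / \<delta>) / (\<gamma>\<^sup>2 * d\<^sup>2) \<le> N"
  shows "real (m + 1) * exp (- (N * (\<gamma> * d) / 8)) \<le> \<delta> / 2"
proof -
  define c where "c = \<gamma> * d"
  define l where "l = ln (4 / \<delta>)"
  have c: "0 < c" using pos by (simp add: c_def)
  have l: "0 \<le> l" using \<delta> unfolding l_def by (intro ln_ge_zero) (simp add: le_divide_eq)
  have "8 * l / (c * c) \<le> N" using N by (simp add: c_def l_def power2_eq_square mult_ac)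
  then have "8 * l \<le> N * c * c" using c by (simp add: divide_le_eq mult.assoc)
  moreover have "real m * c * (8 * l) \<le> 1 * (8 * l)"
    using m(2) l unfolding c_def[symmetric] by (intro mult_right_mono) auto
  ultimately have "(8 * real m * l) * c \<le> (N * c) * c" by (simp add: mult_ac)
  then have "8 * real m * l \<le> N * c" by (rule mult_right_le_imp_le) (rule c)
  then have "exp (- (N * c / 8)) \<le> exp (real m * (- l))" by simp
  also have "\<dots> = (\<delta> / 4) ^ m"
    using \<delta> by (simp only: exp_of_nat_mult) (simp add: l_def exp_minus)
  finally have ex: "exp (- (N * c / 8)) \<le> (\<delta> / 4) ^ m" .
  have "real (m + 1) * exp (- (N * c / 8)) \<le> 2 ^ m * (\<delta> / 4) ^ m"
  proof (rule mult_mono[OF _ ex])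
    have "m + 1 \<le> 2 ^ m" using Suc_leI[OF less_exp[of m]] by (simp only: Suc_eq_plus1)
    then show "real (m + 1) \<le> 2 ^ m" by (metis of_nat_le_iff of_nat_numeral of_nat_power)
  qed auto
  also have "\<dots> = (\<delta> / 2) ^ m" by (simp add: power_mult_distrib[symmetric])
  also have "\<dots> \<le> (\<delta> / 2) ^ 1" using m \<delta> by (intro power_decreasing) auto
  finally show ?thesis by (simp add: c_def)
qed

theorem theorem3p21:
  fixes P :: "'a measure"
    and M N p q :: nat
    and d \<sigma> \<alpha> \<beta> \<gamma> \<delta> K\<^sub>\<sigma> :: real
    and f \<rho> F :: "real \<Rightarrow> real"
    and x \<eta> y :: "nat \<Rightarrow> 'a \<Rightarrow> real"
    and f\<^sub>N e\<^sub>N :: "'a \<Rightarrow> real \<Rightarrow> real"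
  assumes "prob_space P"
    and "M \<ge> 3" and "d = 1 / real M"
    and "f \<in> W22 0 1"
    \<comment> \<open>observation points\<close>
    and "\<And>i \<omega>. i \<in> {1..N} \<Longrightarrow> \<omega> \<in> space P \<Longrightarrow> x i \<omega> \<in> {0..1}"
    and "prob_space.indep_vars P (\<lambda>_. borel) x {1..N}"
    and "\<And>i. i \<in> {1..N} \<Longrightarrow> cdf (distr P borel (x i)) = F"
    and "\<And>i. i \<in> {1..N} \<Longrightarrow> distributed P lborel (x i) (\<lambda>t. ennreal (indicator {0..1} t * \<rho> t))"
    and "continuous_on {0..1} \<rho>" and "\<And>t. t \<in> {0..1} \<Longrightarrow> \<rho> t \<ge> 0"
    \<comment> \<open>noise\<close>
    and "\<sigma> \<ge> 0"
    and "\<And>i. i \<in> {1..N} \<Longrightarrow> integrable P (\<eta> i)"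
    and "\<And>i. i \<in> {1..N} \<Longrightarrow> integral\<^sup>L P (\<eta> i) = 0"
    and "\<And>i j. i \<in> {1..N} \<Longrightarrow> j \<in> {1..N} \<Longrightarrow> integrable P (\<lambda>\<omega>. \<eta> i \<omega> * \<eta> j \<omega>)"
    and "\<And>i j. i \<in> {1..N} \<Longrightarrow> j \<in> {1..N} \<Longrightarrow>
           integral\<^sup>L P (\<lambda>\<omega>. \<eta> i \<omega> * \<eta> j \<omega>) = (if i = j then \<sigma>\<^sup>2 else 0)"
    and "prob_space.indep_var P
           (Pi\<^sub>M {1..N} (\<lambda>_. borel)) (\<lambda>\<omega>. \<lambda>i\<in>{1..N}. x i \<omega>)
           (Pi\<^sub>M {1..N} (\<lambda>_. borel)) (\<lambda>\<omega>. \<lambda>i\<in>{1..N}. \<eta> i \<omega>)"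
    and "\<And>i \<omega>. y i \<omega> = f (x i \<omega>) + \<eta> i \<omega>"
    \<comment> \<open>density bounds\<close>
    and "(SUP t\<in>{0..1}. \<rho> t) \<le> \<beta>"
    and "p < q" and "q \<le> M" and "real q - real p \<ge> 2 * sqrt Kstar"
    and "(INF t\<in>{real p * d<..<real q * d}. \<rho> t) \<ge> \<gamma>" and "\<gamma> > 0"
    \<comment> \<open>the minimizer, which is unique on [0,1] when the points are not all identical\<close>
    and "\<alpha> = real M * \<sigma>\<^sup>2 / real N + d ^ 4"
    and "\<And>\<omega>. \<omega> \<in> space P \<Longrightarrow> \<not> (\<exists>c. \<forall>i\<in>{1..N}. x i \<omega> = c) \<Longrightarrow>
           is_arg_min (tikhonov N (\<lambda>i. x i \<omega>) \<alpha> (\<lambda>i. y i \<omega>)) (\<lambda>g. g \<in> spline_space M) (f\<^sub>N \<omega>)"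
    and "\<And>\<omega> t. e\<^sub>N \<omega> t = f\<^sub>N \<omega> t - f t"
    and "sobolev_constant K\<^sub>\<sigma> (max (sqrt \<sigma>) ((real q - real p) * d)) ((real q - real p) * d)"
    and "0 < \<delta>" and "\<delta> < 1"
    and "real N \<ge> max (real M) (8 * ln (4 / \<delta>) / (\<gamma>\<^sup>2 * d\<^sup>2))"
  shows "\<exists>A\<in>sets P. measure P A \<ge> 1 - \<delta> \<and> (\<forall>\<omega>\<in>A.
           L2norm (real p * d) (real q * d) (e\<^sub>N \<omega>)
             \<le> C1' (L2norm 0 1 (weak_deriv 2 0 1 f)) \<gamma> \<delta> * (real M * \<sigma>\<^sup>2 / real N) powr (1/2)
               + C2' (L2norm 0 1 (weak_deriv 2 0 1 f)) \<beta> \<gamma> \<delta> / (real M)\<^sup>2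
         \<and> L2norm (real p * d) (real q * d) (deriv (e\<^sub>N \<omega>))
             \<le> C3' K\<^sub>\<sigma> (L2norm 0 1 (weak_deriv 2 0 1 f)) \<beta> \<gamma> \<delta> * (real M * \<sigma>\<^sup>2 / real N) powr (1/4)
               + C4' K\<^sub>\<sigma> (L2norm 0 1 (weak_deriv 2 0 1 f)) \<beta> \<gamma> \<delta> / real M)"
proof -
  interpret prob_space P by (rule assms(1))
  note M3 = assms(2) and d = assms(3) and x01 = assms(5) and ind = assms(6) and dist = assms(8)
    and \<rho> = assms(9,10) and \<gamma>0 = assms(23) and \<delta> = assms(28,29)
  define m where "m = q - p"
  have M0: "0 < M" and MN: "M \<le> N" and N: "8 * ln (4 / \<delta>) / (\<gamma>\<^sup>2 * d\<^sup>2) \<le> real N"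
    using M3 assms(30) by auto
  have N0: "0 < N" using MN M0 by simp
  have d0: "0 < d" using M0 by (simp add: d)
  \<comment> \<open>Twice the square root of 32 is larger than 11, and q - p is an integer.\<close>
  have m12: "p + 12 \<le> q"
  proof -
    have "11 / 2 < sqrt (32::real)" by (rule real_less_rsqrt) (simp add: power2_eq_square)
    then have "real p + 11 < real q" using assms(21) by (simp add: Kstar_def)
    then show ?thesis by linarith
  qed
  then have m: "12 \<le> m" "real m = real q - real p" by (auto simp: m_def of_nat_diff)
  define a where "a = real p * d"
  define b where "b = real q * d"
  have b: "b = a + real m * d" by (simp add: a_def b_def m algebra_simps)
  have ab: "0 \<le> a" "a < b" "b \<le> 1"
  proof -
    show "0 \<le> a" using d0 by (simp add: a_def)
    show "a < b" using m d0 by (simp add: b)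
    show "b \<le> 1" using assms(20) M0 by (simp add: b_def d)
  qed
  have \<beta>: "\<rho> t \<le> \<beta>" if "t \<in> {0..1}" for t
  proof -
    have "compact (\<rho> ` {0..1})" by (intro compact_continuous_image \<rho>) auto
    then have "bdd_above (\<rho> ` {0..1})" by (intro bounded_imp_bdd_above compact_imp_bounded)
    then have "\<rho> t \<le> (SUP t\<in>{0..1}. \<rho> t)" using that by (rule cSUP_upper[rotated])
    then show ?thesis using assms(18) by linarith
  qed
  have \<gamma>: "\<gamma> \<le> \<rho> t" if "t \<in> {a<..<b}" for t
  proof -
    have "bdd_below (\<rho> ` {a<..<b})"
      using ab \<rho>(2) by (intro bdd_belowI2[of _ 0]) auto
    then have "(INF t\<in>{a<..<b}. \<rho> t) \<le> \<rho> t" using that by (rule cINF_lower)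
    then show ?thesis using assms(22) unfolding a_def b_def by linarith
  qed
  have \<gamma>\<beta>: "\<gamma> \<le> \<beta>"
    using \<gamma>[of "(a + b) / 2"] \<beta>[of "(a + b) / 2"] ab by simp
  then have \<beta>0: "0 \<le> \<beta>" using \<gamma>0 by simp
  obtain f1 where rep: "W22_rep 0 1 f f1 (weak_deriv 2 0 1 f)"
    using W22_obtain_rep[OF _ assms(4)] by auto
  define w where "w = weak_deriv 2 0 1 f"
  have rep: "W22_rep 0 1 f f1 w" using rep by (simp add: w_def)
  define s where "s = L2norm 0 1 w"
  have s2: "s\<^sup>2 = sq_integral 0 1 w"
    unfolding s_def by (rule square_integrable_power2(2)[OF W22_repD(4)[OF rep]])
  have s0: "0 \<le> s" by (simp add: s_def L2norm_def set_lebesgue_integral_def)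
  have s: "s = sqrt (sq_integral 0 1 w)" using s2 s0 by (metis real_sqrt_unique)
  define I where "I = {1..N}"
  have I: "finite I" "card I = N" by (auto simp: I_def)
  define \<kappa> where "\<kappa> = exp (- (real N * (\<gamma> * d) / 8))"

  \<comment> \<open>The probability of falling into \<open>I'\<close> is at least \<gamma> times its
    length m d, and it is at most 1.\<close>
  have m1: "real m * (\<gamma> * d) \<le> 1"
  proof -
    have 1: "1 \<in> {1..N}" using N0 by auto
    have "\<gamma> * (b - a) \<le> expectation (\<lambda>\<omega>. indicator {a<..<b} (x 1 \<omega>))"
      using ab by (intro expectation_indicator_ge[OF dist[OF 1] \<rho>] \<gamma>) auto
    also have "\<dots> \<le> expectation (\<lambda>\<omega>. 1)"
      by (intro integral_mono') (auto split: split_indicator)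
    finally show ?thesis by (simp add: b prob_space mult_ac)
  qed

  define cell where "cell j = {a + real j * d<..<a + real (Suc j) * d}" for j
  \<comment> \<open>The lower density bound gives each cell at least N \<gamma> d points on average;
    the event is that at most half of these occur.\<close>
  define B1 where "B1 j = {\<omega> \<in> space P. (\<Sum>i\<in>I. indicator (cell j) (x i \<omega>)) \<le> real N * (\<gamma> * d) / 2}" for j
  have xm [measurable]: "x i \<in> borel_measurable P" if "i \<in> I" for i
    using ind that by (auto simp: indep_vars_def I_def)
  have B1s: "B1 j \<in> sets P" for j unfolding B1_def cell_def by measurable
  have B1: "prob (B1 j) \<le> \<kappa>" if j: "j < m" for j
  proof -
    have "real (Suc j) * d \<le> real m * d" using j d0 by (intro mult_right_mono) auto
    then have jb: "a \<le> a + real j * d" "a + real j * d \<le> a + real (Suc j) * d" "a + real (Suc j) * d \<le> b"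
      using d0 by (auto simp: b)
    have "\<gamma> * d \<le> expectation (\<lambda>\<omega>. indicator (cell j) (x i \<omega>))" if "i \<in> I" for i
    proof -
      have "\<gamma> * ((a + real (Suc j) * d) - (a + real j * d)) \<le> expectation (\<lambda>\<omega>. indicator (cell j) (x i \<omega>))"
        unfolding cell_def using that jb ab
        by (intro expectation_indicator_ge[OF dist \<rho>] \<gamma>) (auto simp: I_def)
      then show ?thesis by (simp add: algebra_simps)
    qed
    then show ?thesis
      using few_points_prob[OF I(1) ind[folded I_def], of "cell j" "\<gamma> * d"] \<gamma>0 d0
      by (simp add: B1_def \<kappa>_def I(2) cell_def)
  qed

  define g where "g = quasi_interpolant M f"
  \<comment> \<open>The indicator keeps the summands measurable, because \<open>f\<close> is
    constrained on the unit interval only; it equals 1 at all observation points.\<close>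
  define B2 where "B2 = {\<omega> \<in> space P. real N * (9/4 * \<beta> * s\<^sup>2 * d ^ 4) < (\<Sum>i\<in>I. indicator {0..1} (x i \<omega>) * (g (x i \<omega>) - f (x i \<omega>))\<^sup>2)}"
  have gf: "continuous_on {0..1} (\<lambda>t. (g t - f t)\<^sup>2)"
    unfolding g_def
    by (intro continuous_intros continuous_at_imp_continuous_on ballI
        DERIV_isCont[OF quasi_interpolant_has_derivative(1)[OF M0]] W22_repD(2)[OF rep])
  have gfm [measurable]: "(\<lambda>t. indicator {0..1} t * (g t - f t)\<^sup>2) \<in> borel_measurable borel"
    using borel_measurable_continuous_on_indicator[OF _ gf] by simp
  have B2s: "B2 \<in> sets P"
  proof -
    have [measurable]: "(\<lambda>\<omega>. indicator {0..1} (x i \<omega>) * (g (x i \<omega>) - f (x i \<omega>))\<^sup>2) \<in> borel_measurable P" if "i \<in> I" for i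
      using measurable_compose[OF xm[OF that] gfm] .
    show ?thesis unfolding B2_def by measurable
  qed
  have gb: "(g t - f t)\<^sup>2 \<le> s\<^sup>2 * d ^ 3" if "t \<in> {0..1}" for t
    using quasi_interpolant_bounds(2)[OF M0 rep that] by (simp add: g_def s2 d power_divide)
  have gi: "integral {0..1} (\<lambda>t. (g t - f t)\<^sup>2) \<le> s\<^sup>2 * d ^ 4"
    using quasi_interpolant_bounds(3)[OF M0 rep] by (simp add: g_def s2 d power_divide)
  have B2: "prob B2 \<le> \<kappa>"
  \<comment> \<open>For s = 0 the normalisation of \<open>h\<close> would divide by 0, but then g
    and f coincide on the unit interval.\<close>
  proof (cases "s = 0")
    case True
    have "B2 = {}"
    proof -
      have z: "indicator {0..1} t * (g t - f t)\<^sup>2 = 0" for t :: real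
        using gb[of t] True by (auto split: split_indicator)
      show ?thesis unfolding B2_def z by (simp add: True)
    qed
    then show ?thesis by (simp add: \<kappa>_def)
  next
    case False
    then have sp: "0 < s\<^sup>2 * d ^ 3" using d0 by simp
    \<comment> \<open>Dividing by the uniform bound gives values in the unit interval, as the
      Chernoff bound requires, and the quotient of d^4 and d^3 leaves the mean bound \<beta>
      d.\<close>
    define h where "h t = indicator {0..1} t * (g t - f t)\<^sup>2 / (s\<^sup>2 * d ^ 3)" for t
    have hm: "h \<in> borel_measurable borel" unfolding h_def[abs_def] by measurable
    have h01: "h t \<in> {0..1}" for t
      using gb[of t] sp by (auto simp: h_def divide_le_eq split: split_indicator)
    have hE: "expectation (\<lambda>\<omega>. h (x i \<omega>)) \<le> \<beta> * d" if "i \<in> I" for i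
    proof -
      have "expectation (\<lambda>\<omega>. indicator {0..1} (x i \<omega>) * (g (x i \<omega>) - f (x i \<omega>))\<^sup>2) \<le> \<beta> * integral {0..1} (\<lambda>t. (g t - f t)\<^sup>2)"
        using that by (intro expectation_continuous_le[OF dist \<rho> \<beta> gf]) (auto simp: I_def)
      also have "\<dots> \<le> \<beta> * (s\<^sup>2 * d ^ 4)" using \<beta>0 gi by (intro mult_left_mono)
      finally have "expectation (\<lambda>\<omega>. indicator {0..1} (x i \<omega>) * (g (x i \<omega>) - f (x i \<omega>))\<^sup>2) / (s\<^sup>2 * d ^ 3) \<le> \<beta> * (s\<^sup>2 * d ^ 4) / (s\<^sup>2 * d ^ 3)"
        using sp by (intro divide_right_mono) auto
      also have "\<dots> = \<beta> * d" using False d0 by (simp add: power4_eq_xxxx power3_eq_cube)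
      finally show ?thesis by (simp add: h_def)
    qed
    have "B2 \<subseteq> {\<omega> \<in> space P. 9/4 * real (card I) * (\<beta> * d) \<le> (\<Sum>i\<in>I. h (x i \<omega>))}"
    proof
      fix \<omega> assume "\<omega> \<in> B2"
      then have *: "\<omega> \<in> space P" "real N * (9/4 * \<beta> * s\<^sup>2 * d ^ 4) \<le> (\<Sum>i\<in>I. indicator {0..1} (x i \<omega>) * (g (x i \<omega>) - f (x i \<omega>))\<^sup>2)"
        by (auto simp: B2_def)
      have "9/4 * real N * (\<beta> * d) = real N * (9/4 * \<beta> * s\<^sup>2 * d ^ 4) / (s\<^sup>2 * d ^ 3)"
        using False d0 by (simp add: power4_eq_xxxx power3_eq_cube)
      also have "\<dots> \<le> (\<Sum>i\<in>I. indicator {0..1} (x i \<omega>) * (g (x i \<omega>) - f (x i \<omega>))\<^sup>2) / (s\<^sup>2 * d ^ 3)"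
        using * sp by (intro divide_right_mono) auto
      also have "\<dots> = (\<Sum>i\<in>I. h (x i \<omega>))" by (simp add: h_def sum_divide_distrib)
      finally show "\<omega> \<in> {\<omega> \<in> space P. 9/4 * real (card I) * (\<beta> * d) \<le> (\<Sum>i\<in>I. h (x i \<omega>))}"
        using * by (simp add: I(2))
    qed
    moreover have "{\<omega> \<in> space P. 9/4 * real (card I) * (\<beta> * d) \<le> (\<Sum>i\<in>I. h (x i \<omega>))} \<in> sets P"
    proof -
      have [measurable]: "(\<lambda>\<omega>. h (x i \<omega>)) \<in> borel_measurable P" if "i \<in> I" for i
        using measurable_compose[OF xm[OF that] hm] .
      show ?thesis by measurable
    qed
    ultimately have "prob B2 \<le> prob {\<omega> \<in> space P. 9/4 * real (card I) * (\<beta> * d) \<le> (\<Sum>i\<in>I. h (x i \<omega>))}"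
      by (rule finite_measure_mono)
    also have "\<dots> \<le> exp (- (real (card I) * (\<beta> * d) / 8))"
      using \<beta>0 d0 by (intro large_sum_prob[OF I(1) ind[folded I_def] hm _ h01 hE]) auto
    \<comment> \<open>Because \<gamma> is at most \<beta>, the probability bound for a single cell
      covers this event too.\<close>
    also have "\<dots> \<le> \<kappa>"
      using \<gamma>\<beta> d0 by (auto simp: \<kappa>_def I(2) intro!: mult_left_mono)
    finally show ?thesis .
  qed

  define \<phi> where "\<phi> k X i = spline_basis M k (X i)" for k :: nat and X :: "nat \<Rightarrow> real" and i :: nat
  have \<phi>m: "(\<lambda>X. \<phi> k X i) \<in> borel_measurable (Pi\<^sub>M I (\<lambda>_. borel))" if "i \<in> I" for k i
  proof -
    have "spline_basis M k \<in> borel_measurable borel"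
      unfolding spline_basis_def[abs_def] tpow_def by (cases "k < 3") simp_all
    from measurable_compose[OF measurable_component_singleton[OF that] this] show ?thesis by (simp add: \<phi>_def)
  qed
  define n where "n = M + 3"
  have "\<exists>c. (\<forall>k<n. \<forall>i\<in>I. (\<lambda>X. c k X i) \<in> borel_measurable (Pi\<^sub>M I (\<lambda>_. borel))) \<and>
     (\<forall>X. \<forall>k<n. \<forall>l<k. (\<Sum>i\<in>I. c k X i * c l X i) = 0) \<and>
     (\<forall>X e. \<exists>e'. \<forall>i\<in>I. (\<Sum>k<n. e k * \<phi> k X i) = (\<Sum>k<n. e' k * c k X i))"
    by (rule measurable_Gram_Schmidt[OF I(1)]) (rule \<phi>m)
  then obtain c where c: "(\<forall>k<n. \<forall>i\<in>I. (\<lambda>X. c k X i) \<in> borel_measurable (Pi\<^sub>M I (\<lambda>_. borel))) \<and>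
     (\<forall>X. \<forall>k<n. \<forall>l<k. (\<Sum>i\<in>I. c k X i * c l X i) = 0) \<and>
     (\<forall>X e. \<exists>e'. \<forall>i\<in>I. (\<Sum>k<n. e k * \<phi> k X i) = (\<Sum>k<n. e' k * c k X i))"
    by (elim exE)
  define X where "X \<omega> = (\<lambda>i\<in>I. x i \<omega>)" for \<omega>
  define Qk where "Qk k \<omega> = (\<Sum>i\<in>I. \<eta> i \<omega> * c k (X \<omega>) i)\<^sup>2 / (\<Sum>i\<in>I. (c k (X \<omega>) i)\<^sup>2)" for k \<omega>
  define Q where "Q \<omega> = (\<Sum>k<n. Qk k \<omega>)" for \<omega>
  have Qk: "integrable P (Qk k)" "expectation (Qk k) \<le> \<sigma>\<^sup>2" if "k < n" for k
  proof -
    have cm: "\<And>i. i \<in> I \<Longrightarrow> (\<lambda>X. c k X i) \<in> borel_measurable (Pi\<^sub>M I (\<lambda>_. borel))" using c that by blast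
    note pe = projected_noise_expectation[OF I(1) cm assms(14,15,16)[folded I_def]]
    show "integrable P (Qk k)" "expectation (Qk k) \<le> \<sigma>\<^sup>2"
      unfolding Qk_def[abs_def] X_def using pe by simp_all
  qed
  have Q0: "0 \<le> Q \<omega>" for \<omega> unfolding Q_def Qk_def by (intro sum_nonneg divide_nonneg_nonneg) auto
  have Qi: "integrable P Q" unfolding Q_def[abs_def] by (intro Bochner_Integration.integrable_sum Qk) auto
  \<comment> \<open>The number M + 3 of basis functions is at most 2 M since M is at least
    3.\<close>
  have QE: "expectation Q \<le> 2 * real M * \<sigma>\<^sup>2"
  proof -
    have "expectation Q = (\<Sum>k<n. expectation (Qk k))"
      unfolding Q_def[abs_def] by (intro Bochner_Integration.integral_sum Qk) auto
    also have "\<dots> \<le> (\<Sum>k<n. \<sigma>\<^sup>2)" by (intro sum_mono Qk) auto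
    also have "\<dots> = real n * \<sigma>\<^sup>2" by simp
    also have "\<dots> \<le> (2 * real M) * \<sigma>\<^sup>2" using M3 by (intro mult_right_mono) (auto simp: n_def)
    finally show ?thesis .
  qed
  \<comment> \<open>Half of \<delta> is spent on the noise, so Markov's inequality turns the mean
    bound 2 M \<sigma>^2 into 4 M \<sigma>^2 / \<delta>.\<close>
  define B3 where "B3 = {\<omega> \<in> space P. 2 * real M * \<sigma>\<^sup>2 / (\<delta> / 2) < Q \<omega>}"
  have B3s: "B3 \<in> sets P"
    using borel_measurable_integrable[OF Qi] unfolding B3_def by measurable
  have B3: "prob B3 \<le> \<delta> / 2"
    unfolding B3_def using \<delta> by (intro Markov_event[OF Qi Q0 QE]) auto

  \<comment> \<open>The m cell events and \<open>B2\<close> are the m + 1 events that share the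
    other half of \<delta>.\<close>
  define B where "B = (\<Union>j<m. B1 j) \<union> B2 \<union> B3"
  have Bs: "B \<in> sets P" unfolding B_def using B1s B2s B3s by auto
  have PB: "prob B \<le> \<delta>"
  proof -
    have "prob B \<le> prob ((\<Union>j<m. B1 j) \<union> B2) + prob B3"
      unfolding B_def using B1s B2s B3s by (intro measure_Un_le) auto
    moreover have "prob ((\<Union>j<m. B1 j) \<union> B2) \<le> prob (\<Union>j<m. B1 j) + prob B2"
      using B1s B2s by (intro measure_Un_le) auto
    moreover have "prob (\<Union>j<m. B1 j) \<le> (\<Sum>j<m. prob (B1 j))"
      using B1s by (intro measure_UNION_le) auto
    moreover have "(\<Sum>j<m. prob (B1 j)) \<le> (\<Sum>j<m. \<kappa>)" by (intro sum_mono B1) auto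
    moreover have "(\<Sum>j<m. \<kappa>) + \<kappa> = real (m + 1) * \<kappa>" by (simp add: algebra_simps)
    moreover have "real (m + 1) * \<kappa> \<le> \<delta> / 2"
      unfolding \<kappa>_def using m by (intro exceptional_prob_arithmetic[OF _ m1 \<gamma>0 d0 \<delta> N]) auto
    ultimately show ?thesis using B2 B3 by linarith
  qed
  show ?thesis
  proof (intro bexI[of _ "space P - B"] conjI ballI)
    show "space P - B \<in> sets P" using Bs by auto
    show "1 - \<delta> \<le> prob (space P - B)" using prob_compl[OF Bs] PB by simp
  next
    fix \<omega> assume "\<omega> \<in> space P - B"
    then have \<omega>: "\<omega> \<in> space P" and nB: "\<And>j. j < m \<Longrightarrow> \<omega> \<notin> B1 j" "\<omega> \<notin> B2" "\<omega> \<notin> B3"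
      by (auto simp: B_def)
    have cells: "real N * \<gamma> * d / 2 < real (card {i\<in>{1..N}. x i \<omega> \<in> cell j})" if "j < m" for j
    proof -
      have "real (card {i\<in>I. x i \<omega> \<in> cell j}) = (\<Sum>i\<in>I. indicator (cell j) (x i \<omega>))"
        using I(1) by (simp add: indicator_def sum.If_cases Int_def)
      then show ?thesis using nB(1)[OF that] \<omega> by (simp add: B1_def I_def mult.assoc)
    qed
    \<comment> \<open>The disjoint cells 0 and 1 both contain points, so the points are not all
      identical and the hypothesis on the minimizer applies.\<close>
    have nid: "\<not> (\<exists>c. \<forall>i\<in>{1..N}. x i \<omega> = c)"
    proof
      assume "\<exists>c. \<forall>i\<in>{1..N}. x i \<omega> = c"
      then obtain c where c: "\<And>i. i \<in> {1..N} \<Longrightarrow> x i \<omega> = c" by blast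
      have "c \<in> cell j" if "j < m" for j
      proof -
        have "0 < real N * \<gamma> * d / 2" using N0 \<gamma>0 d0 by simp
        then have "0 < card {i\<in>{1..N}. x i \<omega> \<in> cell j}" using cells[OF that] by linarith
        then have "{i\<in>{1..N}. x i \<omega> \<in> cell j} \<noteq> {}" by (metis card.empty less_irrefl)
        then show ?thesis using c by auto
      qed
      from this[of 0] this[of 1] m show False by (auto simp: cell_def)
    qed
    have min: "is_arg_min (tikhonov N (\<lambda>i. x i \<omega>) \<alpha> (\<lambda>i. y i \<omega>)) (\<lambda>g. g \<in> spline_space M) (f\<^sub>N \<omega>)"
      by (rule assms(25)[OF \<omega> nid])
    have u: "(\<Sum>i=1..N. (quasi_interpolant M f (x i \<omega>) - f (x i \<omega>))\<^sup>2) \<le> real N * (9/4 * \<beta> * s\<^sup>2 * d ^ 4)"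
    proof -
      have "(\<Sum>i\<in>I. indicator {0..1} (x i \<omega>) * (g (x i \<omega>) - f (x i \<omega>))\<^sup>2) = (\<Sum>i=1..N. (quasi_interpolant M f (x i \<omega>) - f (x i \<omega>))\<^sup>2)"
        using x01[OF _ \<omega>] by (intro sum.cong) (auto simp: I_def g_def)
      then show ?thesis using nB(2) \<omega> by (simp add: B2_def)
    qed
    have Q4: "Q \<omega> \<le> 4 * real M * \<sigma>\<^sup>2 / \<delta>" using nB(3) \<omega> by (simp add: B3_def)
    have Qv: "(\<Sum>i=1..N. \<eta> i \<omega> * v (x i \<omega>))\<^sup>2 \<le> Q \<omega> * (\<Sum>i=1..N. (v (x i \<omega>))\<^sup>2)" if v: "v \<in> spline_space M" for v
    proof -
      obtain e where e: "\<And>t. t \<in> {0..1} \<Longrightarrow> v t = (\<Sum>k<M + 3. e k * spline_basis M k t)"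
        using spline_space_basis[OF M0 v] by blast
      obtain e' where e': "\<forall>i\<in>I. (\<Sum>k<n. e k * \<phi> k (X \<omega>) i) = (\<Sum>k<n. e' k * c k (X \<omega>) i)"
        using c by blast
      have "(\<Sum>i\<in>I. \<eta> i \<omega> * v (x i \<omega>))\<^sup>2 \<le> (\<Sum>k<n. (\<Sum>i\<in>I. \<eta> i \<omega> * c k (X \<omega>) i)\<^sup>2 / (\<Sum>i\<in>I. (c k (X \<omega>) i)\<^sup>2)) * (\<Sum>i\<in>I. (v (x i \<omega>))\<^sup>2)"
      proof (rule orthogonal_projection_bound[OF I(1)])
        show "(\<Sum>i\<in>I. c k (X \<omega>) i * c l (X \<omega>) i) = 0" if "k < n" "l < k" for k l using c that by blast
        show "v (x i \<omega>) = (\<Sum>k<n. e' k * c k (X \<omega>) i)" if "i \<in> I" for i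
          using e' e[OF x01[OF _ \<omega>]] that by (simp add: \<phi>_def X_def I_def n_def)
      qed
      then show ?thesis by (simp add: Q_def Qk_def I_def)
    qed
    have eN: "e\<^sub>N \<omega> = (\<lambda>t. f\<^sub>N \<omega> t - f t)" using assms(26) by (intro ext)
    note bound = deterministic_error_bound[OF M3 MN d assms(11) \<beta>0 \<gamma>0 \<delta>(1) m12 assms(20) rep x01[OF _ \<omega>] assms(17) assms(24)
      min assms(27) less_imp_le[OF cells[unfolded m_def cell_def a_def]] s u Q0 Q4 Qv, folded eN]
    show "L2norm (real p * d) (real q * d) (e\<^sub>N \<omega>)
             \<le> C1' (L2norm 0 1 (weak_deriv 2 0 1 f)) \<gamma> \<delta> * (real M * \<sigma>\<^sup>2 / real N) powr (1/2)
               + C2' (L2norm 0 1 (weak_deriv 2 0 1 f)) \<beta> \<gamma> \<delta> / (real M)\<^sup>2"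
      using bound(1) unfolding s_def w_def .
    show "L2norm (real p * d) (real q * d) (deriv (e\<^sub>N \<omega>))
             \<le> C3' K\<^sub>\<sigma> (L2norm 0 1 (weak_deriv 2 0 1 f)) \<beta> \<gamma> \<delta> * (real M * \<sigma>\<^sup>2 / real N) powr (1/4)
               + C4' K\<^sub>\<sigma> (L2norm 0 1 (weak_deriv 2 0 1 f)) \<beta> \<gamma> \<delta> / real M"
      using bound(2) unfolding s_def w_def .
  qed
qed

end
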